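(* Let $n \geq 1$, let $x_1, \ldots, x_n \in \mathbb{R}$, let $\mu_n = \sum_{i=1}^n \frac{1}{n}\delta_{x_i}$, and let $\hat{\mu}_n$ be the $2$-Wasserstein projection of $\mu_n$ onto the set $\mathcal{F}_{lc}$ of log-concave distributions on $\mathbb{R}$, that is, the unique minimizer of $\nu \mapsto \mathcal{W}_2(\nu,\mu_n)$ over $\nu \in \mathcal{F}_{lc}$. If $\mu_n$ is a point mass, then $\hat{\mu}_n = \mu_n$. Otherwise, $\hat{\mu}_n$ has a compactly supported density with respect to Lebesgue measure which is piecewise log-affine with finitely many pieces.
   Context: A Borel probability measure $\mu$ on $\mathbb{R}$ is log-concave if it is either a point mass, or has a density $f$ with respect to Lebesgue measure such that $\log f : \mathbb{R} \to [-\infty,\infty)$ is concave. $\mathcal{F}_{lc}$ denotes the set of all log-concave distributions on $\mathbb{R}$; every element has finite moments of all orders. For Borel probability measures $\mu,\nu$ on $\mathbb{R}$ with finite second moment, $\mathcal{W}_2(\mu,\nu) = \left(\inf_\pi \int |x-y|^2\,d\pi(x,y)\right)^{1/2}$, the infimum being over all couplings $\pi$ of $\mu$ and $\nu$; equivalently $\mathcal{W}_2(\mu,\nu) = \left(\int_0^1 (Q_\mu(u)-Q_\nu(u))^2\,du\right)^{1/2}$, where $Q_\mu(u) = \inf\{x : \mu((-\infty,x]) \ge u\}$ is the quantile function. The set of quantile functions of elements of $\mathcal{F}_{lc}$ is a closed convex subset of $L^2([0,1])$, so the minimizer $\hat{\mu}_n$ exists and is unique. "Compactly supported and piecewise log-affine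 with finitely many pieces" means that there are finitely many points $t_0 < t_1 < \cdots < t_m$ such that the density $f$ is positive with $\log f$ affine on each $(t_{i-1},t_i)$, and $f = 0$ outside $[t_0,t_m]$. *)

theory Defs
  imports "HOL-Probability.Probability"
begin

text \<open>Logarithm of a nonnegative real with values in \<open>[-\<infinity>, \<infinity>)\<close>. It is needed because
  \<^term>\<open>ln (0::real) = 0\<close>.\<close>
definition ext_ln :: "real \<Rightarrow> ereal" where
  "ext_ln y = (if y = 0 then -\<infinity> else ereal (ln y))"

text \<open>Intended for functions that do not take the value \<open>\<infinity>\<close>. The weight \<open>t\<close> is taken in the open
  interval because \<open>0 * (-\<infinity>) = 0\<close> in \<^typ>\<open>ereal\<close>.\<close>
definition ereal_concave :: "(real \<Rightarrow> ereal) \<Rightarrow> bool" where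
  "ereal_concave g \<longleftrightarrow>
     (\<forall>x y t. 0 < t \<and> t < 1 \<longrightarrow>
        ereal (1 - t) * g x + ereal t * g y \<le> g ((1 - t) * x + t * y))"

definition has_real_density :: "real measure \<Rightarrow> (real \<Rightarrow> real) \<Rightarrow> bool" where
  "has_real_density \<mu> f \<longleftrightarrow>
     f \<in> borel_measurable borel \<and> (\<forall>x. 0 \<le> f x) \<and> \<mu> = density lborel (\<lambda>x. ennreal (f x))"

definition point_mass :: "real measure \<Rightarrow> bool" where
  "point_mass \<mu> \<longleftrightarrow> (\<exists>a. \<mu> = return borel a)"

definition log_concave_distributions :: "real measure set" where
  "log_concave_distributions =
     {\<mu>. sets \<mu> = sets borel \<and> prob_space \<mu> \<and>
          (point_mass \<mu> \<or>
           (\<exists>f. has_real_density \<mu> f \<and> ereal_concave (\<lambda>x. ext_ln (f x))))}"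

definition couplings :: "real measure \<Rightarrow> real measure \<Rightarrow> (real \<times> real) measure set" where
  "couplings \<mu> \<nu> =
     {\<pi>. sets \<pi> = sets (borel \<Otimes>\<^sub>M borel) \<and> prob_space \<pi> \<and>
          distr \<pi> borel fst = \<mu> \<and> distr \<pi> borel snd = \<nu>}"

text \<open>The distance is \<^typ>\<open>ennreal\<close>-valued, so that no junk value can arise from an infinite
  transport cost; for measures with finite second moment it is finite.\<close>
definition W2 :: "real measure \<Rightarrow> real measure \<Rightarrow> ennreal" where
  "W2 \<mu> \<nu> =
     (let c = (INF \<pi> \<in> couplings \<mu> \<nu>. \<integral>\<^sup>+ (x, y). ennreal (\<bar>x - y\<bar>\<^sup>2) \<partial>\<pi>)
      in if c = \<top> then \<top> else ennreal (sqrt (enn2real c)))"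

definition is_W2_projection :: "real measure set \<Rightarrow> real measure \<Rightarrow> real measure \<Rightarrow> bool" where
  "is_W2_projection F \<mu> \<nu> \<longleftrightarrow> \<nu> \<in> F \<and> (\<forall>\<nu>'\<in>F. W2 \<nu> \<mu> \<le> W2 \<nu>' \<mu>)"

definition empirical_measure :: "nat \<Rightarrow> (nat \<Rightarrow> real) \<Rightarrow> real measure" where
  "empirical_measure n x =
     measure_of UNIV (sets borel)
       (\<lambda>A. \<Sum>i=1..n. ennreal (1 / real n) * emeasure (return borel (x i)) A)"

lemma sets_empirical_measure [simp]: "sets (empirical_measure n x) = sets borel"
  using sets.sets_measure_of_eq[of "borel :: real measure"]
  by (simp add: empirical_measure_def)

lemma emeasure_empirical_measure:
  assumes "A \<in> sets borel"
  shows "emeasure (empirical_measure n x) A =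
           (\<Sum>i=1..n. ennreal (1 / real n) * indicator A (x i))"
proof -
  have "emeasure (empirical_measure n x) A =
          (\<Sum>i=1..n. ennreal (1 / real n) * emeasure (return borel (x i)) A)"
  proof (rule emeasure_measure_of[OF empirical_measure_def])
    show "countably_additive (sets (empirical_measure n x))
        (\<lambda>A. \<Sum>i=1..n. ennreal (1 / real n) * emeasure (return borel (x i)) A)"
    proof (unfold sets_empirical_measure, rule countably_additiveI)
      fix B :: "nat \<Rightarrow> real set"
      assume B: "range B \<subseteq> sets borel" "disjoint_family B"
      have "(\<Sum>k. emeasure (return borel (x i)) (B k)) =
              emeasure (return borel (x i)) (\<Union>k. B k)" for i
        using B by (intro suminf_emeasure) auto
      then show "(\<Sum>k. \<Sum>i=1..n. ennreal (1 / real n) * emeasure (return borel (x i)) (B k)) =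
          (\<Sum>i=1..n. ennreal (1 / real n) * emeasure (return borel (x i)) (\<Union>k. B k))"
        by (subst suminf_sum) auto
    qed
  qed (use assms in \<open>auto simp: positive_def\<close>)
  then show ?thesis
    using assms by simp
qed

text \<open>No condition is imposed on the values of \<open>f\<close> at the break points \<open>t i\<close>.\<close>
definition compact_piecewise_log_affine :: "(real \<Rightarrow> real) \<Rightarrow> bool" where
  "compact_piecewise_log_affine f \<longleftrightarrow>
     (\<exists>(m::nat) (t :: nat \<Rightarrow> real). 1 \<le> m \<and> (\<forall>i\<in>{1..m}. t (i - 1) < t i) \<and>
        (\<forall>i\<in>{1..m}. \<exists>a b. \<forall>x\<in>{t (i - 1)<..<t i}. 0 < f x \<and> ln (f x) = a * x + b) \<and>
        (\<forall>x. x \<notin> {t 0..t m} \<longrightarrow> f x = 0))"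

end

theory Submission
  imports Defs "HOL-Real_Asymp.Real_Asymp"
begin

text \<open>
  Couplings with the uniform measure on \<open>(0, 1)\<close> turn the problem into an \<open>L\<^sup>2\<close> projection of the
  step function \<open>q\<close>, the quantile function of the empirical measure. A quantile function \<open>Q\<close> belongs
  to a log-concave density \<open>f\<close> iff \<open>Q' = 1 / I\<close> with \<open>I = f \<circ> Q\<close> positive and concave on \<open>(0, 1)\<close>,
  and these \<open>Q\<close> form a convex cone. Let \<open>Q\<close> be the projection and \<open>G u = \<integral>\<^sub>0\<^sup>u (q - Q)\<close>. Since \<open>q\<close> is
  piecewise constant and \<open>Q\<close> is strictly increasing, \<open>G\<close> is strictly concave between grid points and
  has finitely many zeros. Replacing \<open>I\<close> by a concave \<open>J\<close> changes the objective to first order by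
  \<open>\<integral> G (1 / J - 1 / I)\<close>, which must not be negative. Where \<open>G < 0\<close>, taking for \<open>J\<close> a chord of \<open>I\<close>
  shows that \<open>I\<close> is affine; where \<open>G > 0\<close>, taking for \<open>J\<close> the minimum of the supporting lines at the
  end points shows that \<open>I\<close> consists of two affine pieces. Finally \<open>I = p + s u\<close> means
  \<open>ln (f x) = s x + const\<close>, and the support is compact because \<open>Q\<close> is bounded.
\<close>


section \<open>Quantile functions of log-concave densities\<close>


text \<open>Working with \<open>I\<close> instead of \<open>f\<close> turns log-concavity into
  concavity on a fixed interval, since formally \<open>I' = (ln f)' o Q\<close>: a supporting slope
  of \<open>I\<close> at \<open>u\<close> is a supporting slope of \<open>ln f\<close> at
  \<open>Q u\<close>. The cone is convex because adding quantile functions combines the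
  \<open>I\<close> harmonically. Passing from \<open>W2\<close> to \<open>L^2\<close> takes two
  one-sided estimates: an explicit coupling bounds the cost of a competitor from above, and
  Kantorovich potentials bound the cost of the projection from below. The main obstacle is the
  boundary term in the integration by parts: it is controlled by boundedness of
  \<open>R - Q\<close>. Hence \<open>Q\<close> is shown to be bounded before any variation of
  \<open>I\<close>, by comparison with truncated distributions, and every later competitor satisfies
  \<open>J >= c I\<close>, which makes \<open>R\<close> bounded too. The minimum of supporting lines
  needs an end point inside (0, 1); this is why 1/2 is added to the zeros of
  \<open>G\<close>.\<close>

lemma ln_le_ln_plus_slope_right:
  fixes J R :: "real \<Rightarrow> real"
  assumes "u < v"
    and pos: "\<And>t. t \<in> {u..v} \<Longrightarrow> 0 < J t"
    and der: "\<And>t. t \<in> {u..v} \<Longrightarrow> (R has_real_derivative 1 / J t) (at t)"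
    and chord: "\<And>t. t \<in> {u..v} \<Longrightarrow> J u + (J v - J u) / (v - u) * (t - u) \<le> J t"
    and supp: "\<And>t. t \<in> {u..v} \<Longrightarrow> J t \<le> J u + s * (t - u)"
  shows "ln (J v) \<le> ln (J u) + s * (R v - R u)"
proof -
  have mono: "R u \<le> R v"
  proof (rule DERIV_nonneg_imp_nondecreasing[where f = R])
    fix t assume "u \<le> t" "t \<le> v"
    then show "\<exists>y. (R has_real_derivative y) (at t) \<and> 0 \<le> y"
      using der[of t] pos[of t] by (intro exI[of _ "1 / J t"]) auto
  qed (use assms in simp)
  have dl: "((\<lambda>t. R t - ln (J u + c * (t - u)) / c) has_real_derivative
        1 / J t - 1 / (J u + c * (t - u))) (at t)"
    if "t \<in> {u..v}" "c \<noteq> 0" "0 < J u + c * (t - u)" for c t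
    using that by (auto intro!: derivative_eq_intros der)
  consider "s > 0" | "s = 0" | "s < 0" by linarith
  then show ?thesis
  proof cases
    case 1
    have "R u - ln (J u + s * (u - u)) / s \<le> R v - ln (J u + s * (v - u)) / s"
    proof (rule DERIV_nonneg_imp_nondecreasing[where f = "\<lambda>t. R t - ln (J u + s * (t - u)) / s"])
      fix t assume "u \<le> t" "t \<le> v"
      then have t: "t \<in> {u..v}" by auto
      show "\<exists>y. ((\<lambda>t. R t - ln (J u + s * (t - u)) / s) has_real_derivative y) (at t) \<and> 0 \<le> y"
      proof (intro exI conjI)
        have "0 < J u + s * (t - u)" using pos[OF t] supp[OF t] by simp
        then show "((\<lambda>t. R t - ln (J u + s * (t - u)) / s) has_real_derivative
            1 / J t - 1 / (J u + s * (t - u))) (at t)"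
          using 1 by (intro dl[OF t]) auto
        show "0 \<le> 1 / J t - 1 / (J u + s * (t - u))"
          using pos[OF t] supp[OF t] by (simp add: frac_le)
      qed
    qed (use assms in simp)
    from mult_left_mono[OF this, of s] have "ln (J u + s * (v - u)) - ln (J u) \<le> s * (R v - R u)"
      using 1 by (simp add: right_diff_distrib)
    moreover have "ln (J v) \<le> ln (J u + s * (v - u))"
      using pos[of v] supp[of v] assms(1) by (subst ln_le_cancel_iff) auto
    ultimately show ?thesis by linarith
  next
    case 2
    then show ?thesis using pos[of v] pos[of u] supp[of v] assms(1) by auto
  next
    \<comment> \<open>For a negative slope the bound by the supporting line integrates to the wrong
      direction. The chord lies below \<open>J\<close>, meets it at \<open>v\<close>, and its slope
      is at most \<open>s\<close>; since \<open>R v >= R u\<close>, it may be traded for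
      \<open>s\<close> at the end.\<close>
    case 3
    define \<sigma> where "\<sigma> = (J v - J u) / (v - u)"
    have \<sigma>: "\<sigma> \<le> s" "\<sigma> * (v - u) = J v - J u"
      using supp[of v] assms(1) by (auto simp: \<sigma>_def divide_simps mult.commute)
    have pos': "0 < J u + \<sigma> * (t - u)" if t: "t \<in> {u..v}" for t
    proof -
      have "\<sigma> * (v - u) \<le> \<sigma> * (t - u)"
        using t \<sigma> 3 by (intro mult_left_mono_neg) auto
      then show ?thesis using \<sigma>(2) pos[of v] assms(1) by simp
    qed
    have "R u - ln (J u + \<sigma> * (u - u)) / \<sigma> \<ge> R v - ln (J u + \<sigma> * (v - u)) / \<sigma>"
    proof (rule DERIV_nonpos_imp_nonincreasing[where f = "\<lambda>t. R t - ln (J u + \<sigma> * (t - u)) / \<sigma>"])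
      fix t assume "u \<le> t" "t \<le> v"
      then have t: "t \<in> {u..v}" by auto
      show "\<exists>y. ((\<lambda>t. R t - ln (J u + \<sigma> * (t - u)) / \<sigma>) has_real_derivative y) (at t) \<and> y \<le> 0"
      proof (intro exI conjI)
        show "((\<lambda>t. R t - ln (J u + \<sigma> * (t - u)) / \<sigma>) has_real_derivative
            1 / J t - 1 / (J u + \<sigma> * (t - u))) (at t)"
          using 3 \<sigma>(1) pos'[OF t] by (intro dl[OF t]) auto
        show "1 / J t - 1 / (J u + \<sigma> * (t - u)) \<le> 0"
          using pos'[OF t] chord[OF t] unfolding \<sigma>_def by (simp add: frac_le)
      qed
    qed (use assms in simp)
    from mult_left_mono_neg[OF this, of \<sigma>] have "ln (J v) - ln (J u) \<le> \<sigma> * (R v - R u)"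
      using 3 \<sigma> by (simp add: right_diff_distrib)
    also have "\<dots> \<le> s * (R v - R u)"
      using \<sigma> mono by (intro mult_right_mono) auto
    finally show ?thesis by linarith
  qed
qed

text \<open>Concavity in the form that the proof manipulates: it passes through changes of variable,
  minima and harmonic sums by exhibiting a slope. On open convex subsets of the line it is
  equivalent to concavity.\<close>

definition has_supporting_lines :: "real set \<Rightarrow> (real \<Rightarrow> real) \<Rightarrow> bool" where
  "has_supporting_lines S g \<longleftrightarrow> (\<forall>u\<in>S. \<exists>s. \<forall>v\<in>S. g v \<le> g u + s * (v - u))"

lemma has_supporting_lines_imp_concave_on:
  assumes "has_supporting_lines S g" "convex S"
  shows "concave_on S g"
  unfolding concave_on_def
proof (rule convex_onI)
  fix t x y :: real
  assume xy: "t > 0" "t < 1" "x \<in> S" "y \<in> S"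
  define m where "m = (1 - t) * x + t * y"
  have "m \<in> S"
    using convexD[OF assms(2), of x y "1 - t" t] xy by (simp add: m_def)
  then obtain s where s: "\<And>v. v \<in> S \<Longrightarrow> g v \<le> g m + s * (v - m)"
    using assms(1) unfolding has_supporting_lines_def by blast
  have "(1 - t) * g x + t * g y \<le> (1 - t) * (g m + s * (x - m)) + t * (g m + s * (y - m))"
    using s xy by (intro add_mono mult_left_mono) auto
  also have "\<dots> = g m + s * (m - m)"
    unfolding m_def by (simp add: algebra_simps)
  finally show "- g ((1 - t) *\<^sub>R x + t *\<^sub>R y) \<le> (1 - t) * - g x + t * - g y"
    by (simp add: m_def)
qed (use assms in simp)

lemma has_supporting_lines_imp_continuous_on:
  assumes "has_supporting_lines S g" "convex S" "open S"
  shows "continuous_on S g"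
  using convex_on_continuous[of S "\<lambda>x. - g x"] has_supporting_lines_imp_concave_on[OF assms(1,2)] assms(3)
    continuous_on_minus[of S "\<lambda>x. - g x"]
  by (simp add: concave_on_def)

lemma concave_on_above_chord:
  fixes J :: "real \<Rightarrow> real"
  assumes "concave_on S J" "{u..v} \<subseteq> S" "t \<in> {u..v}"
  shows "J u + (J v - J u) / (v - u) * (t - u) \<le> J t"
proof -
  have "convex_on {u..v} (\<lambda>x. - J x)"
    using assms(1,2) unfolding concave_on_def by (rule convex_on_subset) simp
  from convex_onD_Icc'[OF this assms(3)] have "- J t \<le> (- J v - - J u) / (v - u) * (t - u) + - J u" .
  moreover have "(- J v - - J u) / (v - u) * (t - u) = - ((J v - J u) / (v - u) * (t - u))"
    by (simp add: divide_simps algebra_simps)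
  ultimately show ?thesis by linarith
qed

text \<open>From \<open>R' = 1 / J\<close> one gets formally \<open>d (ln J) / d R = J'\<close>, so
  a slope of \<open>J\<close> in \<open>u\<close> is a slope of \<open>ln J\<close> in
  \<open>R u\<close>. This turns concavity of the density quantile function into log-concavity of
  the density.\<close>

lemma ln_supporting_line:
  fixes J R :: "real \<Rightarrow> real"
  assumes conc: "concave_on S J"
    and uv: "u \<in> S" "v \<in> S"
    and pos: "\<And>t. t \<in> S \<Longrightarrow> 0 < J t"
    and der: "\<And>t. t \<in> S \<Longrightarrow> (R has_real_derivative 1 / J t) (at t)"
    and supp: "\<And>t. t \<in> S \<Longrightarrow> J t \<le> J u + s * (t - u)"
  shows "ln (J v) \<le> ln (J u) + s * (R v - R u)"
proof -
  have conv: "convex S"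
    using conc by (simp add: concave_on_iff)
  consider "u = v" | "u < v" | "v < u" by linarith
  then show ?thesis
  proof cases
    case 2
    then have sub: "{u..v} \<subseteq> S"
      using uv conv unfolding is_interval_convex_1[symmetric] is_interval_1 by fastforce
    show ?thesis
      using 2 sub by (intro ln_le_ln_plus_slope_right pos der supp concave_on_above_chord[OF conc]) auto
  next
    case 3
    then have sub: "{v..u} \<subseteq> S"
      using uv conv unfolding is_interval_convex_1[symmetric] is_interval_1 by fastforce
    \<comment> \<open>The reflection \<open>t -> - t\<close> puts \<open>v\<close> to the right of
      \<open>u\<close>; it changes the signs of \<open>R\<close> and of the slope.\<close>
    have "ln (J (- (- v))) \<le> ln (J (- (- u))) + (- s) * ((- R (- (- v))) - (- R (- (- u))))"
    proof (rule ln_le_ln_plus_slope_right[where J = "\<lambda>t. J (- t)" and R = "\<lambda>t. - R (- t)"])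
      fix t assume "t \<in> {-u..-v}"
      then have t: "- t \<in> {v..u}" by auto
      show "0 < J (- t)" "J (- t) \<le> J (- (- u)) + (- s) * (t - (- u))"
        using pos[of "-t"] supp[of "-t"] t sub by (auto simp: algebra_simps)
      show "((\<lambda>t. - R (- t)) has_real_derivative 1 / J (- t)) (at t)"
        using t sub by (auto intro!: derivative_eq_intros DERIV_chain'[of uminus, OF _ der])
      have "J v + (J u - J v) / (u - v) * (- t - v) \<le> J (- t)"
        by (rule concave_on_above_chord[OF conc sub t])
      also have "J v + (J u - J v) / (u - v) * (- t - v) = J u + (J v - J u) / (u - v) * (t + u)"
        using 3 by (simp add: divide_simps) (simp add: algebra_simps)
      finally show "J (- (- u)) + (J (- (- v)) - J (- (- u))) / (- v - - u) * (t - - u) \<le> J (- t)"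
        by simp
    qed (use 3 in simp)
    then show ?thesis by (simp add: algebra_simps)
  qed simp
qed

text \<open>\<open>I\<close> is the density quantile function \<open>f o Q\<close>, and the
  derivative condition is the inverse function rule for the distribution function. Only values on
  (0, 1) count. Monotonicity of \<open>Q\<close> follows from positivity of \<open>I\<close>, and
  the total mass is 1 because the law is an image of the uniform measure.\<close>

definition density_quantile :: "(real \<Rightarrow> real) \<Rightarrow> (real \<Rightarrow> real) \<Rightarrow> bool" where
  "density_quantile I Q \<longleftrightarrow> has_supporting_lines {0<..<1} I \<and>
     (\<forall>u\<in>{0<..<1}. 0 < I u \<and> (Q has_real_derivative 1 / I u) (at u))"

lemma density_quantileD:
  assumes "density_quantile I Q"
  shows "has_supporting_lines {0<..<1} I"
    and "0 < u \<Longrightarrow> u < 1 \<Longrightarrow> 0 < I u"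
    and "0 < u \<Longrightarrow> u < 1 \<Longrightarrow> (Q has_real_derivative 1 / I u) (at u)"
    and "concave_on {0<..<1} I"
    and "continuous_on {0<..<1} I"
    and "continuous_on {0<..<1} Q"
proof -
  show *: "has_supporting_lines {0<..<1} I"
    and der: "0 < u \<Longrightarrow> u < 1 \<Longrightarrow> (Q has_real_derivative 1 / I u) (at u)" for u
    using assms by (auto simp: density_quantile_def)
  show "0 < u \<Longrightarrow> u < 1 \<Longrightarrow> 0 < I u"
    using assms by (auto simp: density_quantile_def)
  show "concave_on {0<..<1} I" "continuous_on {0<..<1} I"
    using * by (auto intro: has_supporting_lines_imp_concave_on has_supporting_lines_imp_continuous_on)
  show "continuous_on {0<..<1} Q"
    by (intro continuous_at_imp_continuous_on ballI DERIV_isCont[OF der]) auto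
qed

lemma density_quantile_strict_mono:
  assumes "density_quantile I Q" "0 < u" "u < v" "v < 1"
  shows "Q u < Q v"
proof (rule DERIV_pos_imp_increasing[OF assms(3)])
  fix t assume "u \<le> t" "t \<le> v"
  then show "\<exists>y. (Q has_real_derivative y) (at t) \<and> 0 < y"
    using density_quantileD(2,3)[OF assms(1), of t] assms by (intro exI[of _ "1 / I t"]) auto
qed

lemma density_quantile_mono:
  assumes "density_quantile I Q" "0 < u" "u \<le> v" "v < 1"
  shows "Q u \<le> Q v"
  using density_quantile_strict_mono[OF assms(1), of u v] assms by (cases "u = v") auto

lemma density_quantile_strict_mono_on:
  "density_quantile I Q \<Longrightarrow> strict_mono_on {0<..<1} Q"
  by (auto simp: strict_mono_on_def intro: density_quantile_strict_mono)

lemma density_quantile_inj_on: "density_quantile I Q \<Longrightarrow> inj_on Q {0<..<1}"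
  by (intro strict_mono_on_imp_inj_on density_quantile_strict_mono_on)

text \<open>This is \<open>I o F\<close> with \<open>F\<close> the inverse of \<open>Q\<close>, that
  is, the derivative of the distribution function. The case distinction hides the arbitrary value of
  \<open>inv_into\<close> off the image.\<close>

definition quantile_density :: "(real \<Rightarrow> real) \<Rightarrow> (real \<Rightarrow> real) \<Rightarrow> real \<Rightarrow> real" where
  "quantile_density I Q x = (if x \<in> Q ` {0<..<1} then I (inv_into {0<..<1} Q x) else 0)"

lemma quantile_density_apply:
  assumes "density_quantile I Q" "0 < u" "u < 1"
  shows "quantile_density I Q (Q u) = I u"
  using assms density_quantile_inj_on[OF assms(1)] by (auto simp: quantile_density_def)

lemma quantile_density_nonneg:
  assumes "density_quantile I Q"
  shows "0 \<le> quantile_density I Q x"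
  using density_quantileD(2)[OF assms] quantile_density_apply[OF assms]
  by (auto simp: quantile_density_def less_imp_le)

lemma measurable_quantile_density:
  assumes "density_quantile I Q"
  shows "quantile_density I Q \<in> borel_measurable borel"
proof -
  have inj: "inj_on Q {0<..<1}" and cont: "continuous_on {0<..<1} Q"
    using assms by (auto intro: density_quantile_inj_on density_quantileD)
  have op: "open (Q ` {0<..<1})"
    by (rule invariance_of_domain[OF cont _ inj]) simp
  obtain g where g: "homeomorphism {0<..<1} (Q ` {0<..<1}) Q g"
    using invariance_of_domain_homeomorphism[OF _ cont _ inj] by auto
  have "continuous_on (Q ` {0<..<1}) (\<lambda>x. I (g x))"
    using g by (intro continuous_on_compose2[OF density_quantileD(5)[OF assms]])
      (auto simp: homeomorphism_def)
  then have "(\<lambda>x. indicator (Q ` {0<..<1}) x *\<^sub>R I (g x)) \<in> borel_measurable borel"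
    by (rule borel_measurable_continuous_on_indicator[OF borel_open[OF op]])
  also have "(\<lambda>x. indicator (Q ` {0<..<1}) x *\<^sub>R I (g x)) = quantile_density I Q"
    using g quantile_density_apply[OF assms]
    by (auto simp: fun_eq_iff homeomorphism_def quantile_density_def[of I Q] inv_into_f_f[OF inj])
  finally show ?thesis .
qed

lemma ereal_concave_quantile_density:
  assumes "density_quantile I Q"
  shows "ereal_concave (\<lambda>x. ext_ln (quantile_density I Q x))"
  unfolding ereal_concave_def
proof (intro allI impI)
  fix x y t :: real
  assume t: "0 < t \<and> t < 1"
  let ?f = "quantile_density I Q"
  let ?S = "Q ` {0<..<1}"
  have zero: "?f z = 0 \<longleftrightarrow> z \<notin> ?S" for z
  proof (cases "z \<in> ?S")
    case True
    then obtain w where "0 < w" "w < 1" "z = Q w" by auto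
    then show ?thesis
      using True density_quantileD(2)[OF assms, of w] quantile_density_apply[OF assms, of w] by auto
  qed (simp add: quantile_density_def)
  show "ereal (1 - t) * ext_ln (?f x) + ereal t * ext_ln (?f y) \<le> ext_ln (?f ((1 - t) * x + t * y))"
  proof (cases "x \<in> ?S \<and> y \<in> ?S")
    case False
    then have eq: "ereal (1 - t) * ext_ln (?f x) + ereal t * ext_ln (?f y) = - \<infinity>"
      using t zero by (auto simp: ext_ln_def)
    show ?thesis unfolding eq by simp
  next
    case True
    then obtain u v where u: "u \<in> {0<..<1}" "x = Q u" and v: "v \<in> {0<..<1}" "y = Q v"
      by auto
    have "convex ?S"
      using connected_continuous_image[OF density_quantileD(6)[OF assms]]
      by (simp add: is_interval_connected_1 flip: is_interval_convex_1)
    from convexD[OF this, of x y "1 - t" t] True t have "(1 - t) * x + t * y \<in> ?S"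
      by simp
    \<comment> \<open>\<open>w\<close> is the level of the convex combination of \<open>x\<close>
      and \<open>y\<close>, not the convex combination of \<open>u\<close> and \<open>v\<close>:
      concavity is tested in the variable \<open>Q u\<close>, by the supporting line of
      \<open>I\<close> at \<open>w\<close>.\<close>
    then obtain w where w: "w \<in> {0<..<1}" "(1 - t) * x + t * y = Q w" by auto
    obtain s where s: "\<And>v. v \<in> {0<..<1} \<Longrightarrow> I v \<le> I w + s * (v - w)"
      using density_quantileD(1)[OF assms] w(1) unfolding has_supporting_lines_def by blast
    have ln: "ln (I z) \<le> ln (I w) + s * (Q z - Q w)" if "z \<in> {0<..<1}" for z
      using that w(1) density_quantileD[OF assms] s
      by (intro ln_supporting_line[where S = "{0<..<1}"]) auto
    have "(1 - t) * ln (I u) + t * ln (I v)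
        \<le> (1 - t) * (ln (I w) + s * (Q u - Q w)) + t * (ln (I w) + s * (Q v - Q w))"
      using ln[OF u(1)] ln[OF v(1)] t by (intro add_mono mult_left_mono) auto
    also have "\<dots> = ln (I w) + s * ((1 - t) * x + t * y - Q w)"
      using u v by (simp add: algebra_simps)
    finally have "(1 - t) * ln (I u) + t * ln (I v) \<le> ln (I w)"
      using w(2) by simp
    moreover have "I u > 0" "I v > 0" "I w > 0"
      using u v w density_quantileD(2)[OF assms] by auto
    ultimately show ?thesis
      using u v w quantile_density_apply[OF assms] by (simp add: ext_ln_def)
  qed
qed

section \<open>The uniform measure and its image under a quantile function\<close>

definition unif01 :: "real measure" where
  "unif01 = restrict_space lborel {0<..<1}"

lemma space_unif01 [simp]: "space unif01 = {0<..<1}"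
  by (simp add: unif01_def space_restrict_space)

lemma prob_space_unif01: "prob_space unif01"
  by standard (simp add: unif01_def emeasure_restrict_space space_restrict_space)

interpretation unif01: prob_space unif01
  by (rule prob_space_unif01)

lemma continuous_on_imp_measurable_unif01:
  "continuous_on {0<..<1} f \<Longrightarrow> f \<in> borel_measurable unif01"
  unfolding unif01_def
  using borel_measurable_continuous_on_restrict[of "{0<..<1}" f]
    measurable_cong_sets[OF sets_restrict_space_cong[OF sets_lborel] refl, of "{0<..<1}" borel]
  by simp

lemma density_quantile_measurable:
  "density_quantile I Q \<Longrightarrow> Q \<in> borel_measurable unif01"
  by (intro continuous_on_imp_measurable_unif01 density_quantileD)

text \<open>In the substitution \<open>x = Q u\<close> the Jacobian \<open>1 / I u\<close> cancels
  the density \<open>I u\<close>. Closed segments inside (0, 1) are used because the substitution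
  rule asks for a continuous derivative on a closed interval, and \<open>1 / I\<close> may blow up
  at 0 and 1.\<close>

lemma emeasure_density_quantile_segment:
  assumes dq: "density_quantile I Q" and [measurable]: "A \<in> sets borel"
    and ab: "0 < a" "a \<le> b" "b < 1"
  shows "emeasure (density lborel (\<lambda>x. ennreal (quantile_density I Q x))) (A \<inter> {Q a..Q b})
       = emeasure lborel ({u\<in>{0<..<1}. Q u \<in> A} \<inter> {a..b})"
proof -
  note [measurable] = measurable_quantile_density[OF dq]
  let ?f = "\<lambda>x. quantile_density I Q x * indicator A x"
  have E: "{u\<in>{0<..<1}. Q u \<in> A} \<in> sets lborel"
  proof -
    have "Q -` A \<inter> space unif01 \<in> sets unif01"
      using density_quantile_measurable[OF dq] by measurable
    then show ?thesis
      by (simp add: unif01_def sets_restrict_space_iff vimage_def Int_def conj_commute)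
  qed
  have "emeasure (density lborel (\<lambda>x. ennreal (quantile_density I Q x))) (A \<inter> {Q a..Q b})
      = (\<integral>\<^sup>+x. ennreal (?f x) * indicator {Q a..Q b} x \<partial>lborel)"
    by (subst emeasure_density) (auto intro!: nn_integral_cong simp: indicator_def)
  also have "\<dots> = (\<integral>\<^sup>+x. ?f x * indicator {Q a..Q b} x \<partial>lborel)"
    by (intro nn_integral_cong) (auto simp: indicator_def)
  also have "\<dots> = (\<integral>\<^sup>+u. ?f (Q u) * (1 / I u) * indicator {a..b} u \<partial>lborel)"
  proof (rule nn_integral_substitution[where f = ?f and g = Q and g' = "\<lambda>u. 1 / I u"])
    show "continuous_on {a..b} (\<lambda>u. 1 / I u)"
    proof (intro continuous_on_divide continuous_on_const ballI)
      show "continuous_on {a..b} I"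
        using ab by (intro continuous_on_subset[OF density_quantileD(5)[OF dq]]) auto
      show "I u \<noteq> 0" if "u \<in> {a..b}" for u
        using that ab density_quantileD(2)[OF dq, of u] by auto
    qed
    show "0 \<le> 1 / I u" if "u \<in> {a..b}" for u
      using that ab density_quantileD(2)[OF dq, of u] by auto
  qed (use ab density_quantileD(3)[OF dq] in \<open>auto simp: set_borel_measurable_def\<close>)
  also have "\<dots> = (\<integral>\<^sup>+u. indicator ({u\<in>{0<..<1}. Q u \<in> A} \<inter> {a..b}) u \<partial>lborel)"
  proof (intro nn_integral_cong)
    fix u
    show "ennreal (?f (Q u) * (1 / I u) * indicator {a..b} u) = indicator ({u\<in>{0<..<1}. Q u \<in> A} \<inter> {a..b}) u"
      using ab quantile_density_apply[OF dq, of u] density_quantileD(2)[OF dq, of u]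
      by (auto simp: indicator_def)
  qed
  also have "\<dots> = emeasure lborel ({u\<in>{0<..<1}. Q u \<in> A} \<inter> {a..b})"
    using E by (intro nn_integral_indicator) auto
  finally show ?thesis .
qed

lemma distr_density_quantile:
  assumes dq: "density_quantile I Q"
  shows "distr unif01 borel Q = density lborel (\<lambda>x. ennreal (quantile_density I Q x))"
proof (rule measure_eqI)
  fix A assume "A \<in> sets (distr unif01 borel Q)"
  then have A[measurable]: "A \<in> sets borel" by simp
  note [measurable] = measurable_quantile_density[OF dq] density_quantile_measurable[OF dq]
  let ?D = "density lborel (\<lambda>x. ennreal (quantile_density I Q x))"
  let ?E = "{u\<in>{0<..<1}. Q u \<in> A}"
  \<comment> \<open>The shift by 2 gives \<open>a k <= 1 / 2\<close>, so the segments
    \<open>{a k..1 - a k}\<close> are nonempty; they increase to (0, 1).\<close>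
  define a where "a k = 1 / (real k + 2)" for k
  have a: "0 < a k" "a k \<le> 1 - a k" "1 - a k < 1" "a k < 1" for k
    by (auto simp: a_def field_simps)
  have dec: "a l \<le> a k" if "k \<le> l" for k l
    using that by (auto simp: a_def field_simps)
  have lim: "a \<longlonglongrightarrow> 0"
    unfolding a_def by real_asymp
  have un: "(\<Union>k. {a k..1 - a k}) = {0<..<1}"
  proof safe
    fix u k assume "u \<in> {a k..1 - a k}"
    then show "u \<in> {0<..<1}" using a[of k] by auto
  next
    fix u :: real assume u: "u \<in> {0<..<1}"
    then have "0 < min u (1 - u)" by auto
    from order_tendstoD(2)[OF lim this] obtain k where "a k < min u (1 - u)"
      by (auto simp: eventually_sequentially)
    then show "u \<in> (\<Union>k. {a k..1 - a k})" by (intro UN_I[of k]) auto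
  qed
  have E: "?E \<in> sets lborel"
  proof -
    have "Q -` A \<inter> space unif01 \<in> sets unif01" by measurable
    then show ?thesis
      by (simp add: unif01_def sets_restrict_space_iff vimage_def Int_def conj_commute)
  qed
  have unQ: "(\<Union>k. {Q (a k)..Q (1 - a k)}) = Q ` {0<..<1}"
  proof -
    have "{Q (a k)..Q (1 - a k)} = Q ` {a k..1 - a k}" for k
    proof -
      have "continuous_on {a k..1 - a k} Q"
        using a[of k] by (intro continuous_on_subset[OF density_quantileD(6)[OF dq]]) auto
      moreover have "Q u \<in> {Q (a k)..Q (1 - a k)}" if "u \<in> {a k..1 - a k}" for u
        using that a[of k] by (auto intro!: density_quantile_mono[OF dq])
      moreover have "y \<in> Q ` {a k..1 - a k}" if "y \<in> {Q (a k)..Q (1 - a k)}" for y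
        using IVT'[of Q "a k" y "1 - a k"] a[of k] that calculation(1) by auto
      ultimately show ?thesis by blast
    qed
    then show ?thesis unfolding un[symmetric] by auto
  qed
  have "emeasure (distr unif01 borel Q) A = emeasure lborel ?E"
    by (subst emeasure_distr)
      (auto simp: unif01_def emeasure_restrict_space space_restrict_space density_quantile_measurable[OF dq, unfolded unif01_def] intro!: arg_cong2[where f=emeasure])
  also have "?E = (\<Union>k. ?E \<inter> {a k..1 - a k})"
    using un by blast
  also have "emeasure lborel \<dots> = (SUP k. emeasure lborel (?E \<inter> {a k..1 - a k}))"
    using E by (intro SUP_emeasure_incseq[symmetric]) (auto simp: incseq_def dest: dec)
  also have "\<dots> = (SUP k. emeasure ?D (A \<inter> {Q (a k)..Q (1 - a k)}))"
    using a by (simp add: emeasure_density_quantile_segment[OF dq A])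
  also have "\<dots> = emeasure ?D (\<Union>k. A \<inter> {Q (a k)..Q (1 - a k)})"
  proof (intro SUP_emeasure_incseq)
    have "Q (a l) \<le> Q (a k) \<and> Q (1 - a k) \<le> Q (1 - a l)" if "k \<le> l" for k l
      using dec[OF that] a[of k] a[of l] by (auto intro!: density_quantile_mono[OF dq])
    then show "incseq (\<lambda>k. A \<inter> {Q (a k)..Q (1 - a k)})"
      unfolding incseq_def by (meson Int_mono atLeastatMost_subset_iff order_refl)
  qed auto
  also have "(\<Union>k. A \<inter> {Q (a k)..Q (1 - a k)}) = A \<inter> Q ` {0<..<1}"
    using unQ by blast
  also have "emeasure ?D (A \<inter> Q ` {0<..<1}) = emeasure ?D A"
  proof -
    have "open (Q ` {0<..<1})"
      using density_quantileD(6)[OF dq] density_quantile_inj_on[OF dq]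
      by (intro invariance_of_domain) auto
    then have [measurable]: "Q ` {0<..<1} \<in> sets borel" by simp
    have "ennreal (quantile_density I Q x) * indicator (A \<inter> Q ` {0<..<1}) x
        = ennreal (quantile_density I Q x) * indicator A x" for x
      by (cases "x \<in> Q ` {0<..<1}") (simp_all add: indicator_def quantile_density_def)
    then show ?thesis
      by (simp add: emeasure_density)
  qed
  finally show "emeasure (distr unif01 borel Q) A = emeasure ?D A" .
qed simp

lemma has_real_density_density_quantile:
  "density_quantile I Q \<Longrightarrow> has_real_density (distr unif01 borel Q) (quantile_density I Q)"
  by (simp add: has_real_density_def measurable_quantile_density quantile_density_nonneg distr_density_quantile)

lemma density_quantile_log_concave:
  assumes "density_quantile I Q"
  shows "distr unif01 borel Q \<in> log_concave_distributions"
  using has_real_density_density_quantile[OF assms] ereal_concave_quantile_density[OF assms]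
    unif01.prob_space_distr[OF density_quantile_measurable[OF assms]]
  by (auto simp: log_concave_distributions_def)

section \<open>Density quantile functions of log-concave measures\<close>


lemma exp_le_exp_plus_slope_right:
  fixes \<phi> F :: "real \<Rightarrow> real"
  assumes "u < v"
    and der: "\<And>t. t \<in> {u..v} \<Longrightarrow> (F has_real_derivative exp (\<phi> t)) (at t)"
    and chord: "\<And>t. t \<in> {u..v} \<Longrightarrow> \<phi> u + (\<phi> v - \<phi> u) / (v - u) * (t - u) \<le> \<phi> t"
    and supp: "\<And>t. t \<in> {u..v} \<Longrightarrow> \<phi> t \<le> \<phi> u + s * (t - u)"
  shows "exp (\<phi> v) \<le> exp (\<phi> u) + s * (F v - F u)"
proof -
  have mono: "F u \<le> F v"
  proof (rule DERIV_nonneg_imp_nondecreasing[where f = F])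
    fix t assume "u \<le> t" "t \<le> v"
    then show "\<exists>y. (F has_real_derivative y) (at t) \<and> 0 \<le> y"
      using der[of t] by (intro exI[of _ "exp (\<phi> t)"]) auto
  qed (use assms in simp)
  \<comment> \<open>Monotonicity of \<open>c * F t - exp (\<phi> u + c * (t - u))\<close>. For
    \<open>c <= 0\<close> the hypothesis follows from the supporting line, for \<open>c > 0\<close>
    from the chord; the factor \<open>c\<close> accounts for the change of direction.\<close>
  have step: "exp (\<phi> u + c * (v - u)) - exp (\<phi> u) \<le> c * (F v - F u)"
    if "\<And>t. t \<in> {u..v} \<Longrightarrow> c * exp (\<phi> u + c * (t - u)) \<le> c * exp (\<phi> t)" for c
  proof -
    have "c * F u - exp (\<phi> u + c * (u - u)) \<le> c * F v - exp (\<phi> u + c * (v - u))"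
    proof (rule DERIV_nonneg_imp_nondecreasing[where f = "\<lambda>t. c * F t - exp (\<phi> u + c * (t - u))"])
      fix t assume "u \<le> t" "t \<le> v"
      then have t: "t \<in> {u..v}" by auto
      show "\<exists>y. ((\<lambda>t. c * F t - exp (\<phi> u + c * (t - u))) has_real_derivative y) (at t) \<and> 0 \<le> y"
      proof (intro exI conjI)
        show "((\<lambda>t. c * F t - exp (\<phi> u + c * (t - u))) has_real_derivative
            c * exp (\<phi> t) - c * exp (\<phi> u + c * (t - u))) (at t)"
          by (auto intro!: derivative_eq_intros der[OF t])
      qed (use that[OF t] in simp)
    qed (use assms in simp)
    then show ?thesis by (simp add: right_diff_distrib)
  qed
  define \<sigma> where "\<sigma> = (\<phi> v - \<phi> u) / (v - u)"
  have \<sigma>: "\<sigma> \<le> s" "\<sigma> * (v - u) = \<phi> v - \<phi> u"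
    using supp[of v] assms(1) by (auto simp: \<sigma>_def divide_simps mult.commute)
  consider "s \<le> 0" | "s > 0" "\<sigma> > 0" | "s > 0" "\<sigma> \<le> 0" by linarith
  then show ?thesis
  proof cases
    case 1
    have "exp (\<phi> v) \<le> exp (\<phi> u + s * (v - u))"
      using supp[of v] assms(1) by simp
    moreover have "exp (\<phi> u + s * (v - u)) - exp (\<phi> u) \<le> s * (F v - F u)"
      using 1 supp by (intro step mult_left_mono_neg) auto
    ultimately show ?thesis by linarith
  next
    case 2
    have "exp (\<phi> u + \<sigma> * (v - u)) - exp (\<phi> u) \<le> \<sigma> * (F v - F u)"
      using 2 chord by (intro step mult_left_mono) (auto simp: \<sigma>_def)
    also have "\<dots> \<le> s * (F v - F u)"
      using \<sigma> mono by (intro mult_right_mono) auto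
    finally show ?thesis by (simp add: \<sigma>(2))
  next
    case 3
    then have "\<phi> v - \<phi> u \<le> 0"
      using assms(1) \<sigma>(2) by (metis diff_gt_0_iff_gt mult_le_0_iff less_imp_le)
    then have "exp (\<phi> v) \<le> exp (\<phi> u)" by simp
    moreover have "0 \<le> s * (F v - F u)" using 3 mono by simp
    ultimately show ?thesis by linarith
  qed
qed

text \<open>Here \<open>F' = exp \<phi>\<close> gives formally
  \<open>d (exp \<phi>) / d F = \<phi>'\<close>. This is the converse passage, from a slope of
  \<open>ln f\<close> to a slope of the density as a function of its distribution function.\<close>

lemma exp_supporting_line:
  fixes \<phi> F :: "real \<Rightarrow> real"
  assumes conc: "concave_on S \<phi>"
    and uv: "u \<in> S" "v \<in> S"
    and der: "\<And>t. t \<in> S \<Longrightarrow> (F has_real_derivative exp (\<phi> t)) (at t)"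
    and supp: "\<And>t. t \<in> S \<Longrightarrow> \<phi> t \<le> \<phi> u + s * (t - u)"
  shows "exp (\<phi> v) \<le> exp (\<phi> u) + s * (F v - F u)"
proof -
  have conv: "convex S"
    using conc by (simp add: concave_on_iff)
  consider "u = v" | "u < v" | "v < u" by linarith
  then show ?thesis
  proof cases
    case 2
    then have sub: "{u..v} \<subseteq> S"
      using uv conv unfolding is_interval_convex_1[symmetric] is_interval_1 by fastforce
    show ?thesis
      using 2 sub by (intro exp_le_exp_plus_slope_right der supp concave_on_above_chord[OF conc]) auto
  next
    case 3
    then have sub: "{v..u} \<subseteq> S"
      using uv conv unfolding is_interval_convex_1[symmetric] is_interval_1 by fastforce
    have "exp (\<phi> (- (- v))) \<le> exp (\<phi> (- (- u))) + (- s) * ((- F (- (- v))) - (- F (- (- u))))"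
    proof (rule exp_le_exp_plus_slope_right[where \<phi> = "\<lambda>t. \<phi> (- t)" and F = "\<lambda>t. - F (- t)"])
      fix t assume "t \<in> {-u..-v}"
      then have t: "- t \<in> {v..u}" by auto
      show "\<phi> (- t) \<le> \<phi> (- (- u)) + (- s) * (t - (- u))"
        using supp[of "-t"] t sub by (auto simp: algebra_simps)
      show "((\<lambda>t. - F (- t)) has_real_derivative exp (\<phi> (- t))) (at t)"
        using t sub by (auto intro!: derivative_eq_intros DERIV_chain'[of uminus, OF _ der])
      have "\<phi> v + (\<phi> u - \<phi> v) / (u - v) * (- t - v) \<le> \<phi> (- t)"
        by (rule concave_on_above_chord[OF conc sub t])
      also have "\<phi> v + (\<phi> u - \<phi> v) / (u - v) * (- t - v) = \<phi> u + (\<phi> v - \<phi> u) / (u - v) * (t + u)"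
        using 3 by (simp add: divide_simps) (simp add: algebra_simps)
      finally show "\<phi> (- (- u)) + (\<phi> (- (- v)) - \<phi> (- (- u))) / (- v - - u) * (t - - u) \<le> \<phi> (- t)"
        by simp
    qed (use 3 in simp)
    then show ?thesis by (simp add: algebra_simps)
  qed simp
qed

lemma concave_on_imp_has_supporting_lines:
  fixes g :: "real \<Rightarrow> real"
  assumes "concave_on S g" "open S"
  shows "has_supporting_lines S g"
  unfolding has_supporting_lines_def
proof
  fix x assume "x \<in> S"
  let ?m = "Inf ((\<lambda>t. (- g x - - g t) / (x - t)) ` ({x<..} \<inter> S))"
  have "- g y \<ge> - g x + ?m * (y - x)" if "y \<in> S" for y
    using assms \<open>x \<in> S\<close> that unfolding concave_on_def
    by (intro convex_le_Inf_differential) (auto simp: interior_open)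
  then show "\<exists>s. \<forall>v\<in>S. g v \<le> g x + s * (v - x)"
    by (intro exI[of _ "- ?m"]) (auto simp: algebra_simps)
qed

lemma ereal_concave_ext_lnD:
  assumes "ereal_concave (\<lambda>x. ext_ln (f x))" "\<And>x. 0 \<le> f x"
  shows "convex {x. 0 < f x}" and "concave_on {x. 0 < f x} (\<lambda>x. ln (f x))"
proof -
  have *: "0 < f ((1 - t) * x + t * y) \<and>
      (1 - t) * ln (f x) + t * ln (f y) \<le> ln (f ((1 - t) * x + t * y))"
    if "0 < t" "t < 1" "0 < f x" "0 < f y" for x y t
  proof -
    have "ereal (1 - t) * ext_ln (f x) + ereal t * ext_ln (f y) \<le> ext_ln (f ((1 - t) * x + t * y))"
      using assms(1) that unfolding ereal_concave_def by blast
    then show ?thesis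
      using that assms(2)[of "(1 - t) * x + t * y"]
      by (auto simp: ext_ln_def less_le split: if_splits)
  qed
  show conv: "convex {x. 0 < f x}"
    unfolding convex_alt
  proof (intro ballI allI impI)
    fix x y u :: real assume "x \<in> {x. 0 < f x}" "y \<in> {x. 0 < f x}" "0 \<le> u \<and> u \<le> 1"
    then show "(1 - u) *\<^sub>R x + u *\<^sub>R y \<in> {x. 0 < f x}"
      using *[of u x y] by (cases "u = 0"; cases "u = 1") auto
  qed
  show "concave_on {x. 0 < f x} (\<lambda>x. ln (f x))"
    unfolding concave_on_def
    using * conv by (intro convex_onI) force+
qed

text \<open>On the interior of \<open>{x. 0 < f x}\<close> the distribution function has derivative
  \<open>f\<close>, is strictly increasing, and maps onto (0, 1); \<open>Q\<close> is its inverse.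
  Supporting lines of \<open>ln f\<close> become supporting lines of \<open>I\<close> by
  \<open>exp_supporting_line\<close>, with \<open>F (Q u) = u\<close>.\<close>

lemma log_concave_density_imp_density_quantile:
  assumes prob: "prob_space \<mu>" and dens: "has_real_density \<mu> f"
    and conc: "ereal_concave (\<lambda>x. ext_ln (f x))"
  obtains I Q where "density_quantile I Q" "distr unif01 borel Q = \<mu>"
proof -
  have [measurable]: "f \<in> borel_measurable borel" and f0: "\<And>x. 0 \<le> f x"
    and \<mu>: "\<mu> = density lborel (\<lambda>x. ennreal (f x))"
    using dens by (auto simp: has_real_density_def)
  have sets_\<mu>[measurable_cong]: "sets \<mu> = sets borel" by (simp add: \<mu>)
  interpret prob_space \<mu> by (rule prob)
  interpret real_distribution \<mu>
    by standard (auto simp: sets_\<mu> \<mu>)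
  define P where "P = {x. 0 < f x}"
  have convP: "convex P" and concP: "concave_on P (\<lambda>x. ln (f x))"
    using ereal_concave_ext_lnD[OF conc f0] by (auto simp: P_def)
  \<comment> \<open>At an end point of \<open>P\<close> the density may jump and \<open>ln f\<close>
    need not have a supporting line, hence the interior. A convex set has a null boundary, so no
    mass is lost.\<close>
  define S where "S = interior P"
  have S: "open S" "convex S" "S \<subseteq> P"
    using convP by (auto simp: S_def interior_subset)
  have fpos: "0 < f x" if "x \<in> S" for x using that S by (auto simp: P_def)
  have concS: "concave_on S (\<lambda>x. ln (f x))"
    using concP S convex_on_subset unfolding concave_on_def by blast
  have suppS: "has_supporting_lines S (\<lambda>x. ln (f x))"
    by (rule concave_on_imp_has_supporting_lines[OF concS S(1)])
  have [measurable]: "P \<in> sets borel" unfolding P_def by measurable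
  have [measurable]: "S \<in> sets borel" using S by auto
  have null: "P - S \<in> null_sets lborel"
  proof -
    have "P - S \<subseteq> frontier P"
      unfolding S_def frontier_def using closure_subset by auto
    then have "P - S \<in> null_sets lebesgue"
      using negligible_convex_frontier[OF convP] negligible_subset negligible_iff_null_sets by blast
    then show ?thesis by (simp add: null_sets_completion_iff)
  qed
  have AE_S: "AE x in lborel. f x = f x * indicator S x"
    using AE_not_in[OF null]
  proof eventually_elim
    case (elim x)
    then show ?case using f0[of x] by (auto simp: indicator_def P_def less_le)
  qed
  have intf: "integrable lborel f"
  proof (rule integrableI_nonneg)
    have "(\<integral>\<^sup>+ x. ennreal (f x) \<partial>lborel) = emeasure \<mu> (space \<mu>)"
      by (simp add: \<mu> emeasure_density)
    then show "(\<integral>\<^sup>+ x. ennreal (f x) \<partial>lborel) < \<infinity>"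
      using emeasure_space_1 by simp
  qed (auto simp: f0)
  have meas: "measure \<mu> A = (LINT x:A|lborel. f x)" if [measurable]: "A \<in> sets borel" for A
  proof -
    have "emeasure \<mu> A = (\<integral>\<^sup>+ x. ennreal (indicator A x * f x) \<partial>lborel)"
      by (auto simp: \<mu> emeasure_density intro!: nn_integral_cong simp: indicator_def)
    also have "\<dots> = ennreal (\<integral>x. indicator A x * f x \<partial>lborel)"
      using integrable_mult_indicator[of A lborel f] intf
      by (intro nn_integral_eq_integral) (auto simp: f0)
    finally show ?thesis
      by (simp add: measure_def set_lebesgue_integral_def f0 Bochner_Integration.integral_nonneg)
  qed
  have disj0: "measure \<mu> A = 0" if [measurable]: "A \<in> sets borel" and "A \<inter> S = {}" for A
  proof -
    have "(LINT x:A|lborel. f x) = (LINT x:A|lborel. 0)"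
      unfolding set_lebesgue_integral_def
    proof (rule integral_cong_AE)
      show "AE x in lborel. indicat_real A x *\<^sub>R f x = indicat_real A x *\<^sub>R 0"
        using AE_S by eventually_elim (use that in \<open>auto simp: indicator_def split: if_splits\<close>)
    qed measurable
    then show ?thesis by (simp add: meas)
  qed
  let ?F = "cdf \<mu>"
  have der: "(?F has_real_derivative f x) (at x)" if x: "x \<in> S" for x
  proof -
    obtain e where e: "0 < e" "cball x e \<subseteq> S"
      using S(1) x open_contains_cball by blast
    define a b where "a = x - e" and "b = x + e"
    have ab: "a < x" "x < b" "{a..b} \<subseteq> S"
      using e by (auto simp: a_def b_def cball_eq_atLeastAtMost)
    have "continuous_on S (\<lambda>x. exp (ln (f x)))"
      by (intro continuous_intros has_supporting_lines_imp_continuous_on suppS S)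
    then have "continuous_on {a..b} (\<lambda>x. exp (ln (f x)))"
      using ab(3) by (rule continuous_on_subset)
    moreover have "continuous_on {a..b} (\<lambda>x. exp (ln (f x))) = continuous_on {a..b} f"
      using ab(3) fpos by (intro continuous_on_cong) auto
    ultimately have cont: "continuous_on {a..b} f" by simp
    have F: "?F t = ?F a + integral {a..t} f" if t: "t \<in> {a..b}" for t
    proof (cases "t = a")
      case False
      then have "?F t - ?F a = measure \<mu> {a<..t}"
        using t by (intro cdf_diff_eq) auto
      also have "\<dots> = (LINT x:{a<..t}|lborel. f x)"
        by (rule meas) simp
      also have "\<dots> = (LINT x:{a..t}|lborel. f x)"
        unfolding set_lebesgue_integral_def
      proof (rule integral_cong_AE)
        show "AE x in lborel. indicat_real {a<..t} x *\<^sub>R f x = indicat_real {a..t} x *\<^sub>R f x"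
          using AE_lborel_singleton[of a] by eventually_elim (auto simp: indicator_def)
      qed measurable
      also have "\<dots> = integral {a..t} f"
        using integrable_mult_indicator[of "{a..t}" lborel f] intf
        by (intro set_borel_integral_eq_integral) (auto simp: set_integrable_def)
      finally show ?thesis by simp
    qed simp
    have "((\<lambda>t. ?F a + integral {a..t} f) has_real_derivative f x) (at x within {a..b})"
      using ab by (auto intro!: derivative_eq_intros integral_has_real_derivative cont)
    then have "((\<lambda>t. ?F a + integral {a..t} f) has_real_derivative f x) (at x)"
      using ab by (simp add: at_within_Icc_at)
    moreover have "\<forall>\<^sub>F t in nhds x. t \<in> {a<..<b}"
      using ab by (intro eventually_nhds_in_open) auto
    ultimately show ?thesis
      by (subst DERIV_cong_ev[OF refl _ refl]) (auto elim!: eventually_mono intro!: F)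
  qed
  have smono: "?F x < ?F y" if "x \<in> S" "y \<in> S" "x < y" for x y
  proof (rule DERIV_pos_imp_increasing[OF that(3), where f = ?F])
    fix t assume "x \<le> t" "t \<le> y"
    then have "t \<in> S"
      using S(2) that unfolding is_interval_convex_1[symmetric] is_interval_1 by blast
    then show "\<exists>y. (?F has_real_derivative y) (at t) \<and> 0 < y"
      using der fpos by blast
  qed
  have F01: "?F x \<in> {0<..<1}" if x: "x \<in> S" for x
  proof -
    obtain e where e: "0 < e" "cball x e \<subseteq> S"
      using S(1) x open_contains_cball by blast
    then have "x - e \<in> S" "x + e \<in> S" by (auto simp: cball_eq_atLeastAtMost)
    then have "?F (x - e) < ?F x" "?F x < ?F (x + e)"
      using smono x e by auto
    then show ?thesis
      using cdf_nonneg[of "x - e"] cdf_bounded_prob[of "x + e"] by auto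
  qed
  have onto: "u \<in> ?F ` S" if u: "u \<in> {0<..<1}" for u
  proof -
    have "\<forall>\<^sub>F x in at_bot. ?F x < u" "\<forall>\<^sub>F x in at_top. u < ?F x"
      using u by (auto intro: order_tendstoD[OF cdf_lim_at_bot] order_tendstoD[OF cdf_lim_at_top_prob])
    then obtain a b where ab: "?F a < u" "u < ?F b"
      by (meson eventually_at_bot_linorder eventually_at_top_linorder order_refl)
    then have "a \<le> b"
      using cdf_nondecreasing[of b a] by linarith
    have "isCont ?F x" for x
    proof -
      have "(LINT x:{x}|lborel. f x) = (LINT x:{x}|lborel. 0)"
        unfolding set_lebesgue_integral_def
      proof (rule integral_cong_AE)
        show "AE y in lborel. indicat_real {x} y *\<^sub>R f y = indicat_real {x} y *\<^sub>R 0"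
          using AE_lborel_singleton[of x] by eventually_elim (auto simp: indicator_def)
      qed measurable
      then show ?thesis by (simp add: isCont_cdf meas)
    qed
    then obtain x where x: "?F x = u"
      using IVT[of ?F a u b] ab \<open>a \<le> b\<close> by auto
    \<comment> \<open>By convexity \<open>S\<close> lies entirely to one side of a point outside it,
      so \<open>?F x\<close> would be 0 or 1.\<close>
    have "x \<in> S"
    proof (rule ccontr)
      assume "x \<notin> S"
      then have "{..x} \<inter> S = {} \<or> {x<..} \<inter> S = {}"
        using S(2) unfolding is_interval_convex_1[symmetric] is_interval_1
        by (auto simp: set_eq_iff)
      then show False
      proof
        assume "{..x} \<inter> S = {}"
        then show False using disj0[of "{..x}"] x u by (simp add: cdf_def)
      next
        assume "{x<..} \<inter> S = {}"
        moreover have "measure \<mu> {..x} = 1 - measure \<mu> {x<..}"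
        proof -
          have "{..x} = space \<mu> - {x<..}" by auto
          then show ?thesis using prob_compl[of "{x<..}"] by (simp del: space_eq_univ)
        qed
        ultimately show False using disj0[of "{x<..}"] x u by (simp add: cdf_def)
      qed
    qed
    then show ?thesis using x by auto
  qed
  have inj: "inj_on ?F S"
    by (auto simp: inj_on_def) (metis smono less_irrefl linorder_neq_iff)
  have img: "?F ` S = {0<..<1}" using F01 onto by blast
  define Q where "Q = inv_into S ?F"
  have QS: "Q u \<in> S" "?F (Q u) = u" if "u \<in> {0<..<1}" for u
    using that img by (auto simp: Q_def inv_into_into f_inv_into_f)
  have QF: "Q (?F x) = x" if "x \<in> S" for x
    using that inj by (simp add: Q_def)
  have contF: "continuous_on S ?F"
    by (intro continuous_at_imp_continuous_on ballI DERIV_isCont[OF der])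
  obtain g where g: "homeomorphism S (?F ` S) ?F g"
    using invariance_of_domain_homeomorphism[OF S(1) contF _ inj] by auto
  have "continuous_on {0<..<1} g" using g img by (auto simp: homeomorphism_def)
  then have "continuous_on {0<..<1} Q"
  proof (rule iffD1[OF continuous_on_cong[OF refl], rotated])
    fix u :: real assume "u \<in> {0<..<1}"
    then show "g u = Q u"
      using g img QS[of u] by (metis homeomorphism_apply1)
  qed
  then have contQ: "isCont Q u" if "u \<in> {0<..<1}" for u
    using that by (simp add: continuous_on_eq_continuous_at)
  define I where "I u = f (Q u)" for u
  have derQ: "(Q has_real_derivative 1 / I u) (at u)" if u: "u \<in> {0<..<1}" for u
  proof -
    have "(Q has_real_derivative inverse (f (Q u))) (at u)"
      using u QS fpos[OF QS(1)[OF u]] by (intro DERIV_inverse_function[where f = ?F and a = 0 and b = 1] der contQ) auto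
    then show ?thesis by (simp add: I_def inverse_eq_divide)
  qed
  have "has_supporting_lines {0<..<1} I"
    unfolding has_supporting_lines_def
  proof
    fix u :: real assume u: "u \<in> {0<..<1}"
    obtain s where s: "\<And>y. y \<in> S \<Longrightarrow> ln (f y) \<le> ln (f (Q u)) + s * (y - Q u)"
      using suppS QS(1)[OF u] unfolding has_supporting_lines_def by blast
    have "I v \<le> I u + s * (v - u)" if v: "v \<in> {0<..<1}" for v
    proof -
      have "exp (ln (f (Q v))) \<le> exp (ln (f (Q u))) + s * (?F (Q v) - ?F (Q u))"
        using der fpos by (intro exp_supporting_line[OF concS] QS u v s) auto
      then show ?thesis
        using QS[OF u] QS[OF v] fpos by (simp add: I_def)
    qed
    then show "\<exists>s. \<forall>v\<in>{0<..<1}. I v \<le> I u + s * (v - u)" by blast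
  qed
  then have dq: "density_quantile I Q"
    using derQ fpos QS by (auto simp: density_quantile_def I_def)
  have "Q ` {0<..<1} = S"
    using QS QF F01 by (auto simp: image_iff) (metis F01 greaterThanLessThan_iff)
  then have qd: "quantile_density I Q x = f x * indicator S x" for x
    using quantile_density_apply[OF dq, of "?F x"] F01[of x] QF[of x]
    by (auto simp: quantile_density_def[of I Q] I_def indicator_def)
  have "distr unif01 borel Q = density lborel (\<lambda>x. ennreal (quantile_density I Q x))"
    by (rule distr_density_quantile[OF dq])
  also have "\<dots> = \<mu>"
    unfolding \<mu>
  proof (rule density_cong)
    show "AE x in lborel. ennreal (quantile_density I Q x) = ennreal (f x)"
      using AE_S by eventually_elim (metis qd)
  qed (use measurable_quantile_density[OF dq] in auto)
  finally show ?thesis using that dq by blast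
qed

section \<open>Transport to an empirical measure\<close>


text \<open>For sorted \<open>y\<close> this is the right-continuous quantile function of the
  empirical measure. Indices run from 0 to \<open>n - 1\<close>, while the sample is numbered from
  1; at \<open>u = 1\<close> the value is \<open>y n\<close>, which the uniform measure on the open
  interval does not see.\<close>

definition step_fun :: "nat \<Rightarrow> (nat \<Rightarrow> real) \<Rightarrow> real \<Rightarrow> real" where
  "step_fun n y u = y (nat \<lfloor>real n * u\<rfloor>)"

lemma nat_floor_eq_iff:
  assumes "0 < n" "0 \<le> u"
  shows "nat \<lfloor>real n * u\<rfloor> = k \<longleftrightarrow> real k / real n \<le> u \<and> u < (real k + 1) / real n"
proof -
  have "nat \<lfloor>real n * u\<rfloor> = k \<longleftrightarrow> \<lfloor>real n * u\<rfloor> = int k"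
    using assms by (simp add: nat_eq_iff)
  also have "\<dots> \<longleftrightarrow> real k \<le> real n * u \<and> real n * u < real k + 1"
    by (simp add: floor_eq_iff)
  also have "\<dots> \<longleftrightarrow> real k / real n \<le> u \<and> u < (real k + 1) / real n"
    using assms by (simp add: field_simps)
  finally show ?thesis .
qed

lemma nat_floor_less:
  assumes "0 < n" "0 \<le> u" "u < 1"
  shows "nat \<lfloor>real n * u\<rfloor> < n"
proof -
  have "real n * u < real n" using assms by simp
  then have "\<lfloor>real n * u\<rfloor> < int n" by (simp add: floor_less_iff)
  then show ?thesis using assms by linarith
qed

lemma le_nat_floor_iff:
  assumes "0 < n" "0 \<le> u"
  shows "k \<le> nat \<lfloor>real n * u\<rfloor> \<longleftrightarrow> real k / real n \<le> u"
proof -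
  have "k \<le> nat \<lfloor>real n * u\<rfloor> \<longleftrightarrow> int k \<le> \<lfloor>real n * u\<rfloor>"
    using assms by (simp add: le_nat_iff)
  also have "\<dots> \<longleftrightarrow> real k \<le> real n * u" by (simp add: le_floor_iff)
  also have "\<dots> \<longleftrightarrow> real k / real n \<le> u"
    using assms by (simp add: field_simps)
  finally show ?thesis .
qed

lemma step_fun_measurable [measurable]: "step_fun n y \<in> borel_measurable borel"
  unfolding step_fun_def by measurable

lemma borel_measurable_unif01: "f \<in> borel_measurable borel \<Longrightarrow> f \<in> borel_measurable unif01"
  unfolding unif01_def by (intro measurable_restrict_space1) simp

lemma step_fun_measurable_unif01 [measurable]: "step_fun n y \<in> borel_measurable unif01"
  by (intro borel_measurable_unif01 step_fun_measurable)

lemma emeasure_unif01_cell: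
  assumes "k < n"
  shows "emeasure unif01 ({0<..<1} \<inter> {real k / real n..<(real k + 1) / real n}) = ennreal (1 / real n)"
proof -
  let ?X = "{0<..<1} \<inter> {real k / real n..<(real k + 1) / real n}"
  have le: "0 \<le> real k / real n" "(real k + 1) / real n \<le> 1" "real k / real n \<le> (real k + 1) / real n"
    using assms by (auto simp: divide_simps)
  have len: "(real k + 1) / real n - real k / real n = 1 / real n"
    by (simp add: diff_divide_distrib[symmetric])
  have "emeasure lborel {real k / real n<..<(real k + 1) / real n} \<le> emeasure lborel ?X"
  proof (rule emeasure_mono)
    show "{real k / real n<..<(real k + 1) / real n} \<subseteq> ?X"
    proof
      fix u assume "u \<in> {real k / real n<..<(real k + 1) / real n}"
      then have "real k / real n < u" "u < (real k + 1) / real n" by auto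
      moreover from this le have "0 < u" "u < 1" by linarith+
      ultimately show "u \<in> ?X" by simp
    qed
  qed simp
  moreover have "emeasure lborel ?X \<le> emeasure lborel {real k / real n..(real k + 1) / real n}"
    by (intro emeasure_mono) auto
  ultimately have "emeasure lborel ?X = ennreal (1 / real n)"
    using le by (simp add: len)
  then show ?thesis
    by (simp add: unif01_def emeasure_restrict_space)
qed

lemma distr_step_fun:
  assumes "0 < n" and [measurable]: "A \<in> sets borel"
  shows "emeasure (distr unif01 borel (step_fun n y)) A
       = (\<Sum>k<n. ennreal (1 / real n) * indicator A (y k))"
proof -
  have cell: "{0<..<1} \<inter> {real k / real n..<(real k + 1) / real n} \<in> sets unif01" for k
    unfolding unif01_def by (auto simp: sets_restrict_space_iff)
  have "emeasure (distr unif01 borel (step_fun n y)) A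
      = (\<integral>\<^sup>+u. indicator A (step_fun n y u) \<partial>unif01)"
    by (simp add: nn_integral_distr flip: nn_integral_indicator)
  also have "\<dots> = (\<integral>\<^sup>+u. (\<Sum>k<n. indicator A (y k) *
      indicator ({0<..<1} \<inter> {real k / real n..<(real k + 1) / real n}) u) \<partial>unif01)"
  proof (rule nn_integral_cong)
    fix u assume "u \<in> space unif01"
    then have u: "0 < u" "u < 1" by auto
    define j where "j = nat \<lfloor>real n * u\<rfloor>"
    have "j < n" using nat_floor_less assms(1) u by (simp add: j_def)
    have "(\<Sum>k<n. indicator A (y k) * indicator ({0<..<1} \<inter> {real k / real n..<(real k + 1) / real n}) u :: ennreal)
        = (\<Sum>k<n. if k = j then indicator A (y j) else 0)"
    proof (intro sum.cong refl)
      fix k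
      have "u \<in> {0<..<1} \<inter> {real k / real n..<(real k + 1) / real n} \<longleftrightarrow> k = j"
        using nat_floor_eq_iff[of n u k] assms(1) u unfolding j_def[symmetric] by auto
      then show "indicator A (y k) * indicator ({0<..<1} \<inter> {real k / real n..<(real k + 1) / real n}) u
          = (if k = j then indicator A (y j) else 0 :: ennreal)"
        by (auto simp: indicator_def)
    qed
    then show "indicator A (step_fun n y u) = (\<Sum>k<n. indicator A (y k) *
        indicator ({0<..<1} \<inter> {real k / real n..<(real k + 1) / real n}) u :: ennreal)"
      using \<open>j < n\<close> by (simp add: step_fun_def j_def)
  qed
  also have "\<dots> = (\<Sum>k<n. indicator A (y k) *
      emeasure unif01 ({0<..<1} \<inter> {real k / real n..<(real k + 1) / real n}))"
    using cell by (subst nn_integral_sum) (auto simp: nn_integral_cmult)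
  also have "\<dots> = (\<Sum>k<n. ennreal (1 / real n) * indicator A (y k))"
    by (intro sum.cong refl) (simp add: emeasure_unif01_cell mult.commute)
  finally show ?thesis .
qed

lemma empirical_measure_eq_distr_step_fun:
  assumes "1 \<le> n"
  obtains y where "\<And>k l. k \<le> l \<Longrightarrow> l < n \<Longrightarrow> y k \<le> y l"
    and "distr unif01 borel (step_fun n y) = empirical_measure n x"
proof -
  define ys where "ys = sort (map x [1..<n+1])"
  have len: "length ys = n" by (simp add: ys_def)
  define y where "y k = ys ! k" for k
  have mono: "y k \<le> y l" if "k \<le> l" "l < n" for k l
    using that unfolding y_def by (intro sorted_nth_mono) (auto simp: ys_def)
  have sum: "(\<Sum>k<n. g (y k)) = (\<Sum>i=1..n. g (x i))" for g :: "real \<Rightarrow> ennreal"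
  proof -
    have "(\<Sum>k<n. g (y k)) = sum_list (map g ys)"
      using len by (simp add: sum_list_sum_nth y_def atLeast0LessThan)
    also have "\<dots> = sum_mset (image_mset g (mset ys))"
      by (metis mset_map sum_mset_sum_list)
    also have "\<dots> = sum_list (map g (map x [1..<n+1]))"
      unfolding ys_def by (metis mset_map mset_sort sum_mset_sum_list)
    also have "\<dots> = (\<Sum>i=1..n. g (x i))"
      by (simp add: sum_list_distinct_conv_sum_set o_def atLeastLessThanSuc_atLeastAtMost del: upt_Suc)
    finally show ?thesis .
  qed
  have "distr unif01 borel (step_fun n y) = empirical_measure n x"
  proof (rule measure_eqI)
    fix A assume "A \<in> sets (distr unif01 borel (step_fun n y))"
    then have A: "A \<in> sets borel" by simp
    show "emeasure (distr unif01 borel (step_fun n y)) A = emeasure (empirical_measure n x) A"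
      using assms sum[of "\<lambda>z. ennreal (1 / real n) * indicator A z"]
      by (simp add: distr_step_fun[OF _ A] emeasure_empirical_measure[OF A])
  qed simp
  then show ?thesis using that mono by blast
qed

lemma step_fun_bounded:
  assumes "0 < n" "0 < u" "u < 1"
  shows "\<bar>step_fun n y u\<bar> \<le> (\<Sum>k<n. \<bar>y k\<bar>)"
  unfolding step_fun_def
  using nat_floor_less[of n u] assms by (intro member_le_sum[of _ "{..<n}" "\<lambda>k. \<bar>y k\<bar>"]) auto

lemma step_fun_mono:
  assumes "0 < n" "0 < u" "u \<le> v" "v < 1" "\<And>k l. k \<le> l \<Longrightarrow> l < n \<Longrightarrow> y k \<le> y l"
  shows "step_fun n y u \<le> step_fun n y v"
  unfolding step_fun_def using assms nat_floor_less[of n v]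
  by (intro assms(5) nat_mono floor_mono mult_left_mono) auto

text \<open>Telescoping over the jumps of \<open>y\<close>. The indicator is written with
  \<open>y k <= y j\<close> instead of \<open>k <= j\<close> so that it depends on the value
  \<open>y j\<close> alone and can define a function of the second coordinate of a coupling; for
  ties with \<open>k > j\<close> the jump is 0.\<close>

lemma telescope_indicator:
  fixes y :: "nat \<Rightarrow> real"
  assumes mono: "\<And>k l. k \<le> l \<Longrightarrow> l < n \<Longrightarrow> y k \<le> y l" and j: "j < n"
  shows "y j = y 0 + (\<Sum>k=1..<n. (y k - y (k - 1)) * of_bool (y k \<le> y j))"
proof -
  have "(\<Sum>k=1..<n. (y k - y (k - 1)) * of_bool (y k \<le> y j))
      = (\<Sum>k=1..<n. (y k - y (k - 1)) * of_bool (k \<le> j))"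
  proof (intro sum.cong refl)
    fix k assume k: "k \<in> {1..<n}"
    show "(y k - y (k - 1)) * of_bool (y k \<le> y j) = (y k - y (k - 1)) * of_bool (k \<le> j)"
    proof (cases "k \<le> j")
      case True
      then show ?thesis using mono[OF True j] by simp
    next
      case False
      then have "y j \<le> y (k - 1)" "y (k - 1) \<le> y k"
        using k by (auto intro!: mono)
      then show ?thesis using False by auto
    qed
  qed
  also have "\<dots> = (\<Sum>k=1..j. y k - y (k - 1))"
    using j by (intro sum.mono_neutral_cong_right) auto
  also have "\<dots> = y j - y 0"
    by (induction j) auto
  finally show ?thesis by simp
qed

text \<open>The Kantorovich potentials for the cost \<open>- x * z\<close>: the first one is the convex piecewise affine
  function with slope \<open>y k\<close> between \<open>Q (k / n)\<close> and \<open>Q ((k + 1) / n)\<close>.\<close>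

definition pot_left :: "nat \<Rightarrow> (nat \<Rightarrow> real) \<Rightarrow> (real \<Rightarrow> real) \<Rightarrow> real \<Rightarrow> real" where
  "pot_left n y Q x = y 0 * x + (\<Sum>k=1..<n. (y k - y (k - 1)) * max 0 (x - Q (real k / real n)))"

definition pot_right :: "nat \<Rightarrow> (nat \<Rightarrow> real) \<Rightarrow> (real \<Rightarrow> real) \<Rightarrow> real \<Rightarrow> real" where
  "pot_right n y Q z = (\<Sum>k=1..<n. (y k - y (k - 1)) * (Q (real k / real n) * of_bool (y k \<le> z)))"

text \<open>Each summand is the inequality \<open>x * e <= max 0 (x - c) + c * e\<close> for
  \<open>e\<close> equal to 0 or 1, weighted with a nonnegative jump of \<open>y\<close>.\<close>

lemma mult_le_potentials:
  assumes mono: "\<And>k l. k \<le> l \<Longrightarrow> l < n \<Longrightarrow> y k \<le> y l" and j: "j < n"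
  shows "x * y j \<le> pot_left n y Q x + pot_right n y Q (y j)"
proof -
  have "x * y j = y 0 * x + (\<Sum>k=1..<n. (y k - y (k - 1)) * (x * of_bool (y k \<le> y j)))"
    by (subst telescope_indicator[OF mono j]) (simp_all add: algebra_simps sum_distrib_left)
  also have "\<dots> \<le> y 0 * x + (\<Sum>k=1..<n. (y k - y (k - 1)) *
      (max 0 (x - Q (real k / real n)) + Q (real k / real n) * of_bool (y k \<le> y j)))"
  proof (intro add_left_mono sum_mono mult_left_mono)
    fix k assume "k \<in> {1..<n}"
    then show "0 \<le> y k - y (k - 1)" using mono[of "k - 1" k] by auto
  qed auto
  also have "\<dots> = pot_left n y Q x + pot_right n y Q (y j)"
    by (simp add: pot_left_def pot_right_def sum.distrib distrib_left)
  finally show ?thesis .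
qed

text \<open>Complementary slackness: at \<open>x = Q u\<close> each summand inequality is an
  equality, because \<open>Q u\<close> lies above \<open>Q (k / n)\<close> when
  \<open>k <= j\<close> and below it otherwise, up to ties, whose weight is 0.\<close>

lemma mult_eq_potentials:
  assumes mono: "\<And>k l. k \<le> l \<Longrightarrow> l < n \<Longrightarrow> y k \<le> y l"
    and Q: "\<And>u v. 0 < u \<Longrightarrow> u \<le> v \<Longrightarrow> v < 1 \<Longrightarrow> Q u \<le> Q v"
    and u: "0 < u" "u < 1" and "0 < n"
  shows "Q u * step_fun n y u = pot_left n y Q (Q u) + pot_right n y Q (step_fun n y u)"
proof -
  define j where "j = nat \<lfloor>real n * u\<rfloor>"
  have j: "j < n" "step_fun n y u = y j"
    using nat_floor_less[of n u] assms by (auto simp: j_def step_fun_def)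
  have "Q u * y j = y 0 * Q u + (\<Sum>k=1..<n. (y k - y (k - 1)) * (Q u * of_bool (y k \<le> y j)))"
    by (subst telescope_indicator[OF mono j(1)]) (simp_all add: algebra_simps sum_distrib_left)
  also have "\<dots> = y 0 * Q u + (\<Sum>k=1..<n. (y k - y (k - 1)) *
      (max 0 (Q u - Q (real k / real n)) + Q (real k / real n) * of_bool (y k \<le> y j)))"
  proof (intro arg_cong2[where f = "(+)"] refl sum.cong)
    fix k assume k: "k \<in> {1..<n}"
    then have kn: "0 < real k / real n" "real k / real n < 1" by auto
    have iff: "k \<le> j \<longleftrightarrow> real k / real n \<le> u"
      using le_nat_floor_iff[of n u k] assms by (simp add: j_def)
    show "(y k - y (k - 1)) * (Q u * of_bool (y k \<le> y j)) = (y k - y (k - 1)) *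
      (max 0 (Q u - Q (real k / real n)) + Q (real k / real n) * of_bool (y k \<le> y j))"
    proof (cases "k \<le> j")
      case True
      then show ?thesis
        using mono[OF True j(1)] Q[of "real k / real n" u] iff kn u by simp
    next
      case False
      then have le: "y j \<le> y (k - 1)" "y (k - 1) \<le> y k"
        using k by (auto intro!: mono)
      have "Q u \<le> Q (real k / real n)"
        using False iff kn u by (intro Q) auto
      then show ?thesis using le by (cases "y k = y (k - 1)") auto
    qed
  qed
  also have "\<dots> = pot_left n y Q (Q u) + pot_right n y Q (y j)"
    by (simp add: pot_left_def pot_right_def sum.distrib distrib_left)
  finally show ?thesis by (simp add: j(2))
qed

lemma pot_measurable [measurable]:
  "pot_left n y Q \<in> borel_measurable borel" "pot_right n y Q \<in> borel_measurable borel"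
  unfolding pot_left_def[abs_def] pot_right_def[abs_def] by measurable

text \<open>Linear growth of the left potential and boundedness of the right one make both
  integrable once \<open>Q\<close> is square integrable.\<close>

lemma pot_bounds:
  obtains C where "\<And>x. \<bar>pot_left n y Q x\<bar> \<le> C * (1 + \<bar>x\<bar>)" "\<And>z. \<bar>pot_right n y Q z\<bar> \<le> C"
proof -
  define A where "A = \<bar>y 0\<bar> + (\<Sum>k=1..<n. \<bar>y k - y (k - 1)\<bar> * (1 + \<bar>Q (real k / real n)\<bar>))"
  have "\<bar>pot_left n y Q x\<bar> \<le> A * (1 + \<bar>x\<bar>)" for x
  proof -
    have "\<bar>pot_left n y Q x\<bar> \<le> \<bar>y 0 * x\<bar> + (\<Sum>k=1..<n. \<bar>(y k - y (k - 1)) * max 0 (x - Q (real k / real n))\<bar>)"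
      unfolding pot_left_def by (intro order_trans[OF abs_triangle_ineq] add_left_mono sum_abs)
    also have "\<dots> \<le> \<bar>y 0\<bar> * (1 + \<bar>x\<bar>) + (\<Sum>k=1..<n. \<bar>y k - y (k - 1)\<bar> * ((1 + \<bar>Q (real k / real n)\<bar>) * (1 + \<bar>x\<bar>)))"
    proof (intro add_mono sum_mono)
      fix k
      have "\<bar>max 0 (x - Q (real k / real n))\<bar> \<le> \<bar>x\<bar> + \<bar>Q (real k / real n)\<bar>" by auto
      also have "\<dots> \<le> (1 + \<bar>Q (real k / real n)\<bar>) * (1 + \<bar>x\<bar>)"
        by (simp add: algebra_simps)
      finally show "\<bar>(y k - y (k - 1)) * max 0 (x - Q (real k / real n))\<bar>
          \<le> \<bar>y k - y (k - 1)\<bar> * ((1 + \<bar>Q (real k / real n)\<bar>) * (1 + \<bar>x\<bar>))"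
        by (simp only: abs_mult mult_left_mono abs_ge_zero)
    qed (simp add: abs_mult mult_left_mono)
    also have "\<dots> = A * (1 + \<bar>x\<bar>)"
      by (simp only: A_def distrib_right sum_distrib_right mult.assoc)
    finally show ?thesis .
  qed
  moreover have "\<bar>pot_right n y Q z\<bar> \<le> A" for z
  proof -
    have "\<bar>pot_right n y Q z\<bar> \<le> (\<Sum>k=1..<n. \<bar>(y k - y (k - 1)) * (Q (real k / real n) * of_bool (y k \<le> z))\<bar>)"
      unfolding pot_right_def by (rule sum_abs)
    also have "\<dots> \<le> (\<Sum>k=1..<n. \<bar>y k - y (k - 1)\<bar> * (1 + \<bar>Q (real k / real n)\<bar>))"
      by (intro sum_mono) (auto simp: abs_mult intro!: mult_left_mono)
    finally show ?thesis by (simp add: A_def)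
  qed
  ultimately show ?thesis using that by blast
qed

lemma integrable_of_square:
  assumes "finite_measure M" "f \<in> borel_measurable M" "integrable M (\<lambda>x. (f x)\<^sup>2 :: real)"
  shows "integrable M f"
proof -
  interpret finite_measure M by fact
  have *: "\<bar>t\<bar> \<le> 1 + t\<^sup>2" for t :: real
    using sum_squares_bound[of 1 "\<bar>t\<bar>"] by (cases "\<bar>t\<bar> \<le> 1") (auto simp: power2_eq_square)
  show ?thesis
    using assms by (intro Bochner_Integration.integrable_bound[of M "\<lambda>x. 1 + (f x)\<^sup>2" f]) (auto intro!: always_eventually order_trans[OF *])
qed

text \<open>Weak duality: \<open>A x + B z <= (x - z)^2\<close> when \<open>z\<close> is an atom,
  with equality along \<open>(Q u, q u)\<close>. The integrals of \<open>A\<close> and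
  \<open>B\<close> depend on the marginals only, so every coupling costs at least as much as the
  monotone one.\<close>

lemma coupling_cost_ge:
  assumes mono: "\<And>k l. k \<le> l \<Longrightarrow> l < n \<Longrightarrow> y k \<le> y l" and n: "0 < n"
    and Q: "\<And>u v. 0 < u \<Longrightarrow> u \<le> v \<Longrightarrow> v < 1 \<Longrightarrow> Q u \<le> Q v"
    and [measurable]: "Q \<in> borel_measurable unif01"
    and Q2: "integrable unif01 (\<lambda>u. (Q u)\<^sup>2)"
    and \<pi>: "\<pi> \<in> couplings (distr unif01 borel Q) (distr unif01 borel (step_fun n y))"
  shows "ennreal (\<integral>u. (Q u - step_fun n y u)\<^sup>2 \<partial>unif01) \<le> (\<integral>\<^sup>+ (x, z). ennreal (\<bar>x - z\<bar>\<^sup>2) \<partial>\<pi>)"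
proof -
  let ?q = "step_fun n y"
  have sets_\<pi>[measurable_cong]: "sets \<pi> = sets (borel \<Otimes>\<^sub>M borel)" and "prob_space \<pi>"
    and fst: "distr \<pi> borel fst = distr unif01 borel Q"
    and snd: "distr \<pi> borel snd = distr unif01 borel ?q"
    using \<pi> by (auto simp: couplings_def)
  interpret \<pi>: prob_space \<pi> by fact
  define A where "A x = x\<^sup>2 - 2 * pot_left n y Q x" for x
  define B where "B z = z\<^sup>2 - 2 * pot_right n y Q z" for z
  have [measurable]: "A \<in> borel_measurable borel" "B \<in> borel_measurable borel"
    unfolding A_def[abs_def] B_def[abs_def] by measurable
  obtain C where C: "\<And>x. \<bar>pot_left n y Q x\<bar> \<le> C * (1 + \<bar>x\<bar>)" "\<And>z. \<bar>pot_right n y Q z\<bar> \<le> C"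
    using pot_bounds[of n y Q] by metis
  have "0 \<le> C" using C(2) abs_ge_zero order_trans by blast
  have intQ: "integrable unif01 Q"
    by (rule integrable_of_square) (auto intro: unif01.finite_measure_axioms Q2)
  have intA: "integrable unif01 (\<lambda>u. A (Q u))"
    unfolding A_def
  proof (intro Bochner_Integration.integrable_diff Q2 integrable_mult_right)
    have "integrable unif01 (\<lambda>u. C * (1 + \<bar>Q u\<bar>))" using intQ by auto
    then show "integrable unif01 (\<lambda>u. pot_left n y Q (Q u))"
    proof (rule Bochner_Integration.integrable_bound)
      show "AE u in unif01. norm (pot_left n y Q (Q u)) \<le> norm (C * (1 + \<bar>Q u\<bar>))"
        using C(1) \<open>0 \<le> C\<close> by (intro AE_I2) (simp add: abs_mult)
    qed measurable
  qed
  have intB: "integrable unif01 (\<lambda>u. B (?q u))"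
  proof (rule unif01.integrable_const_bound)
    define M where "M = (\<Sum>k<n. \<bar>y k\<bar>)"
    have "\<bar>B (?q u)\<bar> \<le> M\<^sup>2 + 2 * C" if "0 < u" "u < 1" for u
    proof -
      have "\<bar>?q u\<bar> \<le> M" using step_fun_bounded[OF n that] by (simp add: M_def)
      then have "(?q u)\<^sup>2 \<le> M\<^sup>2" by (metis abs_ge_zero power2_abs power_mono)
      moreover have "0 \<le> (?q u)\<^sup>2" by simp
      ultimately show ?thesis using C(2)[of "?q u"] unfolding B_def by linarith
    qed
    then show "AE u in unif01. norm (B (?q u)) \<le> M\<^sup>2 + 2 * C"
      by (intro AE_I2) auto
  qed measurable
  have "integrable (distr \<pi> borel fst) A" "integrable (distr \<pi> borel snd) B"
    unfolding fst snd using intA intB by (simp_all add: integrable_distr_eq)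
  then have int\<pi>: "integrable \<pi> (\<lambda>p. A (fst p))" "integrable \<pi> (\<lambda>p. B (snd p))"
    by (simp_all add: integrable_distr_eq)
  have "(\<integral>p. A (fst p) \<partial>\<pi>) = (\<integral>x. A x \<partial>distr \<pi> borel fst)"
    by (simp add: integral_distr)
  also have "\<dots> = (\<integral>u. A (Q u) \<partial>unif01)"
    unfolding fst by (simp add: integral_distr)
  finally have eqA: "(\<integral>p. A (fst p) \<partial>\<pi>) = (\<integral>u. A (Q u) \<partial>unif01)" .
  have "(\<integral>p. B (snd p) \<partial>\<pi>) = (\<integral>x. B x \<partial>distr \<pi> borel snd)"
    by (simp add: integral_distr)
  also have "\<dots> = (\<integral>u. B (?q u) \<partial>unif01)"
    unfolding snd by (simp add: integral_distr)
  finally have eqB: "(\<integral>p. B (snd p) \<partial>\<pi>) = (\<integral>u. B (?q u) \<partial>unif01)" .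
  have "(\<integral>u. (Q u - ?q u)\<^sup>2 \<partial>unif01) = (\<integral>u. A (Q u) + B (?q u) \<partial>unif01)"
  proof (intro Bochner_Integration.integral_cong refl)
    fix u assume "u \<in> space unif01"
    then have "Q u * ?q u = pot_left n y Q (Q u) + pot_right n y Q (?q u)"
      using n by (intro mult_eq_potentials mono Q) auto
    then show "(Q u - ?q u)\<^sup>2 = A (Q u) + B (?q u)"
      unfolding A_def B_def power2_diff by linarith
  qed
  also have "\<dots> = (\<integral>p. A (fst p) + B (snd p) \<partial>\<pi>)"
    using intA intB int\<pi> eqA eqB by simp
  \<comment> \<open>The truncation at 0 prepares the passage to the nonnegative integral: the cost
    of \<open>\<pi>\<close> may be infinite, so it cannot be handled as a Bochner integral.\<close>
  also have "\<dots> \<le> (\<integral>p. max 0 (A (fst p) + B (snd p)) \<partial>\<pi>)"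
    using int\<pi> by (intro integral_mono) auto
  finally have "ennreal (\<integral>u. (Q u - ?q u)\<^sup>2 \<partial>unif01) \<le> ennreal (\<integral>p. max 0 (A (fst p) + B (snd p)) \<partial>\<pi>)"
    by (rule ennreal_leI)
  also have "\<dots> = (\<integral>\<^sup>+p. ennreal (max 0 (A (fst p) + B (snd p))) \<partial>\<pi>)"
    using int\<pi> by (intro nn_integral_eq_integral[symmetric]) auto
  also have "\<dots> \<le> (\<integral>\<^sup>+ (x, z). ennreal (\<bar>x - z\<bar>\<^sup>2) \<partial>\<pi>)"
  proof (intro nn_integral_mono_AE)
    have [measurable]: "y ` {..<n} \<in> sets borel" by (intro borel_closed finite_imp_closed) simp
    \<comment> \<open>The potential inequality is known only for \<open>z\<close> among the values
      \<open>y k\<close>; the second marginal charges nothing else.\<close>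
    have "AE z in distr \<pi> borel snd. z \<in> y ` {..<n}"
      unfolding snd using n nat_floor_less
      by (subst AE_distr_iff) (auto simp: step_fun_def intro!: AE_I2)
    then have "AE p in \<pi>. snd p \<in> y ` {..<n}"
      by (subst (asm) AE_distr_iff) auto
    then show "AE p in \<pi>. ennreal (max 0 (A (fst p) + B (snd p))) \<le> (case p of (x, z) \<Rightarrow> ennreal (\<bar>x - z\<bar>\<^sup>2))"
    proof eventually_elim
      case (elim p)
      then obtain j where j: "j < n" "snd p = y j" by auto
      have "fst p * y j \<le> pot_left n y Q (fst p) + pot_right n y Q (y j)"
        by (intro mult_le_potentials mono j(1))
      then have "A (fst p) + B (snd p) \<le> (fst p - snd p)\<^sup>2"
        unfolding A_def B_def j(2) power2_diff by linarith
      then show ?case by (auto simp: split_beta intro!: ennreal_leI)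
    qed
  qed
  finally show ?thesis .
qed

lemma distr_pair_in_couplings:
  assumes [measurable]: "R \<in> borel_measurable unif01" "q \<in> borel_measurable unif01"
  shows "distr unif01 (borel \<Otimes>\<^sub>M borel) (\<lambda>u. (R u, q u)) \<in> couplings (distr unif01 borel R) (distr unif01 borel q)"
  by (auto simp: couplings_def distr_distr o_def intro!: unif01.prob_space_distr)

section \<open>Reduction to a projection in \<open>L^2\<close>\<close>

definition transport_cost :: "real measure \<Rightarrow> real measure \<Rightarrow> ennreal" where
  "transport_cost \<mu> \<nu> = (INF \<pi> \<in> couplings \<mu> \<nu>. \<integral>\<^sup>+ (x, y). ennreal (\<bar>x - y\<bar>\<^sup>2) \<partial>\<pi>)"

lemma W2_le_imp_transport_cost_le:
  assumes "W2 \<mu> \<nu> \<le> W2 \<mu>' \<nu>'"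
  shows "transport_cost \<mu> \<nu> \<le> transport_cost \<mu>' \<nu>'"
proof (cases "transport_cost \<mu>' \<nu>' = \<top>")
  case False
  have W: "W2 \<mu> \<nu> = (if transport_cost \<mu> \<nu> = \<top> then \<top> else ennreal (sqrt (enn2real (transport_cost \<mu> \<nu>))))" for \<mu> \<nu>
    by (simp add: W2_def transport_cost_def Let_def)
  have fin: "transport_cost \<mu> \<nu> \<noteq> \<top>"
    using assms False by (auto simp: W top_unique split: if_splits)
  then have "sqrt (enn2real (transport_cost \<mu> \<nu>)) \<le> sqrt (enn2real (transport_cost \<mu>' \<nu>'))"
    using assms False by (simp add: W)
  then have "enn2real (transport_cost \<mu> \<nu>) \<le> enn2real (transport_cost \<mu>' \<nu>')" by simp
  then show ?thesis
    using fin False by (metis ennreal_enn2real_if ennreal_leI)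
qed simp

text \<open>The pair \<open>(R, q)\<close> under the uniform measure is an admissible coupling,
  optimal or not; an upper bound is all that is asked of a competitor.\<close>

lemma transport_cost_le:
  assumes [measurable]: "R \<in> borel_measurable unif01" "q \<in> borel_measurable unif01"
    and int: "integrable unif01 (\<lambda>u. (R u - q u)\<^sup>2)"
  shows "transport_cost (distr unif01 borel R) (distr unif01 borel q) \<le> ennreal (\<integral>u. (R u - q u)\<^sup>2 \<partial>unif01)"
proof -
  have "transport_cost (distr unif01 borel R) (distr unif01 borel q)
      \<le> (\<integral>\<^sup>+ (x, y). ennreal (\<bar>x - y\<bar>\<^sup>2) \<partial>distr unif01 (borel \<Otimes>\<^sub>M borel) (\<lambda>u. (R u, q u)))"
    unfolding transport_cost_def by (intro INF_lower distr_pair_in_couplings) measurable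
  also have "\<dots> = (\<integral>\<^sup>+u. ennreal ((R u - q u)\<^sup>2) \<partial>unif01)"
    by (subst nn_integral_distr) auto
  also have "\<dots> = ennreal (\<integral>u. (R u - q u)\<^sup>2 \<partial>unif01)"
    using int by (intro nn_integral_eq_integral) auto
  finally show ?thesis .
qed

lemma integrable_square_step_diff:
  assumes "0 < n" "R \<in> borel_measurable unif01" "integrable unif01 (\<lambda>u. (R u)\<^sup>2)"
  shows "integrable unif01 (\<lambda>u. (R u - step_fun n y u)\<^sup>2)"
proof -
  note [measurable] = assms(2)
  define M where "M = (\<Sum>k<n. \<bar>y k\<bar>)"
  have "integrable unif01 (\<lambda>u. 2 * (R u)\<^sup>2 + 2 * M\<^sup>2)" using assms by auto
  then show ?thesis
  proof (rule Bochner_Integration.integrable_bound)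
    have "norm ((R u - step_fun n y u)\<^sup>2) \<le> norm (2 * (R u)\<^sup>2 + 2 * M\<^sup>2)" if "0 < u" "u < 1" for u
    proof -
      have "(step_fun n y u)\<^sup>2 \<le> M\<^sup>2"
        using step_fun_bounded[OF assms(1) that, of y] unfolding M_def by (metis abs_ge_zero power2_abs power_mono)
      moreover have "0 \<le> (R u + step_fun n y u)\<^sup>2" by simp
      ultimately have "(R u - step_fun n y u)\<^sup>2 \<le> 2 * (R u)\<^sup>2 + 2 * M\<^sup>2"
        by (simp add: power2_diff power2_sum)
      then show ?thesis by simp
    qed
    then show "AE u in unif01. norm ((R u - step_fun n y u)\<^sup>2) \<le> norm (2 * (R u)\<^sup>2 + 2 * M\<^sup>2)"
      by (intro AE_I2) auto
  qed measurable
qed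

text \<open>Minimality is tested against all square integrable \<open>R\<close> with log-concave
  law, monotone or not. The shape of \<open>Q\<close> itself is recorded separately by the lemma
  that produces it.\<close>

definition quantile_projection :: "(real \<Rightarrow> real) \<Rightarrow> (real \<Rightarrow> real) \<Rightarrow> bool" where
  "quantile_projection q Q \<longleftrightarrow> Q \<in> borel_measurable unif01 \<and> integrable unif01 (\<lambda>u. (Q u)\<^sup>2) \<and>
     (\<forall>R. R \<in> borel_measurable unif01 \<longrightarrow> integrable unif01 (\<lambda>u. (R u)\<^sup>2) \<longrightarrow>
        distr unif01 borel R \<in> log_concave_distributions \<longrightarrow>
        (\<integral>u. (Q u - q u)\<^sup>2 \<partial>unif01) \<le> (\<integral>u. (R u - q u)\<^sup>2 \<partial>unif01))"

lemma quantile_projectionD: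
  assumes "quantile_projection q Q"
  shows "Q \<in> borel_measurable unif01" and "integrable unif01 (\<lambda>u. (Q u)\<^sup>2)"
    and "R \<in> borel_measurable unif01 \<Longrightarrow> integrable unif01 (\<lambda>u. (R u)\<^sup>2) \<Longrightarrow>
      distr unif01 borel R \<in> log_concave_distributions \<Longrightarrow>
      (\<integral>u. (Q u - q u)\<^sup>2 \<partial>unif01) \<le> (\<integral>u. (R u - q u)\<^sup>2 \<partial>unif01)"
  using assms by (auto simp: quantile_projection_def)

text \<open>By duality the cost of \<open>\<mu>\<close> is at least the squared \<open>L^2\<close>
  distance of \<open>Q\<close> from the step function, while the cost of a competitor is at most
  that of \<open>R\<close>; minimality compares the two costs.\<close>

lemma W2_projection_minimizes:
  assumes mono: "\<And>k l. k \<le> l \<Longrightarrow> l < n \<Longrightarrow> y k \<le> y l" and n: "0 < n"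
    and proj: "is_W2_projection log_concave_distributions (distr unif01 borel (step_fun n y)) \<mu>"
  obtains Q where "quantile_projection (step_fun n y) Q"
    "distr unif01 borel Q = \<mu>" "(\<exists>I. density_quantile I Q) \<or> (\<exists>a. Q = (\<lambda>_. a))"
proof -
  let ?q = "step_fun n y" and ?\<nu> = "distr unif01 borel (step_fun n y)"
  have \<mu>: "\<mu> \<in> log_concave_distributions"
    and min: "\<And>\<mu>'. \<mu>' \<in> log_concave_distributions \<Longrightarrow> transport_cost \<mu> ?\<nu> \<le> transport_cost \<mu>' ?\<nu>"
    using proj W2_le_imp_transport_cost_le by (auto simp: is_W2_projection_def)
  have const: "distr unif01 borel (\<lambda>_. a) = return borel a" for a :: real
    by (rule unif01.distr_const) simp
  obtain Q where Q: "distr unif01 borel Q = \<mu>" "(\<exists>I. density_quantile I Q) \<or> (\<exists>a. Q = (\<lambda>_. a))"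
  proof (cases "point_mass \<mu>")
    case True
    then obtain a where "\<mu> = return borel a" by (auto simp: point_mass_def)
    then show ?thesis using that[of "\<lambda>_. a"] const by auto
  next
    case False
    then obtain f where "has_real_density \<mu> f" "ereal_concave (\<lambda>x. ext_ln (f x))" "prob_space \<mu>"
      using \<mu> by (auto simp: log_concave_distributions_def)
    then show ?thesis
      using log_concave_density_imp_density_quantile[of \<mu> f] that by blast
  qed
  have meas[measurable]: "Q \<in> borel_measurable unif01"
    using Q(2) density_quantile_measurable by auto
  have Qmono: "\<And>u v. 0 < u \<Longrightarrow> u \<le> v \<Longrightarrow> v < 1 \<Longrightarrow> Q u \<le> Q v"
    using Q(2) density_quantile_mono by auto
  \<comment> \<open>The finite second moment comes from minimality: comparison with the point mass
    at 0 yields a coupling of finite cost, and the other marginal has bounded support.\<close>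
  have sq: "integrable unif01 (\<lambda>u. (Q u)\<^sup>2)"
  proof -
    have "transport_cost \<mu> ?\<nu> \<le> transport_cost (distr unif01 borel (\<lambda>_. 0)) ?\<nu>"
    proof (rule min)
      show "distr unif01 borel (\<lambda>_. 0) \<in> log_concave_distributions"
        by (auto simp: const log_concave_distributions_def point_mass_def intro!: prob_space_return)
    qed
    also have "\<dots> \<le> ennreal (\<integral>u. (0 - ?q u)\<^sup>2 \<partial>unif01)"
      by (intro transport_cost_le integrable_square_step_diff n) auto
    also have "\<dots> < \<top>" by simp
    finally obtain \<pi> where \<pi>: "\<pi> \<in> couplings \<mu> ?\<nu>"
      and fin: "(\<integral>\<^sup>+ (x, z). ennreal (\<bar>x - z\<bar>\<^sup>2) \<partial>\<pi>) < \<top>"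
      unfolding transport_cost_def INF_less_iff by blast
    have sets_\<pi>[measurable_cong]: "sets \<pi> = sets (borel \<Otimes>\<^sub>M borel)" and prob: "prob_space \<pi>"
      and fst: "distr \<pi> borel fst = distr unif01 borel Q"
      and snd: "distr \<pi> borel snd = ?\<nu>"
      using \<pi> Q(1) by (auto simp: couplings_def)
    interpret \<pi>: prob_space \<pi> by fact
    have "(\<integral>\<^sup>+u. ennreal ((Q u)\<^sup>2) \<partial>unif01) = (\<integral>\<^sup>+x. ennreal (x\<^sup>2) \<partial>distr \<pi> borel fst)"
      unfolding fst by (subst nn_integral_distr) auto
    also have "\<dots> = (\<integral>\<^sup>+p. ennreal ((fst p)\<^sup>2) \<partial>\<pi>)"
      by (subst nn_integral_distr) auto
    also have "\<dots> \<le> (\<integral>\<^sup>+p. 2 * ennreal (\<bar>fst p - snd p\<bar>\<^sup>2) + 2 * ennreal ((snd p)\<^sup>2) \<partial>\<pi>)"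
    proof (intro nn_integral_mono)
      fix p :: "real \<times> real"
      \<comment> \<open>This square is the difference of the two sides of the next
        inequality.\<close>
      have "0 \<le> (fst p - 2 * snd p)\<^sup>2" by simp
      then have "(fst p)\<^sup>2 \<le> 2 * \<bar>fst p - snd p\<bar>\<^sup>2 + 2 * (snd p)\<^sup>2"
        by (simp add: power2_eq_square algebra_simps)
      then have "ennreal ((fst p)\<^sup>2) \<le> ennreal (2 * \<bar>fst p - snd p\<bar>\<^sup>2 + 2 * (snd p)\<^sup>2)"
        by (rule ennreal_leI)
      then show "ennreal ((fst p)\<^sup>2) \<le> 2 * ennreal (\<bar>fst p - snd p\<bar>\<^sup>2) + 2 * ennreal ((snd p)\<^sup>2)"
        by (simp add: ennreal_plus ennreal_mult)
    qed
    also have "\<dots> = 2 * (\<integral>\<^sup>+p. ennreal (\<bar>fst p - snd p\<bar>\<^sup>2) \<partial>\<pi>) + 2 * (\<integral>\<^sup>+p. ennreal ((snd p)\<^sup>2) \<partial>\<pi>)"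
      by (subst nn_integral_add) (auto simp: nn_integral_cmult)
    also have "(\<integral>\<^sup>+p. ennreal ((snd p)\<^sup>2) \<partial>\<pi>) = (\<integral>\<^sup>+x. ennreal (x\<^sup>2) \<partial>distr \<pi> borel snd)"
      by (subst nn_integral_distr) auto
    also have "\<dots> = (\<integral>\<^sup>+u. ennreal ((?q u)\<^sup>2) \<partial>unif01)"
      unfolding snd by (subst nn_integral_distr) auto
    also have "\<dots> = ennreal (\<integral>u. (0 - ?q u)\<^sup>2 \<partial>unif01)"
      using integrable_square_step_diff[OF n, of "\<lambda>_. 0" y] by (subst nn_integral_eq_integral[symmetric]) auto
    also have "2 * (\<integral>\<^sup>+p. ennreal (\<bar>fst p - snd p\<bar>\<^sup>2) \<partial>\<pi>) + 2 * \<dots> < \<top>"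
      using fin by (simp add: case_prod_unfold ennreal_mult_less_top)
    finally show ?thesis
      by (intro integrableI_nonneg) auto
  qed
  have "(\<integral>u. (Q u - ?q u)\<^sup>2 \<partial>unif01) \<le> (\<integral>u. (R u - ?q u)\<^sup>2 \<partial>unif01)"
    if [measurable]: "R \<in> borel_measurable unif01" and R2: "integrable unif01 (\<lambda>u. (R u)\<^sup>2)"
      and R: "distr unif01 borel R \<in> log_concave_distributions" for R
  proof -
    have "ennreal (\<integral>u. (Q u - ?q u)\<^sup>2 \<partial>unif01) \<le> transport_cost \<mu> ?\<nu>"
      unfolding transport_cost_def Q(1)[symmetric]
      by (intro INF_greatest coupling_cost_ge mono n Qmono meas sq)
    also have "\<dots> \<le> transport_cost (distr unif01 borel R) ?\<nu>"
      by (rule min[OF R])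
    also have "\<dots> \<le> ennreal (\<integral>u. (R u - ?q u)\<^sup>2 \<partial>unif01)"
      by (intro transport_cost_le integrable_square_step_diff n R2) auto
    finally show ?thesis
      by (subst (asm) ennreal_le_iff) (auto intro: Bochner_Integration.integral_nonneg)
  qed
  then have "quantile_projection ?q Q"
    using meas sq by (simp add: quantile_projection_def)
  then show ?thesis using that Q by blast
qed

section \<open>First-order condition and boundedness\<close>


lemma density_quantile_scale:
  assumes dq: "density_quantile I Q" and c: "0 < c"
  shows "density_quantile (\<lambda>u. I u / c) (\<lambda>u. c * Q u)"
  unfolding density_quantile_def has_supporting_lines_def
proof (intro conjI ballI)
  fix u :: real assume u: "u \<in> {0<..<1}"
  obtain s where s: "\<And>v. v \<in> {0<..<1} \<Longrightarrow> I v \<le> I u + s * (v - u)"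
    using density_quantileD(1)[OF dq] u unfolding has_supporting_lines_def by blast
  show "\<exists>s. \<forall>v\<in>{0<..<1}. I v / c \<le> I u / c + s * (v - u)"
  proof (intro exI[of _ "s / c"] ballI)
    fix v :: real assume "v \<in> {0<..<1}"
    then have "I v / c \<le> (I u + s * (v - u)) / c"
      using s c by (intro divide_right_mono) auto
    then show "I v / c \<le> I u / c + s / c * (v - u)" by (simp add: add_divide_distrib)
  qed
  show "0 < I u / c" using density_quantileD(2)[OF dq] u c by auto
  show "((\<lambda>u. c * Q u) has_real_derivative 1 / (I u / c)) (at u)"
    using density_quantileD(3)[OF dq, of u] u by (auto intro!: derivative_eq_intros)
qed

lemma density_quantile_shift:
  "density_quantile I Q \<Longrightarrow> density_quantile I (\<lambda>u. Q u + c)"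
  unfolding density_quantile_def by (auto intro!: derivative_eq_intros)

text \<open>The harmonic sum of two concave functions is concave: \<open>a b / (a + b)\<close> is the minimum over
  \<open>\<lambda>\<close> of \<open>\<lambda>\<^sup>2 a + (1 - \<lambda>)\<^sup>2 b\<close>.\<close>

lemma harmonic_le:
  fixes a b l :: real
  assumes "0 < a" "0 < b"
  shows "a * b / (a + b) \<le> l\<^sup>2 * a + (1 - l)\<^sup>2 * b"
proof -
  have "(l\<^sup>2 * a + (1 - l)\<^sup>2 * b) * (a + b) - a * b = (l * a - (1 - l) * b)\<^sup>2"
    by (simp add: power2_eq_square algebra_simps)
  then have "a * b \<le> (l\<^sup>2 * a + (1 - l)\<^sup>2 * b) * (a + b)"
    by (metis diff_ge_0_iff_ge zero_le_power2)
  then show ?thesis using assms by (simp add: pos_divide_le_eq)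
qed

lemma density_quantile_add:
  assumes I: "density_quantile I Q" and J: "density_quantile J R"
  shows "density_quantile (\<lambda>u. I u * J u / (I u + J u)) (\<lambda>u. Q u + R u)"
  unfolding density_quantile_def has_supporting_lines_def
proof (intro conjI ballI)
  fix u :: real assume u: "u \<in> {0<..<1}"
  have pos: "0 < I v" "0 < J v" if "v \<in> {0<..<1}" for v
    using that density_quantileD(2)[OF I] density_quantileD(2)[OF J] by auto
  obtain s where s: "\<And>v. v \<in> {0<..<1} \<Longrightarrow> I v \<le> I u + s * (v - u)"
    using density_quantileD(1)[OF I] u unfolding has_supporting_lines_def by blast
  obtain t where t: "\<And>v. v \<in> {0<..<1} \<Longrightarrow> J v \<le> J u + t * (v - u)"
    using density_quantileD(1)[OF J] u unfolding has_supporting_lines_def by blast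
  \<comment> \<open>The minimizing weight at \<open>u\<close>. With this weight kept fixed while
    \<open>v\<close> varies, \<open>harmonic_le\<close> gives a majorant that touches the harmonic
    sum at \<open>u\<close>, and the supporting lines of \<open>I\<close> and \<open>J\<close> bound
    it further.\<close>
  define l where "l = J u / (I u + J u)"
  have l': "1 - l = I u / (I u + J u)"
    using pos[OF u] by (simp add: l_def field_simps)
  have "l\<^sup>2 * I u + (1 - l)\<^sup>2 * J u = I u * J u * (I u + J u) / (I u + J u)\<^sup>2"
    unfolding l' unfolding l_def power_divide
    by (simp add: add_divide_distrib[symmetric] power2_eq_square algebra_simps)
  also have "\<dots> = I u * J u / (I u + J u)"
    by (simp add: power2_eq_square)
  finally have eq: "l\<^sup>2 * I u + (1 - l)\<^sup>2 * J u = I u * J u / (I u + J u)" .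
  show "\<exists>s. \<forall>v\<in>{0<..<1}. I v * J v / (I v + J v) \<le> I u * J u / (I u + J u) + s * (v - u)"
  proof (intro exI[of _ "l\<^sup>2 * s + (1 - l)\<^sup>2 * t"] ballI)
    fix v :: real assume v: "v \<in> {0<..<1}"
    have "I v * J v / (I v + J v) \<le> l\<^sup>2 * I v + (1 - l)\<^sup>2 * J v"
      by (rule harmonic_le[OF pos[OF v]])
    also have "\<dots> \<le> l\<^sup>2 * (I u + s * (v - u)) + (1 - l)\<^sup>2 * (J u + t * (v - u))"
      using s[OF v] t[OF v] by (intro add_mono mult_left_mono) auto
    also have "\<dots> = (l\<^sup>2 * I u + (1 - l)\<^sup>2 * J u) + (l\<^sup>2 * s + (1 - l)\<^sup>2 * t) * (v - u)"
      by (simp add: algebra_simps)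
    finally show "I v * J v / (I v + J v) \<le> I u * J u / (I u + J u) + (l\<^sup>2 * s + (1 - l)\<^sup>2 * t) * (v - u)"
      by (simp only: eq)
  qed
  show "0 < I u * J u / (I u + J u)"
    using pos[OF u] by (simp add: pos_add_strict)
  have "1 / I u + 1 / J u = 1 / (I u * J u / (I u + J u))"
    using pos[OF u] by (simp add: field_simps)
  then show "((\<lambda>u. Q u + R u) has_real_derivative 1 / (I u * J u / (I u + J u))) (at u)"
    using density_quantileD(3)[OF I, of u] density_quantileD(3)[OF J, of u] u
    by (metis DERIV_add greaterThanLessThan_iff)
qed

lemma density_quantile_reflect:
  assumes dq: "density_quantile I Q"
  shows "density_quantile (\<lambda>u. I (1 - u)) (\<lambda>u. - Q (1 - u))"
  unfolding density_quantile_def has_supporting_lines_def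
proof (intro conjI ballI)
  fix u :: real assume u: "u \<in> {0<..<1}"
  then have u': "1 - u \<in> {0<..<1}" by auto
  obtain s where s: "\<And>v. v \<in> {0<..<1} \<Longrightarrow> I v \<le> I (1 - u) + s * (v - (1 - u))"
    using density_quantileD(1)[OF dq] u' unfolding has_supporting_lines_def by blast
  show "\<exists>s. \<forall>v\<in>{0<..<1}. I (1 - v) \<le> I (1 - u) + s * (v - u)"
  proof (intro exI[of _ "- s"] ballI)
    fix v :: real assume "v \<in> {0<..<1}"
    then show "I (1 - v) \<le> I (1 - u) + - s * (v - u)"
      using s[of "1 - v"] by (simp add: algebra_simps)
  qed
  show "0 < I (1 - u)" using density_quantileD(2)[OF dq] u' by auto
  have "((\<lambda>u. Q (1 - u)) has_real_derivative 1 / I (1 - u) * (- 1)) (at u)"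
    using u' by (intro DERIV_chain'[where g = Q] density_quantileD(3)[OF dq]) (auto intro!: derivative_eq_intros)
  then show "((\<lambda>u. - Q (1 - u)) has_real_derivative 1 / I (1 - u)) (at u)"
    using DERIV_minus by fastforce
qed

lemma squeeze_in_unit_interval:
  fixes d u :: real
  assumes "0 < d" "d < 1" "0 < u" "u < 1"
  shows "0 < d + (1 - d) * u" "d + (1 - d) * u < 1"
proof -
  have "0 < (1 - d) * (1 - u)" "0 < (1 - d) * u"
    using assms by (intro mult_pos_pos; simp)+
  then show "0 < d + (1 - d) * u" "d + (1 - d) * u < 1"
    using assms(1) by (auto simp: algebra_simps)
qed

text \<open>The law of the squeezed function is the original one conditioned to exceed
  \<open>Q d\<close>, that is, with its lower tail cut off.\<close>

lemma density_quantile_squeeze: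
  assumes dq: "density_quantile I Q" and d: "0 < d" "d < 1"
  shows "density_quantile (\<lambda>u. I (d + (1 - d) * u) / (1 - d)) (\<lambda>u. Q (d + (1 - d) * u))"
  unfolding density_quantile_def has_supporting_lines_def
proof (intro conjI ballI)
  have in01: "d + (1 - d) * u \<in> {0<..<1}" if "u \<in> {0<..<1}" for u
    using squeeze_in_unit_interval[OF d, of u] that by auto
  fix u :: real assume u: "u \<in> {0<..<1}"
  let ?a = "\<lambda>u. d + (1 - d) * u"
  obtain s where s: "\<And>v. v \<in> {0<..<1} \<Longrightarrow> I v \<le> I (?a u) + s * (v - ?a u)"
    using density_quantileD(1)[OF dq] in01[OF u] unfolding has_supporting_lines_def by blast
  show "\<exists>s. \<forall>v\<in>{0<..<1}. I (?a v) / (1 - d) \<le> I (?a u) / (1 - d) + s * (v - u)"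
  proof (intro exI[of _ s] ballI)
    fix v :: real assume "v \<in> {0<..<1}"
    then have "I (?a v) / (1 - d) \<le> (I (?a u) + s * (?a v - ?a u)) / (1 - d)"
      using d in01 by (intro divide_right_mono s) auto
    also have "s * (?a v - ?a u) = (1 - d) * (s * (v - u))" by (simp add: algebra_simps)
    finally show "I (?a v) / (1 - d) \<le> I (?a u) / (1 - d) + s * (v - u)"
      using d by (simp add: add_divide_distrib)
  qed
  show "0 < I (?a u) / (1 - d)" using density_quantileD(2)[OF dq] in01[OF u] d by auto
  have "((\<lambda>u. Q (?a u)) has_real_derivative 1 / I (?a u) * (1 - d)) (at u)"
    using in01[OF u] by (intro DERIV_chain'[where g = Q] density_quantileD(3)[OF dq]) (auto intro!: derivative_eq_intros)
  then show "((\<lambda>u. Q (?a u)) has_real_derivative 1 / (I (?a u) / (1 - d))) (at u)"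
    by simp
qed

section \<open>Changes of variable on (0, 1) and variations of a square integral\<close>

lemma unif01_integral: "(\<integral>u. f u \<partial>unif01) = (\<integral>u. indicator {0<..<1} u * f u \<partial>lborel)" for f :: "real \<Rightarrow> real"
  unfolding unif01_def by (subst integral_restrict_space) auto

lemma unif01_integrable: "integrable unif01 f \<longleftrightarrow> integrable lborel (\<lambda>u. indicator {0<..<1} u * f u)" for f :: "real \<Rightarrow> real"
  unfolding unif01_def by (subst integrable_restrict_space) auto

lemma unif01_integral_reflect: "(\<integral>u. f (1 - u) \<partial>unif01) = (\<integral>u. f u \<partial>unif01)" for f :: "real \<Rightarrow> real"
proof -
  have "(\<integral>u. f u \<partial>unif01) = (\<integral>u. indicator {0<..<1} (1 + (-1) * u) * f (1 + (-1) * u) \<partial>lborel)"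
    unfolding unif01_integral
    by (subst lborel_integral_real_affine[where c = "-1" and t = 1]) simp_all
  also have "\<dots> = (\<integral>u. indicator {0<..<1} u * f (1 - u) \<partial>lborel)"
    by (intro Bochner_Integration.integral_cong) (auto simp: indicator_def)
  finally show ?thesis by (simp add: unif01_integral)
qed

lemma unif01_integrable_reflect: "integrable unif01 f \<Longrightarrow> integrable unif01 (\<lambda>u. f (1 - u))" for f :: "real \<Rightarrow> real"
proof -
  assume "integrable unif01 f"
  then have "integrable lborel (\<lambda>u. indicator {0<..<1} (1 + (-1) * u) * f (1 + (-1) * u))"
    unfolding unif01_integrable by (intro lborel_integrable_real_affine) auto
  also have "(\<lambda>u. indicator {0<..<1} (1 + (-1) * u) * f (1 + (-1) * u)) = (\<lambda>u. indicator {0<..<1} u * f (1 - u))"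
    by (auto simp: indicator_def)
  finally show ?thesis by (simp add: unif01_integrable)
qed

lemma unif01_integrable_squeeze:
  fixes f :: "real \<Rightarrow> real"
  assumes "integrable unif01 f" "0 < d" "d < 1"
  shows "integrable unif01 (\<lambda>u. f (d + (1 - d) * u))"
proof -
  have "integrable lborel (\<lambda>u. indicator {0<..<1} (d + (1 - d) * u) * f (d + (1 - d) * u))"
    using assms unfolding unif01_integrable by (intro lborel_integrable_real_affine) auto
  then have "integrable lborel (\<lambda>u. indicator {0<..<1} u *\<^sub>R (indicator {0<..<1} (d + (1 - d) * u) * f (d + (1 - d) * u)))"
    by (intro integrable_mult_indicator) auto
  also have "(\<lambda>u. indicator {0<..<1} u *\<^sub>R (indicator {0<..<1} (d + (1 - d) * u) * f (d + (1 - d) * u)))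
      = (\<lambda>u. indicator {0<..<1} u * f (d + (1 - d) * u))"
  proof
    fix u :: real
    show "indicator {0<..<1} u *\<^sub>R (indicator {0<..<1} (d + (1 - d) * u) * f (d + (1 - d) * u))
      = indicator {0<..<1} u * f (d + (1 - d) * u)"
      using squeeze_in_unit_interval[OF assms(2,3), of u] by (simp add: indicator_def)
  qed
  finally show ?thesis by (simp add: unif01_integrable)
qed

lemma integrable_mult_of_squares:
  fixes f g :: "'a \<Rightarrow> real"
  assumes [measurable]: "f \<in> borel_measurable M" "g \<in> borel_measurable M"
    and "integrable M (\<lambda>x. (f x)\<^sup>2)" "integrable M (\<lambda>x. (g x)\<^sup>2)"
  shows "integrable M (\<lambda>x. f x * g x)"
proof (rule Bochner_Integration.integrable_bound)
  show "integrable M (\<lambda>x. (f x)\<^sup>2 + (g x)\<^sup>2)" using assms by auto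
  have "\<bar>a * b\<bar> \<le> a\<^sup>2 + b\<^sup>2" for a b :: real
  proof -
    have "2 * \<bar>a * b\<bar> \<le> a\<^sup>2 + b\<^sup>2"
      using sum_squares_bound[of "\<bar>a\<bar>" "\<bar>b\<bar>"] by (simp add: abs_mult)
    then show ?thesis by linarith
  qed
  then show "AE x in M. norm (f x * g x) \<le> norm ((f x)\<^sup>2 + (g x)\<^sup>2)"
    by (intro AE_I2) auto
qed measurable

lemma integrable_diff_square:
  fixes f g :: "'a \<Rightarrow> real"
  assumes [measurable]: "f \<in> borel_measurable M" "g \<in> borel_measurable M"
    and "integrable M (\<lambda>x. (f x)\<^sup>2)" "integrable M (\<lambda>x. (g x)\<^sup>2)"
  shows "integrable M (\<lambda>x. (f x - g x)\<^sup>2)"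
proof -
  have "integrable M (\<lambda>x. (f x)\<^sup>2 + (g x)\<^sup>2 - 2 * (f x * g x))"
    using integrable_mult_of_squares[OF assms] assms by auto
  then show ?thesis by (simp add: power2_diff mult.assoc)
qed

lemma square_integral_first_order:
  fixes g D :: "'a \<Rightarrow> real"
  assumes [measurable]: "g \<in> borel_measurable M" "D \<in> borel_measurable M"
    and g2: "integrable M (\<lambda>x. (g x)\<^sup>2)" and D2: "integrable M (\<lambda>x. (D x)\<^sup>2)"
    and min: "\<And>t. 0 < t \<Longrightarrow> t < 1 \<Longrightarrow> (\<integral>x. (g x)\<^sup>2 \<partial>M) \<le> (\<integral>x. (g x + t * D x)\<^sup>2 \<partial>M)"
  shows "0 \<le> (\<integral>x. g x * D x \<partial>M)"
proof (rule ccontr)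
  define p where "p = (\<integral>x. g x * D x \<partial>M)"
  define r where "r = (\<integral>x. (D x)\<^sup>2 \<partial>M)"
  assume "\<not> 0 \<le> (\<integral>x. g x * D x \<partial>M)"
  then have p: "p < 0" by (simp add: p_def)
  have r: "0 \<le> r" by (simp add: r_def)
  have gD: "integrable M (\<lambda>x. g x * D x)"
    by (rule integrable_mult_of_squares) (use g2 D2 in auto)
  \<comment> \<open>With this size \<open>t * r <= - p\<close>, so the quadratic term cannot
    compensate \<open>2 * t * p\<close>; the summand 1 avoids a division by 0, and 1/2 keeps
    \<open>t < 1\<close>.\<close>
  define t where "t = min (1/2) (- p / (r + 1))"
  have t: "0 < t" "t < 1" using p r by (auto simp: t_def divide_neg_pos)
  have "(\<integral>x. (g x + t * D x)\<^sup>2 \<partial>M) = (\<integral>x. (g x)\<^sup>2 + 2 * t * (g x * D x) + t\<^sup>2 * (D x)\<^sup>2 \<partial>M)"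
    by (intro Bochner_Integration.integral_cong) (auto simp: power2_eq_square algebra_simps)
  also have "\<dots> = (\<integral>x. (g x)\<^sup>2 \<partial>M) + 2 * t * p + t\<^sup>2 * r"
    using g2 D2 gD by (simp add: p_def r_def)
  finally have "0 \<le> 2 * t * p + t\<^sup>2 * r" using min[OF t] by simp
  then have "0 \<le> t * (2 * p + t * r)" by (simp add: power2_eq_square algebra_simps)
  then have "0 \<le> 2 * p + t * r" using t by (simp add: zero_le_mult_iff)
  moreover have "t * r \<le> - p"
  proof -
    have "t * (r + 1) \<le> - p / (r + 1) * (r + 1)" using r by (intro mult_right_mono) (auto simp: t_def)
    then have "t * (r + 1) \<le> - p" using r by simp
    then show ?thesis using t by (simp add: algebra_simps)
  qed
  ultimately show False using p by linarith
qed

text \<open>The first-order optimality condition for the projection of \<open>q\<close> onto the convex cone of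
  quantile functions of log-concave densities.\<close>

definition stationary :: "(real \<Rightarrow> real) \<Rightarrow> (real \<Rightarrow> real) \<Rightarrow> bool" where
  "stationary Q q \<longleftrightarrow> (\<forall>J R. density_quantile J R \<longrightarrow> integrable unif01 (\<lambda>u. (R u)\<^sup>2) \<longrightarrow>
     0 \<le> (\<integral>u. (Q u - q u) * (R u - Q u) \<partial>unif01))"

lemma stationaryD:
  "stationary Q q \<Longrightarrow> density_quantile J R \<Longrightarrow> integrable unif01 (\<lambda>u. (R u)\<^sup>2) \<Longrightarrow>
     0 \<le> (\<integral>u. (Q u - q u) * (R u - Q u) \<partial>unif01)"
  unfolding stationary_def by blast

lemma stationary_reflect:
  assumes "stationary Q q"
  shows "stationary (\<lambda>u. - Q (1 - u)) (\<lambda>u. - q (1 - u))"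
  unfolding stationary_def
proof (intro allI impI)
  fix J R assume dq: "density_quantile J R" and R2: "integrable unif01 (\<lambda>u. (R u)\<^sup>2)"
  have "integrable unif01 (\<lambda>u. (- R (1 - u))\<^sup>2)"
    using unif01_integrable_reflect[OF R2] by simp
  then have "0 \<le> (\<integral>u. (Q u - q u) * (- R (1 - u) - Q u) \<partial>unif01)"
    by (rule stationaryD[OF assms density_quantile_reflect[OF dq]])
  also have "\<dots> = (\<integral>u. (Q (1 - u) - q (1 - u)) * (- R (1 - (1 - u)) - Q (1 - u)) \<partial>unif01)"
    by (rule unif01_integral_reflect[symmetric])
  also have "\<dots> = (\<integral>u. (- Q (1 - u) - - q (1 - u)) * (R u - - Q (1 - u)) \<partial>unif01)"
    by (intro Bochner_Integration.integral_cong) (auto simp: algebra_simps)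
  finally show "0 \<le> (\<integral>u. (- Q (1 - u) - - q (1 - u)) * (R u - - Q (1 - u)) \<partial>unif01)" .
qed

text \<open>Supporting lines of \<open>I\<close> are nonnegative at 1 by a limit, so
  \<open>I\<close> lies above the segment from \<open>(c, I c)\<close> to
  \<open>(1, 0)\<close>.\<close>

lemma density_quantile_lower_bound:
  assumes dq: "density_quantile I Q" and "0 < c" "c \<le> x" "x < 1"
  shows "I c * (1 - x) \<le> I x * (1 - c)"
proof -
  obtain s where s: "\<And>v. v \<in> {0<..<1} \<Longrightarrow> I v \<le> I x + s * (v - x)"
    using density_quantileD(1)[OF dq] assms unfolding has_supporting_lines_def by force
  have "0 \<le> I x + s * (1 - x)"
  proof (rule tendsto_lowerbound)
    show "((\<lambda>v. I x + s * (v - x)) \<longlongrightarrow> I x + s * (1 - x)) (at_left 1)"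
      by (intro tendsto_intros)
    have "\<forall>\<^sub>F v in at_left 1. v \<in> {x<..<1}"
      using assms by (intro eventually_at_leftI[of x]) auto
    then show "\<forall>\<^sub>F v in at_left 1. 0 \<le> I x + s * (v - x)"
    proof eventually_elim
      case (elim v)
      then show ?case using s[of v] density_quantileD(2)[OF dq, of v] assms by auto
    qed
  qed simp
  then have "0 \<le> (I x + s * (1 - x)) * (x - c)" using assms by simp
  moreover have "I c * (1 - x) \<le> (I x + s * (c - x)) * (1 - x)"
    using s[of c] assms by (intro mult_right_mono) auto
  ultimately show ?thesis by (simp add: algebra_simps)
qed

text \<open>Mean value theorem. Although \<open>Q'\<close> may blow up at 1, it does so at most like
  \<open>1 / (1 - z)\<close>, while the displacement is \<open>d * (1 - u)\<close>, and
  \<open>d <= 1 / 2\<close> keeps \<open>1 - z\<close> above \<open>(1 - u) / 2\<close>. The factors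
  cancel, which leaves a bound uniform in \<open>u >= c\<close>.\<close>

lemma density_quantile_squeeze_diff:
  assumes dq: "density_quantile I Q" and d: "0 < d" "d \<le> 1 / 2"
  shows "0 < u \<Longrightarrow> u < 1 \<Longrightarrow> Q u \<le> Q (d + (1 - d) * u)"
    and "0 < c \<Longrightarrow> c \<le> u \<Longrightarrow> u < 1 \<Longrightarrow> Q (d + (1 - d) * u) - Q u \<le> d * (2 / I c)"
proof -
  have 1: "u < d + (1 - d) * u" "d + (1 - d) * u < 1" "(1 - u) / 2 \<le> 1 - (d + (1 - d) * u)"
    if "0 < u" "u < 1" for u
  proof -
    have "0 < d * (1 - u)" "(2 * d) * (1 - u) \<le> 1 * (1 - u)"
      using that d by (intro mult_pos_pos mult_right_mono; simp)+
    then have *: "0 < d * (1 - u)" "2 * (d * (1 - u)) \<le> 1 - u"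
      by (simp_all only: mult.assoc mult_1)
    define p where "p = d * (1 - u)"
    have eq: "d + (1 - d) * u = u + p" by (simp add: p_def algebra_simps)
    show "u < d + (1 - d) * u" "d + (1 - d) * u < 1" "(1 - u) / 2 \<le> 1 - (d + (1 - d) * u)"
      unfolding eq using *[folded p_def] that by (simp_all add: field_simps)
  qed
  show "Q u \<le> Q (d + (1 - d) * u)" if "0 < u" "u < 1"
    using 1[OF that] that by (intro density_quantile_mono[OF dq]) auto
  show "Q (d + (1 - d) * u) - Q u \<le> d * (2 / I c)" if c: "0 < c" "c \<le> u" "u < 1"
  proof -
    have u: "0 < u" "u < 1" using c by auto
    note 1 = 1[OF u]
    obtain z where z: "u < z" "z < d + (1 - d) * u"
      "Q (d + (1 - d) * u) - Q u = (d + (1 - d) * u - u) * (1 / I z)"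
      using MVT2[OF 1(1), of Q "\<lambda>z. 1 / I z"] density_quantileD(3)[OF dq] u 1 by auto
    have Iz: "0 < I z" "0 < I c" using z 1 u c density_quantileD(2)[OF dq] by auto
    have "I c * ((1 - u) / 2) \<le> I c * (1 - z)"
      using z 1 Iz by (intro mult_left_mono) auto
    also have "\<dots> \<le> I z * (1 - c)"
      using z 1 c by (intro density_quantile_lower_bound[OF dq]) auto
    also have "\<dots> \<le> I z * 1" using Iz c by (intro mult_left_mono) auto
    finally have "(1 - u) * (1 / I z) \<le> 2 / I c"
      using Iz by (simp add: field_simps)
    then have "d * ((1 - u) * (1 / I z)) \<le> d * (2 / I c)"
      using d by (intro mult_left_mono) auto
    moreover have "d + (1 - d) * u - u = d * (1 - u)" by (simp add: algebra_simps)
    ultimately show ?thesis unfolding z(3) by (simp only: mult.assoc)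
  qed
qed

lemma density_quantile_squeeze_limit:
  assumes dq: "density_quantile I Q" and u: "0 < u" "u < 1"
    and d: "d \<longlonglongrightarrow> 0" "\<And>k. d k \<noteq> 0"
  shows "(\<lambda>k. (Q (d k + (1 - d k) * u) - Q u) / d k) \<longlonglongrightarrow> (1 - u) / I u"
proof -
  have "((\<lambda>s. Q (u + s * (1 - u))) has_real_derivative 1 / I u * (1 - u)) (at 0)"
    using density_quantileD(3)[OF dq u]
    by (intro DERIV_chain'[where g = Q]) (auto intro!: derivative_eq_intros)
  then have "((\<lambda>s. (Q (u + s * (1 - u)) - Q u) / s) \<longlongrightarrow> (1 - u) / I u) (at 0)"
    unfolding has_field_derivative_iff by simp
  moreover have "filterlim d (at 0) sequentially"
    using d by (auto simp: filterlim_at)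
  ultimately have "(\<lambda>k. (Q (u + d k * (1 - u)) - Q u) / d k) \<longlonglongrightarrow> (1 - u) / I u"
    by (rule filterlim_compose)
  then show ?thesis by (simp add: algebra_simps)
qed

text \<open>If \<open>Q\<close> were unbounded below, the squeezed quantile functions \<open>Q (d + (1 - d) u)\<close> would
  violate the first-order condition: near \<open>0\<close>, where \<open>Q - q\<close> is negative, their gain is of order
  \<open>d \<integral> \<bar>Q - q\<bar> Q'\<close> with a divergent integral, while elsewhere the loss is of order \<open>d\<close>.\<close>

lemma stationary_bounded_below:
  assumes dq: "density_quantile I Q" and Q2: "integrable unif01 (\<lambda>u. (Q u)\<^sup>2)"
    and [measurable]: "q \<in> borel_measurable unif01"
    and qM: "\<And>u. 0 < u \<Longrightarrow> u < 1 \<Longrightarrow> \<bar>q u\<bar> \<le> M"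
    and st: "stationary Q q"
  shows "\<exists>B. \<forall>u. 0 < u \<longrightarrow> u < 1 \<longrightarrow> B \<le> Q u"
proof (cases "\<exists>c. 0 < c \<and> c < 1 \<and> Q c \<le> - M - 1")
  case False
  then show ?thesis by (intro exI[of _ "- M - 1"]) (auto simp: not_le less_imp_le)
next
  case True
  then obtain c where c: "0 < c" "c < 1" "Q c \<le> - M - 1" by blast
  note [measurable] = density_quantile_measurable[OF dq]
  define K where "K = 2 / I c"
  have K: "0 < K" using density_quantileD(2)[OF dq] c by (simp add: K_def)
  define d where "d k = 1 / (real k + 2)" for k
  have d: "0 < d k" "d k \<le> 1 / 2" "d k < 1" for k
    by (auto simp: d_def field_simps)
  have dlim: "d \<longlonglongrightarrow> 0" unfolding d_def by real_asymp
  define R where "R k u = Q (d k + (1 - d k) * u)" for k u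
  have dqR: "density_quantile (\<lambda>u. I (d k + (1 - d k) * u) / (1 - d k)) (R k)" for k
    unfolding R_def by (intro density_quantile_squeeze dq d)
  have [measurable]: "R k \<in> borel_measurable unif01" for k
    by (rule density_quantile_measurable[OF dqR])
  have R2: "integrable unif01 (\<lambda>u. (R k u)\<^sup>2)" for k
    unfolding R_def by (intro unif01_integrable_squeeze[of "\<lambda>u. (Q u)\<^sup>2"] Q2 d)
  have q2: "integrable unif01 (\<lambda>u. (q u)\<^sup>2)"
  proof (rule unif01.integrable_const_bound)
    have "(q u)\<^sup>2 \<le> M\<^sup>2" if "0 < u" "u < 1" for u
      using qM[OF that] by (metis abs_ge_zero power2_abs power_mono)
    then show "AE u in unif01. norm ((q u)\<^sup>2) \<le> M\<^sup>2"
      by (intro AE_I2) auto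
  qed measurable
  have g2: "integrable unif01 (\<lambda>u. (Q u - q u)\<^sup>2)"
    by (rule integrable_diff_square) (use Q2 q2 in auto)
  have intg: "integrable unif01 (\<lambda>u. \<bar>Q u - q u\<bar>)"
    using integrable_of_square[OF unif01.finite_measure_axioms _ g2] by auto
  have gD: "integrable unif01 (\<lambda>u. (Q u - q u) * (R k u - Q u))" for k
    by (rule integrable_mult_of_squares[OF _ _ g2 integrable_diff_square[OF _ _ R2 Q2]]) measurable
  \<comment> \<open>On (0, c] the difference \<open>q - Q\<close> is at least
    \<open>- M - Q u\<close>, which is at least 1 by the choice of \<open>c\<close>.\<close>
  define w where "w u = indicator {..c} u * (- M - Q u)" for u
  have [measurable]: "w \<in> borel_measurable unif01"
  proof -
    have [measurable]: "indicat_real {..c} \<in> borel_measurable unif01"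
      by (intro borel_measurable_unif01) simp
    show ?thesis unfolding w_def[abs_def] by measurable
  qed
  have w0: "0 \<le> w u" if "0 < u" "u < 1" for u
    using density_quantile_mono[OF dq, of u c] c that by (auto simp: w_def indicator_def)
  have D0: "0 \<le> R k u - Q u" if "0 < u" "u < 1" for k u
    using density_quantile_squeeze_diff(1)[OF dq d(1,2) that] by (simp add: R_def)
  \<comment> \<open>Left of \<open>c\<close> the gain is bounded below with \<open>w\<close>; right
    of \<open>c\<close> the quotient is at most \<open>K\<close>, so the loss is at most
    \<open>K\<close> times the absolute value of \<open>Q - q\<close>. After integration,
    stationarity makes the first term on the right nonpositive, and the constant \<open>C\<close>
    remains.\<close>
  have pt: "w u * ((R k u - Q u) / d k) \<le> (- (Q u - q u) * (R k u - Q u)) / d k + K * \<bar>Q u - q u\<bar>"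
    if u: "0 < u" "u < 1" for u k
  proof (cases "u \<le> c")
    case True
    have "w u \<le> - (Q u - q u)" using True qM[OF u] by (auto simp: w_def)
    then have "w u * ((R k u - Q u) / d k) \<le> - (Q u - q u) * ((R k u - Q u) / d k)"
      using D0[OF u] d(1)[of k] by (intro mult_right_mono) auto
    then show ?thesis using K by (simp add: add_increasing2)
  next
    case False
    have "R k u - Q u \<le> d k * K"
      using False c u density_quantile_squeeze_diff(2)[OF dq d(1,2), of c u k] by (simp add: R_def K_def)
    then have "(R k u - Q u) / d k \<le> K" using d(1)[of k] by (simp add: pos_divide_le_eq mult.commute)
    then have "\<bar>Q u - q u\<bar> * ((R k u - Q u) / d k) \<le> \<bar>Q u - q u\<bar> * K" by (intro mult_left_mono) auto
    moreover have "(Q u - q u) * ((R k u - Q u) / d k) \<le> \<bar>Q u - q u\<bar> * ((R k u - Q u) / d k)"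
      using D0[OF u] d(1)[of k] by (intro mult_right_mono) auto
    ultimately have "(Q u - q u) * ((R k u - Q u) / d k) \<le> \<bar>Q u - q u\<bar> * K" by (rule order_trans[rotated])
    then have "0 \<le> - ((Q u - q u) * ((R k u - Q u) / d k)) + K * \<bar>Q u - q u\<bar>"
      by (simp only: mult.commute[of K])
    then have "0 \<le> - (Q u - q u) * ((R k u - Q u) / d k) + K * \<bar>Q u - q u\<bar>"
      by (simp only: mult_minus_left)
    then show ?thesis using False by (simp add: w_def)
  qed
  define C where "C = K * (\<integral>u. \<bar>Q u - q u\<bar> \<partial>unif01)"
  have bound: "(\<integral>\<^sup>+u. ennreal (w u * ((R k u - Q u) / d k)) \<partial>unif01) \<le> ennreal C" for k
  proof -
    let ?h = "\<lambda>u. (- (Q u - q u) * (R k u - Q u)) / d k + K * \<bar>Q u - q u\<bar>"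
    have neg: "integrable unif01 (\<lambda>u. - (Q u - q u) * (R k u - Q u))"
      using Bochner_Integration.integrable_minus[OF gD[of k]] by (simp only: mult_minus_left)
    have int: "integrable unif01 ?h"
      using neg intg by auto
    have "(\<integral>\<^sup>+u. ennreal (w u * ((R k u - Q u) / d k)) \<partial>unif01) \<le> (\<integral>\<^sup>+u. ennreal (?h u) \<partial>unif01)"
      by (intro nn_integral_mono ennreal_leI pt) auto
    also have "\<dots> = ennreal (\<integral>u. ?h u \<partial>unif01)"
    proof (intro nn_integral_eq_integral int AE_I2)
      fix u assume "u \<in> space unif01"
      then have u: "0 < u" "u < 1" by auto
      have "0 \<le> w u * ((R k u - Q u) / d k)" using w0[OF u] D0[OF u] d(1)[of k] by auto
      then show "0 \<le> ?h u" using pt[OF u, of k] by linarith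
    qed
    also have "(\<integral>u. ?h u \<partial>unif01) = (\<integral>u. - (Q u - q u) * (R k u - Q u) \<partial>unif01) / d k + C"
      using neg intg by (simp add: C_def)
    also have "\<dots> \<le> 0 + C"
    proof (intro add_right_mono divide_nonpos_pos d)
      have "(\<integral>u. - (Q u - q u) * (R k u - Q u) \<partial>unif01) = - (\<integral>u. (Q u - q u) * (R k u - Q u) \<partial>unif01)"
        by (simp only: mult_minus_left Bochner_Integration.integral_minus)
      then show "(\<integral>u. - (Q u - q u) * (R k u - Q u) \<partial>unif01) \<le> 0"
        using stationaryD[OF st dqR R2, of k] by simp
    qed
    finally show ?thesis by (simp add: ennreal_leI)
  qed
  \<comment> \<open>Preparation for Fatou's lemma: the quotients converge pointwise, and no
    dominating function is at hand near 0.\<close>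
  have lim: "liminf (\<lambda>k. ennreal (w u * ((R k u - Q u) / d k))) = ennreal (w u * ((1 - u) / I u))"
    if "0 < u" "u < 1" for u
  proof (rule lim_imp_Liminf)
    have "(\<lambda>k. (R k u - Q u) / d k) \<longlonglongrightarrow> (1 - u) / I u"
      unfolding R_def using d(1) by (intro density_quantile_squeeze_limit dq that dlim) (metis less_irrefl)
    then show "(\<lambda>k. ennreal (w u * ((R k u - Q u) / d k))) \<longlonglongrightarrow> ennreal (w u * ((1 - u) / I u))"
      by (intro tendsto_ennrealI tendsto_mult tendsto_const)
  qed simp
  have "(\<integral>\<^sup>+u. ennreal (w u * ((1 - u) / I u)) \<partial>unif01)
      = (\<integral>\<^sup>+u. liminf (\<lambda>k. ennreal (w u * ((R k u - Q u) / d k))) \<partial>unif01)"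
    using lim by (intro nn_integral_cong) auto
  also have "\<dots> \<le> liminf (\<lambda>k. \<integral>\<^sup>+u. ennreal (w u * ((R k u - Q u) / d k)) \<partial>unif01)"
    by (intro nn_integral_liminf) measurable
  also have "\<dots> \<le> ennreal C"
    using bound by (intro Liminf_le) (auto intro: always_eventually)
  finally have main: "(\<integral>\<^sup>+u. ennreal (w u * ((1 - u) / I u)) \<partial>unif01) \<le> ennreal C" .
  have C0: "0 \<le> C" unfolding C_def using K by (intro mult_nonneg_nonneg Bochner_Integration.integral_nonneg) auto
  \<comment> \<open>Since \<open>Q' = 1 / I\<close>, the integrand
    \<open>(1 - c) * (- M - Q) / I\<close> has the antiderivative
    \<open>- (1 - c) * (M + Q)^2 / 2\<close>. Its integral over \<open>{e..c}\<close> is at most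
    \<open>C\<close>, which says \<open>(M + Q e)^2 <= Z\<close> for every \<open>e\<close>; an
    unbounded \<open>Q\<close> would make it diverge.\<close>
  define Z where "Z = (M + Q c)\<^sup>2 + 2 * C / (1 - c)"
  have low: "- M - sqrt Z \<le> Q e" if e: "0 < e" "e < c" for e
  proof -
    let ?f = "\<lambda>x. indicator {e..c} x * (- (1 - c) * (M + Q x) / I x)"
    have f0: "0 \<le> - (1 - c) * (M + Q x) / I x" if "e \<le> x" "x \<le> c" for x
    proof -
      have "M + Q x \<le> 0" using density_quantile_mono[OF dq, of x c] c e that by auto
      moreover have "0 < I x" using density_quantileD(2)[OF dq, of x] c e that by auto
      ultimately show ?thesis using c by (auto intro!: divide_nonneg_pos mult_nonpos_nonpos)
    qed
    have f_borel: "?f \<in> borel_measurable borel"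
    proof -
      have "continuous_on {e..c} (\<lambda>x. - (1 - c) * (M + Q x) / I x)"
      proof (intro continuous_intros continuous_on_subset[OF density_quantileD(6)[OF dq]]
          continuous_on_subset[OF density_quantileD(5)[OF dq]] ballI)
        fix x assume "x \<in> {e..c}"
        then show "I x \<noteq> 0" using density_quantileD(2)[OF dq, of x] c e by auto
      qed (use c e in auto)
      then have "(\<lambda>x. indicator {e..c} x *\<^sub>R (- (1 - c) * (M + Q x) / I x)) \<in> borel_measurable borel"
        by (intro borel_measurable_continuous_on_indicator) auto
      then show ?thesis by simp
    qed
    define F where "F x = - ((1 - c) * (M + Q x)\<^sup>2) / 2" for x
    have "ennreal (F c - F e) = (\<integral>\<^sup>+x. ennreal (?f x) * indicator {e..c} x \<partial>lborel)"
    proof (rule nn_integral_FTC_Icc[where f = ?f and F = F and a = e and b = c, symmetric])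
      fix x assume "x \<in> {e..c}"
      then have x: "e \<le> x" "x \<le> c" by auto
      show "0 \<le> ?f x" using f0[OF x] x by simp
      have "(Q has_real_derivative 1 / I x) (at x)"
        using x c e by (intro density_quantileD(3)[OF dq]) auto
      then have "(F has_real_derivative - (1 - c) * (M + Q x) / I x) (at x)"
        unfolding F_def by (auto intro!: derivative_eq_intros simp: divide_simps algebra_simps)
      then show "(F has_real_derivative ?f x) (at x)" using x by simp
    qed (rule f_borel, use e in simp)
    also have "\<dots> \<le> (\<integral>\<^sup>+x. ennreal (w x * ((1 - x) / I x)) * indicator {0<..<1} x \<partial>lborel)"
    proof (intro nn_integral_mono)
      fix x
      show "ennreal (?f x) * indicator {e..c} x \<le> ennreal (w x * ((1 - x) / I x)) * indicator {0<..<1} x"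
      proof (cases "x \<in> {e..c}")
        case True
        then have x: "0 < x" "x < 1" "x \<le> c" "e \<le> x" using c e by auto
        have "(1 - c) / I x \<le> (1 - x) / I x"
          using x density_quantileD(2)[OF dq, of x] by (intro divide_right_mono) auto
        then have "w x * ((1 - c) / I x) \<le> w x * ((1 - x) / I x)"
          using w0[OF x(1,2)] by (rule mult_left_mono)
        moreover have "?f x = w x * ((1 - c) / I x)" using x by (simp add: w_def field_simps)
        ultimately have "ennreal (?f x) \<le> ennreal (w x * ((1 - x) / I x))" by (simp only: ennreal_leI)
        then show ?thesis using x True by (simp add: indicator_def)
      qed simp
    qed
    also have "\<dots> = (\<integral>\<^sup>+u. ennreal (w u * ((1 - u) / I u)) \<partial>unif01)"
      unfolding unif01_def by (subst nn_integral_restrict_space) auto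
    also have "\<dots> \<le> ennreal C" by (rule main)
    finally have "F c - F e \<le> C" using C0 by simp
    then have "(1 - c) * (M + Q e)\<^sup>2 \<le> (1 - c) * (M + Q c)\<^sup>2 + 2 * C"
      unfolding F_def by linarith
    also have "\<dots> = (1 - c) * Z"
      using c by (simp add: Z_def distrib_left)
    finally have "(M + Q e)\<^sup>2 \<le> Z" using c by simp
    then have "\<bar>M + Q e\<bar> \<le> sqrt Z" using real_sqrt_le_mono by fastforce
    then show ?thesis by linarith
  qed
  show ?thesis
  proof (intro exI[of _ "min (- M - sqrt Z) (Q c)"] allI impI)
    fix u :: real assume "0 < u" "u < 1"
    then show "min (- M - sqrt Z) (Q c) \<le> Q u"
      using low[of u] density_quantile_mono[OF dq, of c u] c by (cases "u < c") auto
  qed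
qed

text \<open>Reflection exchanges the tails and preserves stationarity, so the upper bound is the
  lower bound for \<open>- Q (1 - u)\<close>.\<close>

lemma stationary_bounded:
  assumes dq: "density_quantile I Q" and Q2: "integrable unif01 (\<lambda>u. (Q u)\<^sup>2)"
    and q: "q \<in> borel_measurable borel"
    and qM: "\<And>u. 0 < u \<Longrightarrow> u < 1 \<Longrightarrow> \<bar>q u\<bar> \<le> M"
    and st: "stationary Q q"
  obtains B where "\<And>u. 0 < u \<Longrightarrow> u < 1 \<Longrightarrow> \<bar>Q u\<bar> \<le> B"
proof -
  obtain B where B: "\<And>u. 0 < u \<Longrightarrow> u < 1 \<Longrightarrow> B \<le> Q u"
    using stationary_bounded_below[OF dq Q2 borel_measurable_unif01[OF q] qM st] by auto
  have "\<exists>B. \<forall>u. 0 < u \<longrightarrow> u < 1 \<longrightarrow> B \<le> - Q (1 - u)"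
  proof (rule stationary_bounded_below[OF density_quantile_reflect[OF dq] _ _ _ stationary_reflect[OF st]])
    show "integrable unif01 (\<lambda>u. (- Q (1 - u))\<^sup>2)"
      using unif01_integrable_reflect[OF Q2] by simp
    show "(\<lambda>u. - q (1 - u)) \<in> borel_measurable unif01"
      by (intro borel_measurable_unif01 borel_measurable_uminus measurable_compose[OF _ q]) simp
    show "\<bar>- q (1 - u)\<bar> \<le> M" if "0 < u" "u < 1" for u
      using qM[of "1 - u"] that by simp
  qed
  then obtain B' where B': "\<And>u. 0 < u \<Longrightarrow> u < 1 \<Longrightarrow> B' \<le> - Q (1 - u)" by blast
  have "\<bar>Q u\<bar> \<le> max \<bar>B\<bar> \<bar>B'\<bar>" if "0 < u" "u < 1" for u
    using B[OF that] B'[of "1 - u"] that by auto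
  then show ?thesis using that by blast
qed

section \<open>Variations of the density quantile function\<close>


lemma has_supporting_lines_min:
  assumes "has_supporting_lines S f" "has_supporting_lines S g"
  shows "has_supporting_lines S (\<lambda>u. min (f u) (g u))"
  unfolding has_supporting_lines_def
proof
  fix u assume u: "u \<in> S"
  obtain s where s: "\<And>v. v \<in> S \<Longrightarrow> f v \<le> f u + s * (v - u)"
    using assms(1) u unfolding has_supporting_lines_def by blast
  obtain t where t: "\<And>v. v \<in> S \<Longrightarrow> g v \<le> g u + t * (v - u)"
    using assms(2) u unfolding has_supporting_lines_def by blast
  have "min (f v) (g v) \<le> min (f u) (g u) + (if f u \<le> g u then s else t) * (v - u)" if "v \<in> S" for v
    using s[OF that] t[OF that] by (auto simp: min_def)
  then show "\<exists>s. \<forall>v\<in>S. min (f v) (g v) \<le> min (f u) (g u) + s * (v - u)" by blast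
qed

lemma has_supporting_lines_affine: "has_supporting_lines S (\<lambda>u. p + s * u)"
  unfolding has_supporting_lines_def by (auto intro!: exI[of _ s] simp: algebra_simps)

definition affine_between :: "real \<Rightarrow> real \<Rightarrow> (real \<Rightarrow> real) \<Rightarrow> bool" where
  "affine_between a b f \<longleftrightarrow> (\<exists>p s. \<forall>u\<in>{a<..<b}. f u = p + s * u)"

lemma affine_between_mono:
  "affine_between a b f \<Longrightarrow> a \<le> a' \<Longrightarrow> b' \<le> b \<Longrightarrow> affine_between a' b' f"
  unfolding affine_between_def by fastforce

text \<open>Two fixed points at the thirds of the interval determine the line; a point outside them
  is handled by the triple in which \<open>p\<close> or \<open>r\<close> is the middle one.\<close>

lemma affine_between_of_chords:
  fixes f :: "real \<Rightarrow> real"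
  assumes "a < b"
    and chord: "\<And>p u r. a < p \<Longrightarrow> p < u \<Longrightarrow> u < r \<Longrightarrow> r < b \<Longrightarrow>
      f u = f p + (f r - f p) / (r - p) * (u - p)"
  shows "affine_between a b f"
proof -
  have cross: "(r - p) * f u = (r - u) * f p + (u - p) * f r"
    if "a < p" "p < u" "u < r" "r < b" for p u r
  proof -
    have "(r - p) * f u = (r - p) * (f p + (f r - f p) / (r - p) * (u - p))"
      using chord[OF that] by simp
    also have "\<dots> = (r - p) * f p + (f r - f p) * (u - p)"
      using that by (simp add: distrib_left)
    finally show ?thesis by (simp add: algebra_simps)
  qed
  define p where "p = a + (b - a) / 3"
  define r where "r = a + 2 * (b - a) / 3"
  have pr: "a < p" "p < r" "r < b" using assms(1) by (auto simp: p_def r_def field_simps)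
  have "(r - p) * f u = (r - u) * f p + (u - p) * f r" if "u \<in> {a<..<b}" for u
  proof -
    consider "u < p" | "u = p" | "p < u" "u < r" | "u = r" | "r < u" by linarith
    then show ?thesis
    proof cases
      case 1
      then show ?thesis using cross[of u p r] that pr by (simp add: algebra_simps)
    next
      case 3
      then show ?thesis using cross[of p u r] that pr by simp
    next
      case 5
      then show ?thesis using cross[of p r u] that pr by (simp add: algebra_simps)
    qed auto
  qed
  then have "f u = ((r - u) * f p + (u - p) * f r) / (r - p)" if "u \<in> {a<..<b}" for u
    using that pr by (simp add: eq_divide_eq mult.commute)
  then have "f u = (r * f p - p * f r) / (r - p) + (f r - f p) / (r - p) * u" if "u \<in> {a<..<b}" for u
    using that by (simp add: add_divide_distrib[symmetric] algebra_simps)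
  then show ?thesis unfolding affine_between_def by blast
qed

lemma affine_between_cong:
  "(\<And>u. a < u \<Longrightarrow> u < b \<Longrightarrow> f u = g u) \<Longrightarrow> affine_between a b f \<Longrightarrow> affine_between a b g"
  unfolding affine_between_def by (metis greaterThanLessThan_iff)

lemma min_affine_split:
  fixes p s q t :: real
  assumes "a < b"
  obtains c where "a \<le> c" "c \<le> b"
    "affine_between a c (\<lambda>u. min (p + s * u) (q + t * u))"
    "affine_between c b (\<lambda>u. min (p + s * u) (q + t * u))"
proof -
  \<comment> \<open>The crossing point of the two lines, clamped to \<open>[a, b]\<close>; for
    parallel lines the first piece is empty.\<close>
  define c where "c = (if s = t then a else max a (min b ((q - p) / (s - t))))"
  have sign: "(p + s * u) - (q + t * u) = (s - t) * (u - (q - p) / (s - t))" if "s \<noteq> t" for u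
    using that by (simp add: field_simps)
  have *: "affine_between d e (\<lambda>u. min (p + s * u) (q + t * u))"
    if "(\<forall>u. d < u \<longrightarrow> u < e \<longrightarrow> p + s * u \<le> q + t * u) \<or> (\<forall>u. d < u \<longrightarrow> u < e \<longrightarrow> q + t * u \<le> p + s * u)" for d e
    using that
  proof
    assume "\<forall>u. d < u \<longrightarrow> u < e \<longrightarrow> p + s * u \<le> q + t * u"
    then show ?thesis unfolding affine_between_def by (intro exI[of _ p] exI[of _ s]) auto
  next
    assume "\<forall>u. d < u \<longrightarrow> u < e \<longrightarrow> q + t * u \<le> p + s * u"
    then show ?thesis unfolding affine_between_def by (intro exI[of _ q] exI[of _ t]) auto
  qed
  have cab: "a \<le> c" "c \<le> b" using assms by (auto simp: c_def)
  show ?thesis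
  proof (cases "s = t")
    case True
    then have "c = a" by (simp add: c_def)
    have "affine_between a b (\<lambda>u. min (p + s * u) (q + t * u))"
      using True by (intro *) auto
    then show ?thesis using that[OF cab] \<open>c = a\<close> by (auto simp: affine_between_def)
  next
    case False
    define x where "x = (q - p) / (s - t)"
    have c: "c = max a (min b x)" using False by (simp add: c_def x_def)
    have diff: "(p + s * u) - (q + t * u) = (s - t) * (u - x)" for u
      using sign[OF False] by (simp add: x_def)
    have L: "u < x" if "a < u" "u < c" for u using that c by (auto simp: max_def min_def split: if_splits)
    have R: "x < u" if "c < u" "u < b" for u using that c by (auto simp: max_def min_def split: if_splits)
    show ?thesis
    proof (cases "s < t")
      case True
      have "0 \<le> (s - t) * (u - x)" if "u < x" for u
        using that True by (intro mult_nonpos_nonpos) auto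
      moreover have "(s - t) * (u - x) \<le> 0" if "x < u" for u
        using that True by (intro mult_nonpos_nonneg) auto
      ultimately show ?thesis
        using L R diff by (intro that[OF cab] *) (smt (verit))+
    next
      case False
      with \<open>s \<noteq> t\<close> have "t < s" by simp
      have "(s - t) * (u - x) \<le> 0" if "u < x" for u
        using that \<open>t < s\<close> by (intro mult_nonneg_nonpos) auto
      moreover have "0 \<le> (s - t) * (u - x)" if "x < u" for u
        using that \<open>t < s\<close> by (intro mult_nonneg_nonneg) auto
      ultimately show ?thesis
        using L R diff by (intro that[OF cab] *) (smt (verit))+
    qed
  qed
qed

lemma unif01_has_integral:
  fixes f :: "real \<Rightarrow> real"
  assumes "integrable unif01 f"
  shows "(f has_integral (\<integral>u. f u \<partial>unif01)) {0..1}"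
proof -
  have "set_integrable lborel {0<..<1} f"
    using assms by (simp add: unif01_integrable set_integrable_def)
  note set_borel_integral_eq_integral[OF this]
  moreover have "(LINT u:{0<..<1}|lborel. f u) = (\<integral>u. f u \<partial>unif01)"
    by (simp add: unif01_integral set_lebesgue_integral_def)
  ultimately have "(f has_integral (\<integral>u. f u \<partial>unif01)) {0<..<1}"
    by (metis integrable_integral)
  then show ?thesis by (simp add: has_integral_Icc_iff_Ioo)
qed

lemma finite_of_no_triple:
  fixes Z :: "real set"
  assumes "\<And>x y z. x \<in> Z \<Longrightarrow> y \<in> Z \<Longrightarrow> z \<in> Z \<Longrightarrow> x < y \<Longrightarrow> y < z \<Longrightarrow> False"
  shows "finite Z"
proof (rule ccontr)
  assume "infinite Z"
  then obtain T where T: "finite T" "card T = 3" "T \<subseteq> Z"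
    using infinite_arbitrarily_large by blast
  then have ne: "T \<noteq> {}" by auto
  have "card (T - {Min T, Max T}) \<ge> 1"
    using T card_Diff_subset_Int[of T "{Min T, Max T}"] card_insert_le_m1[of 2 "{Max T}" "Min T"]
      card_Diff_insert diff_card_le_card_Diff[of "{Min T, Max T}" T] by (auto simp: card_insert_if)
  then obtain y where y: "y \<in> T" "y \<noteq> Min T" "y \<noteq> Max T"
    using card_gt_0_iff[of "T - {Min T, Max T}"] by (metis DiffE card.empty ex_in_conv insertCI not_one_le_zero)
  have "Min T < y" "y < Max T"
    using y T Min_le[of T y] Max_ge[of T y] by (auto simp: less_le)
  then show False
    using assms[of "Min T" y "Max T"] T y Min_in[OF T(1) ne] Max_in[OF T(1) ne] by blast
qed

text \<open>What is kept of the minimization problem: the first-order condition for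
  \<open>Q\<close>, together with its boundedness, which makes the boundary terms vanish in
  \<open>perturbation\<close>.\<close>

locale stationary_quantile =
  fixes n :: nat and y :: "nat \<Rightarrow> real" and I Q :: "real \<Rightarrow> real" and B :: real
  assumes n: "0 < n"
    and dq: "density_quantile I Q"
    and bounded: "\<And>u. 0 < u \<Longrightarrow> u < 1 \<Longrightarrow> \<bar>Q u\<bar> \<le> B"
    and stat: "stationary Q (step_fun n y)"
begin

abbreviation q where "q \<equiv> step_fun n y"

definition G :: "real \<Rightarrow> real" where "G u = integral {0..u} (\<lambda>t. q t - Q t)"

definition grid :: "real set" where "grid = (\<lambda>k. real k / real n) ` {..n}"

lemma finite_grid: "finite grid"
  by (simp add: grid_def)

lemma bounded_integrable:
  fixes f :: "real \<Rightarrow> real" and C :: real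
  assumes [measurable]: "f \<in> borel_measurable unif01" and "\<And>u. 0 < u \<Longrightarrow> u < 1 \<Longrightarrow> \<bar>f u\<bar> \<le> C"
  shows "integrable unif01 f"
  using assms by (intro unif01.integrable_const_bound[of _ C] AE_I2) auto

lemma Q_measurable [measurable]: "Q \<in> borel_measurable unif01"
  by (rule density_quantile_measurable[OF dq])

definition M :: real where "M = (\<Sum>k<n. \<bar>y k\<bar>)"

lemma q_bounded: "0 < u \<Longrightarrow> u < 1 \<Longrightarrow> \<bar>q u\<bar> \<le> M"
  unfolding M_def by (rule step_fun_bounded[OF n])

lemma diff_bounded: "0 < u \<Longrightarrow> u < 1 \<Longrightarrow> \<bar>q u - Q u\<bar> \<le> M + B"
  using q_bounded[of u] bounded[of u] by linarith

lemma diff_integrable: "integrable unif01 (\<lambda>u. q u - Q u)"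
  by (rule bounded_integrable[OF _ diff_bounded]) auto

lemma diff_integrable_on: "(\<lambda>u. q u - Q u) integrable_on {0..1}"
  using unif01_has_integral[OF diff_integrable] by blast

lemma G_continuous: "continuous_on {0..1} G"
  unfolding G_def using diff_integrable_on by (rule indefinite_integral_continuous_1)

lemma G_0: "G 0 = 0"
  by (simp add: G_def)

text \<open>Shifts of \<open>Q\<close> by 1 and by -1 are both admissible, so the mean of
  \<open>q - Q\<close> is 0.\<close>

lemma G_1: "G 1 = 0"
proof -
  have "0 \<le> (\<integral>u. (Q u - q u) * ((Q u + c) - Q u) \<partial>unif01)" for c
  proof (rule stationaryD[OF stat density_quantile_shift[OF dq]])
    show "integrable unif01 (\<lambda>u. (Q u + c)\<^sup>2)"
    proof (rule bounded_integrable)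
      fix u :: real assume "0 < u" "u < 1"
      then have "\<bar>Q u + c\<bar> \<le> B + \<bar>c\<bar>" using bounded[of u] by linarith
      then have "\<bar>Q u + c\<bar>\<^sup>2 \<le> (B + \<bar>c\<bar>)\<^sup>2" by (intro power_mono) auto
      then show "\<bar>(Q u + c)\<^sup>2\<bar> \<le> (B + \<bar>c\<bar>)\<^sup>2" by simp
    qed measurable
  qed
  note this[of 1] this[of "-1"]
  moreover have "(\<integral>u. q u - Q u \<partial>unif01) = - (\<integral>u. Q u - q u \<partial>unif01)"
    by (subst Bochner_Integration.integral_minus[symmetric]) simp
  ultimately have "(\<integral>u. q u - Q u \<partial>unif01) = 0" by simp
  then show ?thesis
    using unif01_has_integral[OF diff_integrable] unfolding G_def by (simp add: integral_unique)
qed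

lemma off_grid_cell:
  assumes "0 < u" "u < 1" "u \<notin> grid"
  obtains k where "k < n" "real k / real n < u" "u < (real k + 1) / real n"
    "\<And>v. real k / real n \<le> v \<Longrightarrow> v < (real k + 1) / real n \<Longrightarrow> q v = y k"
proof -
  define k where "k = nat \<lfloor>real n * u\<rfloor>"
  have k: "k < n" "real k / real n \<le> u" "u < (real k + 1) / real n"
    using nat_floor_eq_iff[of n u k] nat_floor_less[of n u] assms n by (auto simp: k_def)
  then have "real k / real n \<in> grid" by (auto simp: grid_def)
  then have "real k / real n < u" using k assms(3) by (metis order_le_less)
  moreover have "q v = y k" if v: "real k / real n \<le> v" "v < (real k + 1) / real n" for v
  proof -
    have "0 \<le> real k / real n" by simp
    then have "0 \<le> v" using v by linarith
    then have "nat \<lfloor>real n * v\<rfloor> = k" using nat_floor_eq_iff[of n v k] n v by simp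
    then show ?thesis by (simp add: step_fun_def)
  qed
  ultimately show ?thesis using that k by blast
qed

lemma G_deriv:
  assumes u: "0 < u" "u < 1" "u \<notin> grid"
  shows "(G has_real_derivative q u - Q u) (at u)"
proof -
  obtain k where k: "real k / real n < u" "u < (real k + 1) / real n"
    and qk: "\<And>v. real k / real n \<le> v \<Longrightarrow> v < (real k + 1) / real n \<Longrightarrow> q v = y k"
    using off_grid_cell[OF u] by metis
  have "\<forall>\<^sub>F v in nhds u. v \<in> {real k / real n<..<(real k + 1) / real n}"
    using k by (intro eventually_nhds_in_open) auto
  then have "\<forall>\<^sub>F v in nhds u. y k = q v"
    by eventually_elim (use qk in auto)
  then have "isCont q u"
    by (subst isCont_cong[of _ "\<lambda>_. y k"]) (auto elim: eventually_mono)
  moreover have "isCont Q u"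
    using density_quantileD(3)[OF dq u(1,2)] by (rule DERIV_isCont)
  ultimately have "isCont (\<lambda>t. q t - Q t) u" by (intro continuous_intros)
  then have cont: "continuous (at u within ({0..1} - {})) (\<lambda>t. q t - Q t)"
    using continuous_at_imp_continuous_at_within by blast
  have "((\<lambda>u. integral {0..u} (\<lambda>t. q t - Q t)) has_vector_derivative q u - Q u) (at u within ({0..1} - {}))"
    using u by (intro integral_has_vector_derivative_continuous_at[OF diff_integrable_on _ _ cont]) auto
  then have "(G has_real_derivative q u - Q u) (at u within {0..1})"
    unfolding G_def[abs_def] has_real_derivative_iff_has_vector_derivative by simp
  then show ?thesis using u by (simp add: at_within_Icc_at)
qed

text \<open>Integration by parts: for the competitor \<open>R\<close> with \<open>R' = 1 / J\<close>, the first variation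
  \<open>\<integral> (Q - q) (R - Q)\<close> equals \<open>\<integral> G (1 / J - 1 / I)\<close>.\<close>

lemma perturbation:
  assumes J: "has_supporting_lines {0<..<1} J" and c: "0 < c"
    and cI: "\<And>u. 0 < u \<Longrightarrow> u < 1 \<Longrightarrow> c * I u \<le> J u"
    and sign: "\<And>u. 0 < u \<Longrightarrow> u < 1 \<Longrightarrow> G u * (1 / J u - 1 / I u) \<le> 0"
    and w: "0 < w" "w < 1" "G w \<noteq> 0"
  shows "J w = I w"
proof -
  have Ipos: "0 < I u" if "0 < u" "u < 1" for u using density_quantileD(2)[OF dq that] .
  have Jpos: "0 < J u" if "0 < u" "u < 1" for u
    using cI[OF that] mult_pos_pos[OF c Ipos[OF that]] by linarith
  have contJ: "continuous_on {0<..<1} J"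
    by (rule has_supporting_lines_imp_continuous_on[OF J]) auto
  have contI: "continuous_on {0<..<1} I" by (rule density_quantileD(5)[OF dq])
  have continv: "isCont (\<lambda>u. 1 / J u) u" if "0 < u" "u < 1" for u
    using contJ that Jpos[OF that] by (auto intro!: continuous_intros simp: continuous_on_eq_continuous_at)
  have "\<exists>R. \<forall>u. ereal 0 < ereal u \<longrightarrow> ereal u < ereal 1 \<longrightarrow> (R has_vector_derivative 1 / J u) (at u)"
    by (rule einterval_antiderivative) (auto intro: continv)
  then obtain R where R: "\<And>u. 0 < u \<Longrightarrow> u < 1 \<Longrightarrow> (R has_real_derivative 1 / J u) (at u)"
    unfolding has_real_derivative_iff_has_vector_derivative by auto
  have dqR: "density_quantile J R"
    using J Jpos R by (auto simp: density_quantile_def)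
  note [measurable] = density_quantile_measurable[OF dqR]
  \<comment> \<open>From \<open>J >= c I\<close> follows \<open>R' <= Q' / c\<close>, so the
    oscillation of \<open>R\<close> is at most that of \<open>Q / c\<close>. Boundedness gives both
    square integrability and control at the end points.\<close>
  have Rdiff: "R v - R u \<le> 2 * B / c" if uv: "0 < u" "u \<le> v" "v < 1" for u v
  proof -
    have "Q u / c - R u \<le> Q v / c - R v"
    proof (rule DERIV_nonneg_imp_nondecreasing[where f = "\<lambda>u. Q u / c - R u"])
      fix t assume t: "u \<le> t" "t \<le> v"
      show "\<exists>d. ((\<lambda>u. Q u / c - R u) has_real_derivative d) (at t) \<and> 0 \<le> d"
      proof (intro exI conjI)
        show "((\<lambda>u. Q u / c - R u) has_real_derivative 1 / I t / c - 1 / J t) (at t)"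
          using t uv by (intro DERIV_diff DERIV_cdivide R density_quantileD(3)[OF dq]) auto
        have "1 / J t \<le> 1 / (c * I t)"
          using t uv c cI[of t] Ipos[of t] by (intro divide_left_mono) (auto intro!: mult_pos_pos Jpos)
        then show "0 \<le> 1 / I t / c - 1 / J t" by (simp add: mult.commute)
      qed
    qed (use uv in simp)
    then have "R v - R u \<le> (Q v - Q u) / c" by (simp add: diff_divide_distrib)
    also have "\<dots> \<le> 2 * B / c"
      using bounded[of u] bounded[of v] uv c by (intro divide_right_mono) auto
    finally show ?thesis .
  qed
  define K where "K = \<bar>R (1/2)\<bar> + 2 * B / c"
  have RK: "\<bar>R u\<bar> \<le> K" if "0 < u" "u < 1" for u
  proof (cases "u \<le> 1/2")
    case True
    then show ?thesis
      using Rdiff[of u "1/2"] density_quantile_mono[OF dqR, of u "1/2"] that by (auto simp: K_def)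
  next
    case False
    then show ?thesis
      using Rdiff[of "1/2" u] density_quantile_mono[OF dqR, of "1/2" u] that by (auto simp: K_def)
  qed
  have "integrable unif01 (\<lambda>u. (R u)\<^sup>2)"
  proof (rule bounded_integrable)
    fix u :: real assume "0 < u" "u < 1"
    then have "\<bar>R u\<bar>\<^sup>2 \<le> K\<^sup>2" using RK[of u] by (intro power_mono) auto
    then show "\<bar>(R u)\<^sup>2\<bar> \<le> K\<^sup>2" by simp
  qed measurable
  then have st: "0 \<le> (\<integral>u. (Q u - q u) * (R u - Q u) \<partial>unif01)"
    by (rule stationaryD[OF stat dqR])
  define D where "D u = R u - Q u" for u
  have DK: "\<bar>D u\<bar> \<le> K + B" if "0 < u" "u < 1" for u
    using RK[OF that] bounded[OF that] by (simp add: D_def)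
  have intD: "integrable unif01 (\<lambda>u. (q u - Q u) * D u)"
  proof (rule bounded_integrable)
    fix u :: real assume u: "0 < u" "u < 1"
    show "\<bar>(q u - Q u) * D u\<bar> \<le> (M + B) * (K + B)"
      unfolding abs_mult using diff_bounded[OF u] DK[OF u] by (intro mult_mono) auto
  qed (simp add: D_def)
  define E where "E = (\<integral>u. (q u - Q u) * D u \<partial>unif01)"
  have E: "((\<lambda>u. (q u - Q u) * D u) has_integral E) {0..1}" "E \<le> 0"
  proof -
    show "((\<lambda>u. (q u - Q u) * D u) has_integral E) {0..1}"
      unfolding E_def by (rule unif01_has_integral[OF intD])
    have "E = - (\<integral>u. (Q u - q u) * (R u - Q u) \<partial>unif01)"
      unfolding E_def D_def
      by (subst Bochner_Integration.integral_minus[symmetric]) (simp add: algebra_simps)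
    then show "E \<le> 0" using st by simp
  qed
  \<comment> \<open>Minus the integrand of the first variation after integration by parts,
    nonnegative by \<open>sign\<close>. Its integral turns out to be \<open>E\<close>, which is at
    most 0 by stationarity, so \<open>h\<close>, continuous near \<open>w\<close>, vanishes at
    \<open>w\<close>.\<close>
  define h where "h u = (if 0 < u \<and> u < 1 then - (G u * (1 / J u - 1 / I u)) else 0)" for u
  have h0: "0 \<le> h u" for u using sign[of u] by (auto simp: h_def)
  \<comment> \<open>The product is set to 0 at 0 and 1, where \<open>R\<close> and \<open>Q\<close>
    have arbitrary values; continuity there follows from \<open>G -> 0\<close> and the bound on
    \<open>D\<close>.\<close>
  define \<Phi> where "\<Phi> u = (if 0 < u \<and> u < 1 then G u * D u else 0)" for u
  have contG: "isCont G u" if "0 < u" "u < 1" for u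
    using G_continuous that by (intro continuous_on_interior[of "{0..1}"]) auto
  have contD: "isCont D u" if "0 < u" "u < 1" for u
    unfolding D_def using DERIV_isCont[OF R[OF that]] DERIV_isCont[OF density_quantileD(3)[OF dq that]]
    by (intro continuous_intros)
  have \<Phi>_cont: "continuous_on {0..1} \<Phi>"
    unfolding continuous_on_eq_continuous_within
  proof
    fix u :: real assume u: "u \<in> {0..1}"
    show "continuous (at u within {0..1}) \<Phi>"
    proof (cases "0 < u \<and> u < 1")
      case True
      have "isCont (\<lambda>u. G u * D u) u" using contG contD True by (intro continuous_intros) auto
      moreover have "\<forall>\<^sub>F v in nhds u. v \<in> {0<..<1}" using True by (intro eventually_nhds_in_open) auto
      then have "\<forall>\<^sub>F v in nhds u. \<Phi> v = G v * D v"
        by eventually_elim (auto simp: \<Phi>_def)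
      ultimately have "isCont \<Phi> u" by (subst isCont_cong)
      then show ?thesis using continuous_at_imp_continuous_at_within by blast
    next
      case False
      then have "u = 0 \<or> u = 1" using u by auto
      then have G0: "G u = 0" and \<Phi>0: "\<Phi> u = 0" using G_0 G_1 by (auto simp: \<Phi>_def)
      have "continuous (at u within {0..1}) G"
        using G_continuous u by (simp add: continuous_on_eq_continuous_within)
      then have "(G \<longlongrightarrow> 0) (at u within {0..1})" by (simp add: continuous_within G0)
      then have lim: "((\<lambda>v. (K + B) * \<bar>G v\<bar>) \<longlongrightarrow> 0) (at u within {0..1})"
        by (intro tendsto_mult_right_zero tendsto_rabs_zero)
      have "(\<Phi> \<longlongrightarrow> 0) (at u within {0..1})"
      proof (rule Lim_null_comparison[OF _ lim])
        have "norm (\<Phi> v) \<le> (K + B) * \<bar>G v\<bar>" for v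
        proof (cases "0 < v \<and> v < 1")
          case True
          then have "\<bar>D v\<bar> * \<bar>G v\<bar> \<le> (K + B) * \<bar>G v\<bar>" using DK[of v] by (intro mult_right_mono) auto
          then show ?thesis using True by (simp add: \<Phi>_def abs_mult mult.commute)
        next
          case False
          have "0 \<le> K + B" using DK[of "1/2"] by simp
          then show ?thesis using False by (auto simp: \<Phi>_def)
        qed
        then show "\<forall>\<^sub>F v in at u within {0..1}. norm (\<Phi> v) \<le> (K + B) * \<bar>G v\<bar>"
          by simp
      qed
      then show ?thesis by (simp add: continuous_within \<Phi>0)
    qed
  qed
  have "((\<lambda>u. (q u - Q u) * D u - h u) has_integral (\<Phi> 1 - \<Phi> 0)) {0..1}"
  proof (rule fundamental_theorem_of_calculus_interior_strong[OF finite_grid _ _ \<Phi>_cont])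
    fix u assume u: "u \<in> {0<..<1} - grid"
    then have u': "0 < u" "u < 1" "u \<notin> grid" by auto
    have "((\<lambda>u. G u * D u) has_real_derivative (q u - Q u) * D u + G u * (1 / J u - 1 / I u)) (at u)"
      unfolding D_def
      by (rule derivative_eq_intros G_deriv u' R density_quantileD(3)[OF dq] refl)+ (simp add: algebra_simps)
    moreover have "\<forall>\<^sub>F v in nhds u. v \<in> {0<..<1}" using u by (intro eventually_nhds_in_open) auto
    then have "\<forall>\<^sub>F v in nhds u. \<Phi> v = G v * D v"
      by eventually_elim (auto simp: \<Phi>_def)
    ultimately have "(\<Phi> has_real_derivative (q u - Q u) * D u + G u * (1 / J u - 1 / I u)) (at u)"
      by (subst DERIV_cong_ev[OF refl _ refl])
    then show "(\<Phi> has_vector_derivative (q u - Q u) * D u - h u) (at u)"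
      using u' by (simp add: has_real_derivative_iff_has_vector_derivative h_def)
  qed simp
  then have "((\<lambda>u. (q u - Q u) * D u - h u) has_integral 0) {0..1}" by (simp add: \<Phi>_def)
  from has_integral_diff[OF E(1) this] have hE: "(h has_integral E) {0..1}" by simp
  define a b where "a = w / 2" and "b = (w + 1) / 2"
  have ab: "0 < a" "a < w" "w < b" "b < 1" using w by (auto simp: a_def b_def)
  have hcont: "continuous_on {a..b} h"
  proof -
    have "continuous_on {a..b} (\<lambda>u. - (G u * (1 / J u - 1 / I u)))"
      using ab Jpos Ipos
      by (intro continuous_intros continuous_on_subset[OF G_continuous] continuous_on_subset[OF contI]
          continuous_on_subset[OF contJ]) (force simp: less_le)+
    then show ?thesis
      by (rule iffD1[OF continuous_on_cong[OF refl], rotated]) (use ab in \<open>auto simp: h_def\<close>)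
  qed
  have "integral {a..b} h \<le> integral {0..1} h"
    using ab hE h0 by (intro integral_subset_le) (auto intro: integrable_continuous_interval hcont)
  also have "\<dots> \<le> 0" using hE E(2) by (simp add: integral_unique)
  finally have "integral {a..b} h \<le> 0" .
  moreover have "0 \<le> integral {a..b} h"
    by (intro integral_nonneg integrable_continuous_interval hcont h0)
  ultimately have "integral {a..b} h = 0" by (rule order_antisym)
  then have "h w = 0"
    using integral_eq_0_iff[OF hcont] ab h0 by simp
  then have "1 / J w = 1 / I w" using w by (simp add: h_def)
  then show ?thesis using Jpos[of w] Ipos[of w] w by (simp add: field_simps)
qed

end

section \<open>Finitely many affine pieces\<close>


context stationary_quantile
begin

lemma G_isCont: "0 < u \<Longrightarrow> u < 1 \<Longrightarrow> isCont G u"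
  using G_continuous by (intro continuous_on_interior[of "{0..1}"]) auto

lemma grid_01: "0 \<in> grid" "1 \<in> grid"
  using n unfolding grid_def by (force, auto intro!: image_eqI[of _ _ n])

text \<open>Rolle's theorem between two zeros inside one cell gives a point where
  \<open>Q = y k\<close>. Three zeros would give two such points, against strict monotonicity of
  \<open>Q\<close>.\<close>

lemma finite_zeros: "finite {u\<in>{0..1}. G u = 0}"
proof -
  let ?Z = "\<lambda>k. {u. 0 < u \<and> u < 1 \<and> real k / real n < u \<and> u < (real k + 1) / real n \<and> G u = 0}"
  have "finite (?Z k)" for k
  proof (rule finite_of_no_triple)
    fix u v w assume uvw: "u \<in> ?Z k" "v \<in> ?Z k" "w \<in> ?Z k" "u < v" "v < w"
    have root: "\<exists>z>s. z < t \<and> q z = Q z \<and> q z = y k" if st: "s \<in> ?Z k" "t \<in> ?Z k" "s < t" for s t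
    proof -
      have qk: "q z = y k" "z \<notin> grid" if z: "s < z" "z < t" for z
      proof -
        have zk: "real k / real n < z" "z < (real k + 1) / real n" "0 \<le> z"
          using st z by auto
        then have "nat \<lfloor>real n * z\<rfloor> = k" using nat_floor_eq_iff[of n z k] n by simp
        then show "q z = y k" by (simp add: step_fun_def)
        show "z \<notin> grid"
        proof
          assume "z \<in> grid"
          then obtain j where "z = real j / real n" by (auto simp: grid_def)
          then have "real k < real j" "real j < real (Suc k)"
            using zk n by (auto simp: divide_less_cancel)
          then show False by (simp only: of_nat_less_iff)
        qed
      qed
      have der: "(G has_real_derivative q z - Q z) (at z)" if "s < z" "z < t" for z
        using qk[OF that] st that by (intro G_deriv) auto
      have "continuous_on {s..t} G"
        using st by (intro continuous_on_subset[OF G_continuous]) auto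
      then obtain z where z: "s < z" "z < t" "G t - G s = (t - s) * (q z - Q z)"
        using MVT[OF st(3), of G] der st
        by (smt (verit, ccfv_threshold) DERIV_unique real_differentiable_def)
      then have "q z = Q z" using st by auto
      then show ?thesis using z qk by blast
    qed
    obtain z where z: "u < z" "z < v" "q z = Q z" "q z = y k" using root uvw by blast
    obtain z' where z': "v < z'" "z' < w" "q z' = Q z'" "q z' = y k" using root uvw by blast
    have "Q z < Q z'"
      using uvw z z' by (intro density_quantile_strict_mono[OF dq]) auto
    then show False using z z' by simp
  qed
  then have "finite (grid \<union> (\<Union>k<n. ?Z k))" using finite_grid by blast
  moreover have "{u\<in>{0..1}. G u = 0} \<subseteq> grid \<union> (\<Union>k<n. ?Z k)"
  proof
    fix u assume u: "u \<in> {u\<in>{0..1}. G u = 0}"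
    show "u \<in> grid \<union> (\<Union>k<n. ?Z k)"
    proof (cases "u \<in> grid")
      case False
      then have u': "0 < u" "u < 1" using u grid_01 by (auto simp: less_le)
      obtain k where "k < n" "real k / real n < u" "u < (real k + 1) / real n"
        using off_grid_cell[OF u' False] by metis
      then show ?thesis using u u' by blast
    qed simp
  qed
  ultimately show ?thesis by (rule finite_subset[rotated])
qed

text \<open>Where \<open>G < 0\<close> the competitor replaces \<open>I\<close> by a chord, which is smaller.\<close>

lemma affine_between_of_neg:
  assumes ab: "0 \<le> a" "a < b" "b \<le> 1" and neg: "\<And>u. a < u \<Longrightarrow> u < b \<Longrightarrow> G u < 0"
  shows "affine_between a b I"
proof (rule affine_between_of_chords[OF ab(2)])
  fix p u r assume pr: "a < p" "p < u" "u < r" "r < b"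
  define L where "L v = I p + (I r - I p) / (r - p) * (v - p)" for v
  have Ipos: "0 < I v" if "0 < v" "v < 1" for v using density_quantileD(2)[OF dq that] .
  have cross: "(w - s) * I v \<ge> (w - v) * I s + (v - s) * I w"
    if "0 < s" "s < v" "v < w" "w < 1" for s v w
  proof -
    have "I s + (I w - I s) / (w - s) * (v - s) \<le> I v"
      using that by (intro concave_on_above_chord[OF density_quantileD(4)[OF dq]]) auto
    then have "(w - s) * (I s + (I w - I s) / (w - s) * (v - s)) \<le> (w - s) * I v"
      using that by (intro mult_left_mono) auto
    moreover have "(w - s) * (I s + (I w - I s) / (w - s) * (v - s)) = (w - s) * I s + (I w - I s) * (v - s)"
      using that by (simp add: distrib_left)
    ultimately show ?thesis by (simp add: algebra_simps)
  qed
  have Lmul: "(r - p) * L v = (r - v) * I p + (v - p) * I r" for v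
  proof -
    have "(r - p) * L v = (r - p) * I p + (I r - I p) * (v - p)"
      using pr by (simp add: L_def distrib_left)
    then show ?thesis by (simp add: algebra_simps)
  qed
  have inside: "L v \<le> I v" if "p \<le> v" "v \<le> r" for v
    using that ab pr unfolding L_def
    by (intro concave_on_above_chord[OF density_quantileD(4)[OF dq]]) auto
  \<comment> \<open>Outside \<open>[p, r]\<close> the extended chord lies above the concave
    \<open>I\<close>, so \<open>min I L\<close>, concave on all of (0, 1), differs from
    \<open>I\<close> only inside, where \<open>G < 0\<close>.\<close>
  have outside: "I v \<le> L v" if "0 < v" "v < 1" "v < p \<or> r < v" for v
  proof -
    have "(r - p) * I v \<le> (r - p) * L v"
      using that(3)
    proof
      assume "v < p"
      then have "(r - p) * I v + (p - v) * I r \<le> (r - v) * I p"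
        using cross[of v p r] that ab pr by simp
      then show ?thesis unfolding Lmul by (simp add: algebra_simps)
    next
      assume "r < v"
      then have "(v - r) * I p + (r - p) * I v \<le> (v - p) * I r"
        using cross[of p r v] that ab pr by simp
      then show ?thesis unfolding Lmul by (simp add: algebra_simps)
    qed
    then show ?thesis using pr by simp
  qed
  define m where "m = min (I p) (I r)"
  have m: "0 < m" using Ipos[of p] Ipos[of r] ab pr by (simp add: m_def)
  have Lm: "m \<le> L v" if "p \<le> v" "v \<le> r" for v
  proof -
    have "(r - v) * m + (v - p) * m \<le> (r - p) * L v"
      unfolding Lmul using that by (intro add_mono mult_left_mono) (auto simp: m_def)
    then have "(r - p) * m \<le> (r - p) * L v" by (simp add: algebra_simps)
    then show ?thesis using pr by simp
  qed
  obtain s where s: "\<And>v. v \<in> {0<..<1} \<Longrightarrow> I v \<le> I (1/2) + s * (v - 1/2)"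
    using density_quantileD(1)[OF dq] unfolding has_supporting_lines_def by force
  define C where "C = I (1/2) + \<bar>s\<bar>"
  have IC: "I v \<le> C" if "0 < v" "v < 1" for v
  proof -
    have "s * (v - 1/2) \<le> \<bar>s\<bar> * \<bar>v - 1/2\<bar>" by (metis abs_ge_self abs_mult)
    also have "\<dots> \<le> \<bar>s\<bar> * 1" using that by (intro mult_left_mono) auto
    finally show ?thesis using s[of v] that by (simp add: C_def)
  qed
  have C: "0 < C" using Ipos[of "1/2"] by (simp add: C_def)
  \<comment> \<open>\<open>C\<close> bounds \<open>I\<close> on (0, 1) and \<open>m\<close> bounds
    the chord from below on \<open>[p, r]\<close>, so \<open>c * I <= m <= L\<close> there, as
    \<open>perturbation\<close> requires.\<close>
  define c where "c = min 1 (m / C)"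
  have c: "0 < c" "c \<le> 1" "c * C \<le> m" using m C by (auto simp: c_def min_def field_simps)
  have c_le: "c * I v \<le> min (I v) (L v)" if v: "0 < v" "v < 1" for v
  proof -
    have 1: "c * I v \<le> I v" using c Ipos[OF v] by (simp add: mult_le_cancel_right1)
    have "c * I v \<le> c * C" using c IC[OF v] by (intro mult_left_mono) auto
    then have "c * I v \<le> m" using c by linarith
    then show ?thesis using 1 outside[OF v] Lm[of v] by (cases "v < p \<or> r < v") auto
  qed
  have "min (I u) (L u) = I u"
  proof (rule perturbation[where J = "\<lambda>v. min (I v) (L v)"])
    have shift: "x + s * (v - p) = (x - s * p) + s * v" for x s v :: real
      by (simp add: algebra_simps)
    have "has_supporting_lines {0<..<1} L"
      unfolding L_def[abs_def] shift by (rule has_supporting_lines_affine)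
    then show "has_supporting_lines {0<..<1} (\<lambda>v. min (I v) (L v))"
      by (intro has_supporting_lines_min density_quantileD(1)[OF dq])
    show "0 < c" "\<And>v. 0 < v \<Longrightarrow> v < 1 \<Longrightarrow> c * I v \<le> min (I v) (L v)"
      using c c_le by auto
    show "0 < u" "u < 1" "G u \<noteq> 0" using neg[of u] pr ab by auto
    show "G v * (1 / min (I v) (L v) - 1 / I v) \<le> 0" if v: "0 < v" "v < 1" for v
    proof (cases "v < p \<or> r < v")
      case True
      then show ?thesis using outside[OF v] by simp
    next
      case False
      then have "G v < 0" "0 < L v" using neg[of v] pr Lm[of v] m by auto
      moreover have "1 / I v \<le> 1 / min (I v) (L v)"
        using \<open>0 < L v\<close> Ipos[OF v] by (intro divide_left_mono) auto
      ultimately show ?thesis by (intro mult_nonpos_nonneg) auto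
    qed
  qed
  then show "I u = I p + (I r - I p) / (r - p) * (u - p)"
    using inside[of u] pr by (simp add: L_def)
qed

text \<open>Where \<open>G > 0\<close> the competitor replaces \<open>I\<close> by the minimum of supporting lines at the end
  points, which is larger. An end point that is \<open>0\<close> or \<open>1\<close> contributes no line.\<close>

lemma affine_pieces_of_pos:
  assumes ab: "0 \<le> a" "a < b" "b \<le> 1" "0 < a \<or> b < 1"
    and pos: "\<And>u. a < u \<Longrightarrow> u < b \<Longrightarrow> 0 < G u"
  obtains c where "a \<le> c" "c \<le> b" "affine_between a c I" "affine_between c b I"
proof -
  have Ipos: "0 < I v" if "0 < v" "v < 1" for v using density_quantileD(2)[OF dq that] .
  have supp: "\<exists>s. \<forall>v. 0 < v \<longrightarrow> v < 1 \<longrightarrow> I v \<le> I w + s * (v - w)" if "0 < w" "w < 1" for w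
  proof -
    have "w \<in> {0<..<1}" using that by simp
    then obtain s where "\<forall>v\<in>{0<..<1}. I v \<le> I w + s * (v - w)"
      using density_quantileD(1)[OF dq] unfolding has_supporting_lines_def by blast
    then show ?thesis by (intro exI[of _ s]) simp
  qed
  \<comment> \<open>An end point equal to 0 or 1 is replaced by the other one, which is inside (0,
    1) by assumption; both lines then pass through the same point of the graph.\<close>
  define p where "p = (if a = 0 then b else a)"
  define r where "r = (if b = 1 then a else b)"
  have pr: "0 < p" "p < 1" "0 < r" "r < 1" using ab by (auto simp: p_def r_def)
  obtain s where s: "\<And>v. 0 < v \<Longrightarrow> v < 1 \<Longrightarrow> I v \<le> I p + s * (v - p)" using supp[OF pr(1,2)] by blast
  obtain t where t: "\<And>v. 0 < v \<Longrightarrow> v < 1 \<Longrightarrow> I v \<le> I r + t * (v - r)" using supp[OF pr(3,4)] by blast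
  define L where "L v = min (I p + s * (v - p)) (I r + t * (v - r))" for v
  have IL: "I v \<le> L v" if "0 < v" "v < 1" for v using s[OF that] t[OF that] by (simp add: L_def)
  define J where "J v = (if a < v \<and> v < b then L v else I v)" for v
  have IJ: "I v \<le> J v" if "0 < v" "v < 1" for v using IL[OF that] by (simp add: J_def)
  have JL: "J v \<le> L v" if "0 < v" "v < 1" for v using IL[OF that] by (simp add: J_def)
  have "has_supporting_lines {0<..<1} J"
    unfolding has_supporting_lines_def
  proof
    fix u :: real assume "u \<in> {0<..<1}"
    then have u: "0 < u" "u < 1" by auto
    consider "a < u" "u < b" | "u \<le> a" | "b \<le> u" by linarith
    then show "\<exists>s. \<forall>v\<in>{0<..<1}. J v \<le> J u + s * (v - u)"
    proof cases
      case 1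
      have "has_supporting_lines {0<..<1} (\<lambda>v. min ((I p - s * p) + s * v) ((I r - t * r) + t * v))"
        by (intro has_supporting_lines_min has_supporting_lines_affine)
      then have "has_supporting_lines {0<..<1} L"
        by (simp add: L_def[abs_def] algebra_simps)
      then obtain m where "\<And>v. v \<in> {0<..<1} \<Longrightarrow> L v \<le> L u + m * (v - u)"
        using u unfolding has_supporting_lines_def by force
      then have "\<And>v. v \<in> {0<..<1} \<Longrightarrow> J v \<le> J u + m * (v - u)"
        using JL 1 unfolding J_def[of u] by fastforce
      then show ?thesis by blast
    next
      case 2
      then have "p = a" using u by (simp add: p_def)
      \<comment> \<open>The line at \<open>u\<close> has to dominate \<open>L\<close> beyond
        \<open>a\<close> as well, for which a slope of at least \<open>s\<close> suffices. For
        \<open>u < a\<close> this holds because supporting slopes decrease; at \<open>u = a\<close>,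
        where \<open>I\<close> may have a kink, the slope \<open>s\<close> itself is chosen.\<close>
      obtain m where m: "\<And>v. 0 < v \<Longrightarrow> v < 1 \<Longrightarrow> I v \<le> I u + m * (v - u)" and me: "u = a \<Longrightarrow> m = s"
        using supp[OF u] s \<open>p = a\<close> by (cases "u = a") auto
      have sm: "s \<le> m"
      proof (cases "u = a")
        case False
        then have "0 \<le> (m - s) * (a - u)"
          using m[of a] s[of u] u pr \<open>p = a\<close> by (simp add: algebra_simps)
        then show ?thesis using False 2 by (simp add: zero_le_mult_iff)
      qed (use me in simp)
      have "J v \<le> J u + m * (v - u)" if v: "0 < v" "v < 1" for v
      proof (cases "a < v \<and> v < b")
        case True
        have "L v \<le> I a + s * (v - a)" using \<open>p = a\<close> by (simp add: L_def)
        also have "\<dots> \<le> I a + m * (v - a)" using sm True by (intro add_left_mono mult_right_mono) auto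
        also have "\<dots> \<le> I u + m * (a - u) + m * (v - a)" using m[of a] pr \<open>p = a\<close> by simp
        finally show ?thesis using True 2 by (simp add: J_def algebra_simps)
      next
        case False
        then have "J v = I v" unfolding J_def by (rule if_not_P)
        then show ?thesis using m[OF v] 2 by (simp add: J_def[of u])
      qed
      then show ?thesis by (intro exI[of _ m]) simp
    next
      case 3
      then have "r = b" using u by (simp add: r_def)
      obtain m where m: "\<And>v. 0 < v \<Longrightarrow> v < 1 \<Longrightarrow> I v \<le> I u + m * (v - u)" and me: "u = b \<Longrightarrow> m = t"
        using supp[OF u] t \<open>r = b\<close> by (cases "u = b") auto
      have tm: "m \<le> t"
      proof (cases "u = b")
        case False
        then have "0 \<le> (t - m) * (u - b)"
          using m[of b] t[of u] u pr \<open>r = b\<close> by (simp add: algebra_simps)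
        then show ?thesis using False 3 by (simp add: zero_le_mult_iff)
      qed (use me in simp)
      have "J v \<le> J u + m * (v - u)" if v: "0 < v" "v < 1" for v
      proof (cases "a < v \<and> v < b")
        case True
        have "L v \<le> I b + t * (v - b)" using \<open>r = b\<close> by (simp add: L_def)
        also have "\<dots> \<le> I b + m * (v - b)" using tm True by (intro add_left_mono mult_right_mono_neg) auto
        also have "\<dots> \<le> I u + m * (b - u) + m * (v - b)" using m[of b] pr \<open>r = b\<close> by simp
        finally show ?thesis using True 3 by (simp add: J_def algebra_simps)
      next
        case False
        then have "J v = I v" unfolding J_def by (rule if_not_P)
        then show ?thesis using m[OF v] 3 by (simp add: J_def[of u])
      qed
      then show ?thesis by (intro exI[of _ m]) simp
    qed
  qed
  then have J_eq: "J u = I u" if "a < u" "u < b" for u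
  proof (rule perturbation[where c = 1])
    show "0 < u" "u < 1" "G u \<noteq> 0" using that ab pos[of u] by auto
    show "G v * (1 / J v - 1 / I v) \<le> 0" if v: "0 < v" "v < 1" for v
    proof (cases "a < v \<and> v < b")
      case True
      have "1 / J v \<le> 1 / I v"
        using Ipos[OF v] IJ[OF v] by (intro divide_left_mono) auto
      then show ?thesis using pos[of v] True by (intro mult_nonneg_nonpos) auto
    next
      case False
      then have "J v = I v" unfolding J_def by (rule if_not_P)
      then show ?thesis by simp
    qed
  qed (use IJ in auto)
  obtain c where c: "a \<le> c" "c \<le> b"
    and aff: "affine_between a c (\<lambda>u. min ((I p - s * p) + s * u) ((I r - t * r) + t * u))"
      "affine_between c b (\<lambda>u. min ((I p - s * p) + s * u) ((I r - t * r) + t * u))"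
    using min_affine_split[OF ab(2), of "I p - s * p" s "I r - t * r" t] by blast
  have eq: "min ((I p - s * p) + s * u) ((I r - t * r) + t * u) = I u" if "a < u" "u < b" for u
    using J_eq[OF that] that by (simp add: J_def L_def algebra_simps)
  show ?thesis
  proof (rule that[OF c])
    show "affine_between a c I"
      using aff(1) by (rule affine_between_cong[rotated]) (use eq c in auto)
    show "affine_between c b I"
      using aff(2) by (rule affine_between_cong[rotated]) (use eq c in auto)
  qed
qed

text \<open>The intermediate value theorem gives \<open>G\<close> one sign on the interval, and one
  of the two preceding lemmas applies.\<close>

lemma affine_pieces_between:
  assumes ab: "0 \<le> a" "a < b" "b \<le> 1" "0 < a \<or> b < 1"
    and nz: "\<And>u. a < u \<Longrightarrow> u < b \<Longrightarrow> G u \<noteq> 0"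
  shows "\<exists>c. a \<le> c \<and> c \<le> b \<and> affine_between a c I \<and> affine_between c b I"
proof -
  have cont: "isCont G u" if "a < u" "u < b" for u
    using that ab by (intro G_isCont) auto
  have same: "0 < G u \<longleftrightarrow> 0 < G v" if uv: "a < u" "u < v" "v < b" for u v
  proof (rule ccontr)
    assume "\<not> ?thesis"
    then have "(G u \<le> 0 \<and> 0 \<le> G v) \<or> (0 \<le> G u \<and> G v \<le> 0)" by auto
    then have "\<exists>w. u \<le> w \<and> w \<le> v \<and> G w = 0"
      using IVT[of G u 0 v] IVT2[of G v 0 u] cont uv by fastforce
    then obtain w where "u \<le> w" "w \<le> v" "G w = 0" by blast
    then show False using nz[of w] uv by auto
  qed
  define w where "w = (a + b) / 2"
  have w: "a < w" "w < b" using ab by (auto simp: w_def)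
  have all: "0 < G u \<longleftrightarrow> 0 < G w" if "a < u" "u < b" for u
  proof (cases u w rule: linorder_cases)
    case less
    then show ?thesis using same[of u w] that w by blast
  next
    case greater
    then show ?thesis using same[of w u] that w by blast
  qed simp
  show ?thesis
  proof (cases "0 < G w")
    case True
    then show ?thesis using affine_pieces_of_pos[OF ab] all by metis
  next
    case False
    then have "G u < 0" if "a < u" "u < b" for u
      using all[OF that] nz[OF that] by auto
    then have "affine_between a b I" by (rule affine_between_of_neg[OF ab(1-3)])
    then show ?thesis using ab by (intro exI[of _ a]) (auto simp: affine_between_def)
  qed
qed

lemma finite_breakpoints:
  obtains P where "finite P" "{0, 1} \<subseteq> P" "P \<subseteq> {0..1}"
    "\<And>a b. 0 \<le> a \<Longrightarrow> a < b \<Longrightarrow> b \<le> 1 \<Longrightarrow> {a<..<b} \<inter> P = {} \<Longrightarrow> affine_between a b I"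
proof -
  \<comment> \<open>The point 1/2 cuts the gap (0, 1) that would arise if \<open>G\<close> had no
    interior zero, so that each gap has an end point inside (0, 1).\<close>
  define P where "P = insert (1/2) {u\<in>{0..1}. G u = 0}"
  have P: "finite P" "0 \<in> P" "1 \<in> P" "P \<subseteq> {0..1}" "1/2 \<in> P"
    using finite_zeros G_0 G_1 by (auto simp: P_def)
  define nxt where "nxt p = Min {r\<in>P. p < r}" for p
  have nxt: "nxt p \<in> P" "p < nxt p" "\<And>r. r \<in> P \<Longrightarrow> p < r \<Longrightarrow> nxt p \<le> r"
    if "p \<in> P" "p < 1" for p
  proof -
    have fin: "finite {r\<in>P. p < r}" and "{r\<in>P. p < r} \<noteq> {}" using P that by auto
    then have "nxt p \<in> {r\<in>P. p < r}" unfolding nxt_def by (rule Min_in)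
    then show "nxt p \<in> P" "p < nxt p" by auto
    show "\<And>r. r \<in> P \<Longrightarrow> p < r \<Longrightarrow> nxt p \<le> r" unfolding nxt_def using fin by (intro Min_le) auto
  qed
  have "\<exists>c. p \<le> c \<and> c \<le> nxt p \<and> affine_between p c I \<and> affine_between c (nxt p) I"
    if p: "p \<in> P" "p < 1" for p
  proof (rule affine_pieces_between)
    show "0 \<le> p" "p < nxt p" "nxt p \<le> 1" using nxt[OF p] p P by auto
    show "0 < p \<or> nxt p < 1"
      using nxt(3)[OF p P(5)] p P by (cases "p < 1/2") auto
    show "G u \<noteq> 0" if "p < u" "u < nxt p" for u
    proof
      assume "G u = 0"
      moreover have "0 \<le> u" "u \<le> 1" using that p nxt[OF p] P by force+
      ultimately have "u \<in> P" by (simp add: P_def)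
      then show False using nxt(3)[OF p, of u] that by simp
    qed
  qed
  then obtain c where c: "\<And>p. p \<in> P \<Longrightarrow> p < 1 \<Longrightarrow>
      p \<le> c p \<and> c p \<le> nxt p \<and> affine_between p (c p) I \<and> affine_between (c p) (nxt p) I"
    by metis
  \<comment> \<open>One further break point per gap, for the kink of the minimum of two lines where
    \<open>G > 0\<close>.\<close>
  define S where "S = P \<union> c ` (P - {1})"
  show ?thesis
  proof (rule that[of S])
    show "finite S" "{0, 1} \<subseteq> S" using P by (auto simp: S_def)
    show "S \<subseteq> {0..1}"
    proof -
      have "c p \<in> {0..1}" if "p \<in> P - {1}" for p
      proof -
        have "p \<in> P" "p < 1" using that P by (auto simp: less_le)
        then have "0 \<le> p" "p \<le> c p" "c p \<le> nxt p" "nxt p \<le> 1"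
          using c[of p] nxt(1)[of p] P(4) by auto
        then show ?thesis by simp
      qed
      then show ?thesis unfolding S_def using P(4) by blast
    qed
    fix a b :: real assume ab: "0 \<le> a" "a < b" "b \<le> 1" and S: "{a<..<b} \<inter> S = {}"
    define p where "p = Max {r\<in>P. r \<le> a}"
    have fin: "finite {r\<in>P. r \<le> a}" and ne: "{r\<in>P. r \<le> a} \<noteq> {}" using P ab by auto
    then have "p \<in> {r\<in>P. r \<le> a}" unfolding p_def by (rule Max_in)
    then have p: "p \<in> P" "p < 1" "p \<le> a" using ab by auto
    have max: "r \<le> p" if "r \<in> P" "r \<le> a" for r
      unfolding p_def using fin that by (intro Max_ge) auto
    have "b \<le> nxt p"
    proof (rule ccontr)
      assume "\<not> b \<le> nxt p"
      moreover have "a < nxt p" using max[of "nxt p"] nxt[OF p(1,2)] by (metis not_le)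
      ultimately have "nxt p \<in> {a<..<b} \<inter> S" using nxt[OF p(1,2)] by (auto simp: S_def)
      then show False using S by blast
    qed
    moreover have "c p \<notin> {a<..<b}"
      using S p by (auto simp: S_def)
    then have "c p \<le> a \<or> b \<le> c p" by auto
    ultimately show "affine_between a b I"
      using c[OF p(1,2)] p(3) affine_between_mono by blast
  qed
qed

end

section \<open>Piecewise log-affine densities\<close>


text \<open>With \<open>I = p + s u\<close> both \<open>ln I\<close> and \<open>s Q\<close> have the
  derivative \<open>s / I\<close>, so they differ by a constant.\<close>

lemma ln_affine_on_segment:
  assumes dq: "density_quantile I Q" and ab: "0 \<le> a" "a < b" "b \<le> 1" and aff: "affine_between a b I"
  shows "\<exists>s C. \<forall>u\<in>{a<..<b}. ln (I u) = s * Q u + C"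
proof -
  obtain p s where ps: "\<And>u. u \<in> {a<..<b} \<Longrightarrow> I u = p + s * u"
    using aff unfolding affine_between_def by blast
  have "\<exists>C. \<forall>u\<in>{a<..<b}. ln (p + s * u) - s * Q u = C"
  proof (rule has_field_derivative_zero_constant)
    fix u assume u: "u \<in> {a<..<b}"
    then have "0 < I u" "(Q has_real_derivative 1 / I u) (at u)"
      using density_quantileD(2,3)[OF dq, of u] ab by auto
    then have pos: "0 < p + s * u" and der: "(Q has_real_derivative 1 / (p + s * u)) (at u)"
      using ps[OF u] by simp_all
    have "((\<lambda>u. ln (p + s * u) - s * Q u) has_real_derivative
        1 / (p + s * u) * s - s * (1 / (p + s * u))) (at u)"
      using pos by (auto intro!: derivative_eq_intros der)
    then show "((\<lambda>u. ln (p + s * u) - s * Q u) has_real_derivative 0) (at u within {a<..<b})"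
      by (simp add: has_field_derivative_at_within)
  qed simp
  then obtain C where C: "\<And>u. u \<in> {a<..<b} \<Longrightarrow> ln (p + s * u) - s * Q u = C" by blast
  have "ln (I u) = s * Q u + C" if "u \<in> {a<..<b}" for u
    using C[OF that] unfolding ps[OF that] by linarith
  then show ?thesis by blast
qed

lemma compact_piecewise_log_affine_quantile_density:
  assumes dq: "density_quantile I Q" and bdd: "\<And>u. 0 < u \<Longrightarrow> u < 1 \<Longrightarrow> \<bar>Q u\<bar> \<le> B"
    and P: "finite P" "{0, 1} \<subseteq> P" "P \<subseteq> {0..1}"
    and aff: "\<And>a b. 0 \<le> a \<Longrightarrow> a < b \<Longrightarrow> b \<le> 1 \<Longrightarrow> {a<..<b} \<inter> P = {} \<Longrightarrow> affine_between a b I"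
  shows "compact_piecewise_log_affine (quantile_density I Q)"
proof -
  let ?f = "quantile_density I Q"
  define lo hi where "lo = Inf (Q ` {0<..<1})" and "hi = Sup (Q ` {0<..<1})"
  have bb: "bdd_below (Q ` {0<..<1})" and ba: "bdd_above (Q ` {0<..<1})"
    using bdd by (auto simp: abs_le_iff intro!: bdd_belowI2[of _ "-B"] bdd_aboveI2[of _ _ B]) (smt (verit))
  have lo_le: "lo \<le> Q u" and le_hi: "Q u \<le> hi" if "0 < u" "u < 1" for u
    using that bb ba by (auto simp: lo_def hi_def intro!: cINF_lower cSUP_upper)
  have lo: "lo < Q u" if "0 < u" "u < 1" for u
    using lo_le[of "u / 2"] density_quantile_strict_mono[OF dq, of "u / 2" u] that by simp
  have hi: "Q u < hi" if "0 < u" "u < 1" for u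
    using le_hi[of "(u + 1) / 2"] density_quantile_strict_mono[OF dq, of u "(u + 1) / 2"] that by simp
  \<comment> \<open>\<open>T\<close> extends \<open>Q\<close> to the end points by its infimum and
    supremum, since \<open>Q 0\<close> and \<open>Q 1\<close> are arbitrary values. The break points
    of the density are the images \<open>T (bs ! i)\<close>.\<close>
  define T where "T u = (if u = 0 then lo else if u = 1 then hi else Q u)" for u :: real
  have Tmono: "T u < T v" if "0 \<le> u" "u < v" "v \<le> 1" for u v
    using that lo[of v] hi[of u] lo[of "1/2"] hi[of "1/2"] density_quantile_strict_mono[OF dq, of u v]
    by (auto simp: T_def)
  have between: "\<exists>u\<in>{a<..<b}. x = Q u" if ab: "0 \<le> a" "a < b" "b \<le> 1" and x: "T a < x" "x < T b" for a b x
  proof -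
    have "lo < x"
      using x Tmono[of 0 a] ab by (cases "a = 0") (auto simp: T_def split: if_splits)
    then obtain u1 where u1: "0 < u1" "u1 < 1" "Q u1 < x"
      using cInf_lessD[of "Q ` {0<..<1}" x] unfolding lo_def by auto
    have "x < hi"
      using x Tmono[of b 1] ab by (cases "b = 1") (auto simp: T_def split: if_splits)
    then obtain u2 where u2: "0 < u2" "u2 < 1" "x < Q u2"
      using less_cSupD[of "Q ` {0<..<1}" x] unfolding hi_def by auto
    have "u1 \<le> u2"
      using density_quantile_mono[OF dq, of u2 u1] u1 u2 by (cases "u1 \<le> u2") auto
    moreover have "continuous_on {u1..u2} Q"
      using u1 u2 by (intro continuous_on_subset[OF density_quantileD(6)[OF dq]]) auto
    ultimately obtain u where "u1 \<le> u" "u \<le> u2" "Q u = x"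
      using IVT'[of Q u1 x u2] u1 u2 by auto
    then have u: "0 < u" "u < 1" "Q u = x" using u1 u2 by auto
    have "a < u"
    proof (rule ccontr)
      assume "\<not> a < u"
      then have "Q u \<le> Q a" "a \<noteq> 0" "a \<noteq> 1" using u ab by (auto intro: density_quantile_mono[OF dq])
      then show False using x u by (simp add: T_def)
    qed
    moreover have "u < b"
    proof (rule ccontr)
      assume "\<not> u < b"
      then have "Q b \<le> Q u" "b \<noteq> 0" "b \<noteq> 1" using u ab by (auto intro: density_quantile_mono[OF dq])
      then show False using x u by (simp add: T_def)
    qed
    ultimately show ?thesis using u by auto
  qed
  define bs where "bs = sorted_list_of_set P"
  define m where "m = card P - 1"
  have set_bs: "set bs = P" and sorted: "sorted bs" "distinct bs" and len: "length bs = card P"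
    using P by (auto simp: bs_def)
  have "card {0, 1 :: real} \<le> card P" using P by (intro card_mono) auto
  then have card: "2 \<le> card P" by simp
  have m: "1 \<le> m" "length bs = Suc m" using card len by (auto simp: m_def)
  have less: "bs ! i < bs ! j" if "i < j" "j \<le> m" for i j
    using sorted_nth_mono[OF sorted(1), of i j] nth_eq_iff_index_eq[OF sorted(2), of i j] that m
    by (auto simp: less_le)
  have in01: "0 \<le> bs ! i" "bs ! i \<le> 1" if "i \<le> m" for i
  proof -
    have "bs ! i \<in> P" using that m set_bs nth_mem[of i bs] by simp
    then show "0 \<le> bs ! i" "bs ! i \<le> 1" using P by auto
  qed
  have first: "bs ! 0 = 0"
  proof -
    obtain i where i: "i \<le> m" "bs ! i = 0"
      using P set_bs m by (metis in_set_conv_nth insert_subset less_Suc_eq_le)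
    then show ?thesis using less[of 0 i] in01[of 0] by (cases "i = 0") auto
  qed
  have last: "bs ! m = 1"
  proof -
    obtain i where i: "i \<le> m" "bs ! i = 1"
      using P set_bs m by (metis in_set_conv_nth insert_subset less_Suc_eq_le)
    then show ?thesis using less[of i m] in01[of m] by (cases "i = m") auto
  qed
  have gap: "{bs ! (i - 1)<..<bs ! i} \<inter> P = {}" if i: "i \<in> {1..m}" for i
  proof (rule ccontr)
    assume "\<not> ?thesis"
    then obtain j where j: "j \<le> m" "bs ! (i - 1) < bs ! j" "bs ! j < bs ! i"
      using set_bs m by (auto simp: in_set_conv_nth less_Suc_eq_le)
    consider "j < i - 1" | "j = i - 1" | "j = i" | "i < j" using i by fastforce
    then show False
    proof cases
      case 1
      moreover have "i - 1 \<le> m" using i unfolding atLeastAtMost_iff by linarith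
      ultimately show False using less[of j "i - 1"] j(2) by linarith
    next
      case 4
      then show False using less[of i j] j by auto
    qed (use j in auto)
  qed
  show ?thesis
    unfolding compact_piecewise_log_affine_def
  proof (intro exI[of _ m] exI[of _ "\<lambda>i. T (bs ! i)"] conjI ballI allI impI m)
    fix i assume i: "i \<in> {1..m}"
    define a b where "a = bs ! (i - 1)" and "b = bs ! i"
    have ab: "0 \<le> a" "a < b" "b \<le> 1" "{a<..<b} \<inter> P = {}"
      using i in01[of "i - 1"] in01[of i] less[of "i - 1" i] gap[OF i] by (auto simp: a_def b_def)
    show "T (bs ! (i - 1)) < T (bs ! i)"
      using Tmono[OF ab(1-3)] by (simp add: a_def b_def)
    obtain s C where sC: "\<And>u. u \<in> {a<..<b} \<Longrightarrow> ln (I u) = s * Q u + C"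
      using ln_affine_on_segment[OF dq ab(1-3) aff[OF ab]] by blast
    have "0 < ?f x \<and> ln (?f x) = s * x + C" if "x \<in> {T a<..<T b}" for x
    proof -
      have "\<exists>u\<in>{a<..<b}. x = Q u" using between[OF ab(1-3), of x] that by auto
      then obtain u where u: "u \<in> {a<..<b}" "x = Q u" by blast
      then have u01: "0 < u" "u < 1" using ab by auto
      then show ?thesis
        using sC[OF u(1)] u(2) quantile_density_apply[OF dq u01] density_quantileD(2)[OF dq u01] by simp
    qed
    then show "\<exists>s C. \<forall>x\<in>{T (bs ! (i - 1))<..<T (bs ! i)}. 0 < ?f x \<and> ln (?f x) = s * x + C"
      unfolding a_def b_def by blast
  next
    fix x assume "x \<notin> {T (bs ! 0)..T (bs ! m)}"
    then have "x < lo \<or> hi < x" unfolding first last by (auto simp: T_def)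
    then have "x \<notin> Q ` {0<..<1}" using lo hi by fastforce
    then show "?f x = 0" by (simp add: quantile_density_def)
  qed
qed

section \<open>Point masses and the first-order condition for the minimizer\<close>

lemma density_quantile_ident: "density_quantile (\<lambda>_. 1) (\<lambda>u. u)"
  unfolding density_quantile_def has_supporting_lines_def
  by (auto intro!: exI[of _ 0] derivative_eq_intros)

lemma distr_const_unif01: "distr unif01 borel (\<lambda>_. a) = return borel a" for a :: real
  by (rule unif01.distr_const) simp

text \<open>The point mass is itself log-concave and a competitor at distance 0, so \<open>Q\<close>
  agrees with the step function almost everywhere.\<close>

lemma minimizer_eq_of_point_mass:
  assumes n: "0 < n" and proj: "quantile_projection (step_fun n y) Q"
    and pm: "point_mass (distr unif01 borel (step_fun n y))"
  shows "distr unif01 borel Q = distr unif01 borel (step_fun n y)"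
proof -
  let ?q = "step_fun n y"
  note [measurable] = quantile_projectionD(1)[OF proj]
  note Q2 = quantile_projectionD(2)[OF proj] and min = quantile_projectionD(3)[OF proj]
  obtain a where a: "distr unif01 borel ?q = return borel a" using pm by (auto simp: point_mass_def)
  have "AE z in distr unif01 borel ?q. z = a"
    unfolding a by (subst AE_return) auto
  then have AEq: "AE u in unif01. ?q u = a"
    by (subst (asm) AE_distr_iff) auto
  have "(\<integral>u. (Q u - ?q u)\<^sup>2 \<partial>unif01) \<le> (\<integral>u. (a - ?q u)\<^sup>2 \<partial>unif01)"
    by (rule min) (auto simp: distr_const_unif01 log_concave_distributions_def point_mass_def
        intro!: prob_space_return)
  also have "\<dots> = (\<integral>u. 0 \<partial>unif01)"
    using AEq by (intro integral_cong_AE) (auto elim: eventually_mono)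
  finally have "(\<integral>u. (Q u - ?q u)\<^sup>2 \<partial>unif01) = 0"
    by (simp add: antisym Bochner_Integration.integral_nonneg)
  then have "AE u in unif01. (Q u - ?q u)\<^sup>2 = 0"
    by (subst (asm) integral_nonneg_eq_0_iff_AE[OF integrable_square_step_diff[OF n _ Q2]]) auto
  then show ?thesis
    by (intro distr_cong_AE) (auto elim: eventually_mono)
qed

text \<open>The average of \<open>(q u - q (1/2)) (u - 1/2)\<close> is positive unless the increasing function \<open>q\<close> is
  constant, so a constant \<open>a\<close> is improved by \<open>a + t (u - 1/2)\<close> for small \<open>t\<close>.\<close>

lemma minimizer_not_const:
  assumes mono: "\<And>k l. k \<le> l \<Longrightarrow> l < n \<Longrightarrow> y k \<le> y l" and n: "0 < n"
    and proj: "quantile_projection (step_fun n y) (\<lambda>_. a)"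
  shows "point_mass (distr unif01 borel (step_fun n y))"
proof -
  let ?q = "step_fun n y"
  note min = quantile_projectionD(3)[OF proj]
  define h where "h u = u - 1 / 2" for u :: real
  have [measurable]: "h \<in> borel_measurable unif01"
    unfolding h_def[abs_def] by (intro continuous_on_imp_measurable_unif01 continuous_intros)
  have h_le: "\<bar>h u\<bar> \<le> 1" if "0 < u" "u < 1" for u using that by (auto simp: h_def)
  have h2: "integrable unif01 (\<lambda>u. (h u)\<^sup>2)"
  proof (rule unif01.integrable_const_bound[of _ 1], rule AE_I2)
    fix u assume "u \<in> space unif01"
    then show "norm ((h u)\<^sup>2) \<le> 1" using h_le[of u] by (simp add: abs_square_le_1)
  qed measurable
  have inth: "integrable unif01 h"
    by (rule integrable_of_square) (auto intro: unif01.finite_measure_axioms h2)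
  have "(\<integral>u. h (1 - u) \<partial>unif01) = (\<integral>u. - h u \<partial>unif01)"
    by (intro Bochner_Integration.integral_cong) (auto simp: h_def)
  then have h0: "(\<integral>u. h u \<partial>unif01) = 0" by (simp add: unif01_integral_reflect)
  have q2: "integrable unif01 (\<lambda>u. (c - ?q u)\<^sup>2)" for c
    by (intro integrable_square_step_diff n) auto
  have qh: "integrable unif01 (\<lambda>u. (c - ?q u) * h u)" for c
    by (rule integrable_mult_of_squares) (use q2 h2 in auto)
  have ah: "0 \<le> (\<integral>u. (a - ?q u) * h u \<partial>unif01)"
  proof (rule square_integral_first_order[OF _ _ q2 h2])
    fix t :: real assume t: "0 < t" "t < 1"
    \<comment> \<open>This is the quantile function of the uniform distribution on an interval of
      length \<open>t\<close>, whose density is the constant \<open>1 / t\<close>.\<close>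
    have dq: "density_quantile (\<lambda>_. 1 / t) (\<lambda>u. a + t * h u)"
      using density_quantile_shift[OF density_quantile_scale[OF density_quantile_ident t(1)], of "a - t / 2"]
      by (simp add: h_def algebra_simps)
    have "(\<integral>u. (a - ?q u)\<^sup>2 \<partial>unif01) \<le> (\<integral>u. (a + t * h u - ?q u)\<^sup>2 \<partial>unif01)"
    proof (rule min[OF _ _ density_quantile_log_concave[OF dq]])
      have "integrable unif01 (\<lambda>u. a\<^sup>2 + 2 * a * t * h u + t\<^sup>2 * (h u)\<^sup>2)"
        using inth h2 by auto
      then show "integrable unif01 (\<lambda>u. (a + t * h u)\<^sup>2)"
        by (simp add: power2_eq_square algebra_simps)
    qed measurable
    then show "(\<integral>u. (a - ?q u)\<^sup>2 \<partial>unif01) \<le> (\<integral>u. (a - ?q u + t * h u)\<^sup>2 \<partial>unif01)"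
      by (simp add: algebra_simps)
  qed measurable
  \<comment> \<open>As \<open>h\<close> has integral 0, the constant \<open>a\<close> can be
    exchanged for the value of the step function at 1/2, and then the integrand is nonnegative by
    monotonicity.\<close>
  define b where "b = ?q (1/2)"
  have "(\<integral>u. (?q u - b) * h u \<partial>unif01) = (\<integral>u. (a - b) * h u - (a - ?q u) * h u \<partial>unif01)"
    by (intro Bochner_Integration.integral_cong) (auto simp: algebra_simps)
  also have "\<dots> = - (\<integral>u. (a - ?q u) * h u \<partial>unif01)"
    using inth qh h0 by simp
  finally have eq: "(\<integral>u. (?q u - b) * h u \<partial>unif01) = - (\<integral>u. (a - ?q u) * h u \<partial>unif01)" .
  have nonneg: "0 \<le> (?q u - b) * h u" if "0 < u" "u < 1" for u
  proof (cases "u \<le> 1/2")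
    case True
    then show ?thesis
      using step_fun_mono[OF n that(1) True _ mono] by (intro mult_nonpos_nonpos) (auto simp: b_def h_def)
  next
    case False
    then have "1/2 \<le> u" by simp
    then show ?thesis
      using step_fun_mono[OF n _ _ that(2) mono, of "1/2"] by (intro mult_nonneg_nonneg) (auto simp: b_def h_def)
  qed
  have int: "integrable unif01 (\<lambda>u. (?q u - b) * h u)"
    using Bochner_Integration.integrable_minus[OF qh[of b]] by (simp add: algebra_simps)
  have "0 \<le> (\<integral>u. (?q u - b) * h u \<partial>unif01)"
    using nonneg by (intro integral_nonneg_AE AE_I2) auto
  with eq ah have "(\<integral>u. (?q u - b) * h u \<partial>unif01) = 0" by linarith
  then have "AE u in unif01. (?q u - b) * h u = 0"
    using nonneg by (subst (asm) integral_nonneg_eq_0_iff_AE[OF int]) (auto intro!: AE_I2)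
  moreover have "AE u in unif01. u \<noteq> 1/2"
  proof -
    have "AE u in lborel. u \<in> {0<..<1} \<longrightarrow> u \<noteq> (1/2 :: real)"
      using AE_lborel_singleton[of "1/2"] by eventually_elim simp
    then show ?thesis unfolding unif01_def by (simp add: AE_restrict_space_iff)
  qed
  ultimately have "AE u in unif01. ?q u = b"
    by eventually_elim (auto simp: h_def)
  then have "distr unif01 borel ?q = distr unif01 borel (\<lambda>_. b)"
    by (intro distr_cong_AE) auto
  then show ?thesis by (auto simp: distr_const_unif01 point_mass_def)
qed

text \<open>For \<open>0 < t < 1\<close> the function \<open>(1 - t) Q + t R\<close> stays in the
  cone and is a competitor, so the derivative of the objective at \<open>t = 0\<close> is
  nonnegative.\<close>

lemma minimizer_stationary:
  assumes n: "0 < n" and dq: "density_quantile I Q" and proj: "quantile_projection (step_fun n y) Q"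
  shows "stationary Q (step_fun n y)"
  unfolding stationary_def
proof (intro allI impI)
  let ?q = "step_fun n y"
  note Q2 = quantile_projectionD(2)[OF proj] and min = quantile_projectionD(3)[OF proj]
  fix J R assume dqR: "density_quantile J R" and R2: "integrable unif01 (\<lambda>u. (R u)\<^sup>2)"
  note [measurable] = density_quantile_measurable[OF dq] density_quantile_measurable[OF dqR]
  have D2: "integrable unif01 (\<lambda>u. (R u - Q u)\<^sup>2)"
    by (rule integrable_diff_square) (use R2 Q2 in auto)
  show "0 \<le> (\<integral>u. (Q u - ?q u) * (R u - Q u) \<partial>unif01)"
  proof (rule square_integral_first_order[OF _ _ _ D2])
    show "integrable unif01 (\<lambda>u. (Q u - ?q u)\<^sup>2)"
      by (intro integrable_square_step_diff n Q2) measurable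
    fix t :: real assume t: "0 < t" "t < 1"
    define K where "K u = (1 - t) * Q u + t * R u" for u
    obtain H where H: "density_quantile H K"
      using density_quantile_add[OF density_quantile_scale[OF dq, of "1 - t"] density_quantile_scale[OF dqR t(1)]] t
      unfolding K_def[abs_def] by auto
    have QR: "integrable unif01 (\<lambda>u. Q u * R u)"
      by (rule integrable_mult_of_squares) (use R2 Q2 in auto)
    have "integrable unif01 (\<lambda>u. (1 - t)\<^sup>2 * (Q u)\<^sup>2 + t\<^sup>2 * (R u)\<^sup>2 + 2 * (1 - t) * t * (Q u * R u))"
      using Q2 R2 QR by auto
    also have "(\<lambda>u. (1 - t)\<^sup>2 * (Q u)\<^sup>2 + t\<^sup>2 * (R u)\<^sup>2 + 2 * (1 - t) * t * (Q u * R u)) = (\<lambda>u. (K u)\<^sup>2)"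
      by (simp add: K_def power2_sum power_mult_distrib fun_eq_iff)
    finally have "(\<integral>u. (Q u - ?q u)\<^sup>2 \<partial>unif01) \<le> (\<integral>u. (K u - ?q u)\<^sup>2 \<partial>unif01)"
      by (rule min[OF density_quantile_measurable[OF H] _ density_quantile_log_concave[OF H]])
    also have "(\<integral>u. (K u - ?q u)\<^sup>2 \<partial>unif01) = (\<integral>u. (Q u - ?q u + t * (R u - Q u))\<^sup>2 \<partial>unif01)"
      by (intro Bochner_Integration.integral_cong arg_cong[where f = "\<lambda>z. z\<^sup>2"])
        (simp_all add: K_def algebra_simps)
    finally show "(\<integral>u. (Q u - ?q u)\<^sup>2 \<partial>unif01) \<le> (\<integral>u. (Q u - ?q u + t * (R u - Q u))\<^sup>2 \<partial>unif01)" .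
  qed measurable
qed

theorem theorem4p7:
  fixes n :: nat and x :: "nat \<Rightarrow> real" and \<mu>_hat :: "real measure"
  assumes "n \<ge> 1"
    and "is_W2_projection log_concave_distributions (empirical_measure n x) \<mu>_hat"
  shows "(point_mass (empirical_measure n x) \<longrightarrow> \<mu>_hat = empirical_measure n x) \<and>
         (\<not> point_mass (empirical_measure n x) \<longrightarrow>
            (\<exists>f. has_real_density \<mu>_hat f \<and> compact_piecewise_log_affine f))"
proof -
  have n: "0 < n" using assms(1) by simp
  obtain y where mono: "\<And>k l. k \<le> l \<Longrightarrow> l < n \<Longrightarrow> y k \<le> y l"
    and emp: "distr unif01 borel (step_fun n y) = empirical_measure n x"
    using empirical_measure_eq_distr_step_fun[OF assms(1)] by metis
  obtain Q where proj: "quantile_projection (step_fun n y) Q"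
    and Q: "distr unif01 borel Q = \<mu>_hat" "(\<exists>I. density_quantile I Q) \<or> (\<exists>a. Q = (\<lambda>_. a))"
    using W2_projection_minimizes[OF mono n assms(2)[folded emp]] by metis
  show ?thesis
  proof (intro conjI impI)
    assume "point_mass (empirical_measure n x)"
    then show "\<mu>_hat = empirical_measure n x"
      using minimizer_eq_of_point_mass[OF n proj] emp Q(1) by simp
  next
    assume npm: "\<not> point_mass (empirical_measure n x)"
    obtain I where dq: "density_quantile I Q"
    proof -
      have "Q \<noteq> (\<lambda>_. a)" for a
      proof
        assume "Q = (\<lambda>_. a)"
        then have "quantile_projection (step_fun n y) (\<lambda>_. a)" using proj by simp
        from minimizer_not_const[OF mono n this] npm emp show False by simp
      qed
      then show ?thesis using Q(2) that by blast
    qed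
    have st: "stationary Q (step_fun n y)"
      by (rule minimizer_stationary[OF n dq proj])
    obtain B where B: "\<And>u. 0 < u \<Longrightarrow> u < 1 \<Longrightarrow> \<bar>Q u\<bar> \<le> B"
      using stationary_bounded[OF dq quantile_projectionD(2)[OF proj] step_fun_measurable step_fun_bounded[OF n] st] by metis
    interpret stationary_quantile n y I Q B
      using n dq B st by unfold_locales
    obtain P where "finite P" "{0, 1} \<subseteq> P" "P \<subseteq> {0..1}"
      "\<And>a b. 0 \<le> a \<Longrightarrow> a < b \<Longrightarrow> b \<le> 1 \<Longrightarrow> {a<..<b} \<inter> P = {} \<Longrightarrow> affine_between a b I"
      using finite_breakpoints by blast
    then have "compact_piecewise_log_affine (quantile_density I Q)"
      by (intro compact_piecewise_log_affine_quantile_density[OF dq B])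
    then show "\<exists>f. has_real_density \<mu>_hat f \<and> compact_piecewise_log_affine f"
      using has_real_density_density_quantile[OF dq] Q(1) by metis
  qed
qed

end
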